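(* Let $N\ge 2$ be an integer and let $p,q,\sigma\in\mathbb R$ satisfy $$p+(1+\sigma)q<\frac{N+2}{N}+\sigma\qquad\text{with}\qquad 0<\sigma<\frac{1}{4}\left(\sqrt{\frac{N+8}{N}}-1\right).$$ Then the equation $-\Delta u=u^p|\nabla u|^q$ possesses no nontrivial positive solution in $\mathbb R^N$.
   Context: A (weak) solution of $-\Delta u=u^p|\nabla u|^q$ in $\mathbb R^N$ is a function $u\in C^1(\mathbb R^N)$ such that $u^p|\nabla u|^q\in L^1_{loc}(\mathbb R^N)$ and $\int_{\mathbb R^N}\langle\nabla u,\nabla\psi\rangle=\int_{\mathbb R^N}u^p|\nabla u|^q\psi$ for all $\psi\in C_0^\infty(\mathbb R^N)$. The exponents $p,q$ are real and may be negative; for $q<0$ the term $u^p|\nabla u|^q$ is singular (equal to $+\infty$) where $\nabla u=0$; for $q=0$ the equation is $-\Delta u=u^p$. A positive solution is called nontrivial if it is not constant. *)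

theory Defs
  imports "HOL-Analysis.Analysis"
begin

primrec C_k :: "nat \<Rightarrow> ('a::euclidean_space \<Rightarrow> real) \<Rightarrow> bool" where
  "C_k 0 f \<longleftrightarrow> continuous_on UNIV f"
| "C_k (Suc k) f \<longleftrightarrow>
     (\<forall>x. f differentiable (at x)) \<and>
     (\<forall>b\<in>Basis. C_k k (\<lambda>x. frechet_derivative f (at x) b))"

definition test_function :: "('a::euclidean_space \<Rightarrow> real) \<Rightarrow> bool" where
  "test_function \<psi> \<longleftrightarrow> (\<forall>k. C_k k \<psi>) \<and> compact (closure {x. \<psi> x \<noteq> 0})"

definition gradient :: "('a::euclidean_space \<Rightarrow> real) \<Rightarrow> 'a \<Rightarrow> 'a" where
  "gradient f x = (\<Sum>b\<in>Basis. frechet_derivative f (at x) b *\<^sub>R b)"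

text \<open>The power of a nonnegative real with values in \<open>[0, \<infinity>]\<close>: at \<open>0\<close> it is \<open>\<infinity>\<close> for a
  negative exponent and \<open>1\<close> for the exponent \<open>0\<close>, whereas \<open>0 powr q = 0\<close> for every \<open>q\<close>.\<close>

definition ext_powr :: "real \<Rightarrow> real \<Rightarrow> ennreal" where
  "ext_powr t q =
     (if t = 0 then (if q < 0 then \<infinity> else if q = 0 then 1 else 0) else ennreal (t powr q))"

text \<open>The right-hand side \<open>u\<^sup>p |\<nabla>u|\<^sup>q\<close>; it is used for positive \<open>u\<close> only, so that the first
  factor is finite and nonzero.\<close>

definition source :: "real \<Rightarrow> real \<Rightarrow> ('a::euclidean_space \<Rightarrow> real) \<Rightarrow> 'a \<Rightarrow> ennreal" where
  "source p q u x = ennreal (u x powr p) * ext_powr (norm (gradient u x)) q"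

definition locally_integrable :: "('a::euclidean_space \<Rightarrow> ennreal) \<Rightarrow> bool" where
  "locally_integrable F \<longleftrightarrow>
     F \<in> borel_measurable lebesgue \<and>
     (\<forall>K. compact K \<longrightarrow> (\<integral>\<^sup>+x\<in>K. F x \<partial>lebesgue) < \<infinity>)"

text \<open>Local integrability makes \<open>{x. source p q u x = \<infinity>}\<close> a null set, so its real part
  \<open>enn2real\<close> represents the same element of \<open>L\<^sup>1\<close> on compact sets.\<close>

definition positive_weak_solution :: "real \<Rightarrow> real \<Rightarrow> ('a::euclidean_space \<Rightarrow> real) \<Rightarrow> bool" where
  "positive_weak_solution p q u \<longleftrightarrow>
     C_k 1 u \<and>
     (\<forall>x. 0 < u x) \<and>
     locally_integrable (source p q u) \<and>
     (\<forall>\<psi>. test_function \<psi> \<longrightarrow>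
        (LINT x|lebesgue. gradient u x \<bullet> gradient \<psi> x)
          = (LINT x|lebesgue. enn2real (source p q u x) * \<psi> x))"

end

theory Submission
  imports Defs
begin

text \<open>Put \<open>v = u powr (- \<sigma>)\<close>, \<open>Z = |\<nabla>v|\<^sup>2\<close> and \<open>K = 1 + 1 / \<sigma>\<close>. Then \<open>\<Delta>v = H + K Z / v\<close>, where \<open>H\<close> is a
  constant times \<open>v powr A * Z powr (q / 2)\<close>. The hypotheses imply that, after the crude bound
  \<open>|D\<^sup>2v|\<^sup>2 \<ge> (\<Delta>v)\<^sup>2 / N\<close>, the terms \<open>H\<^sup>2\<close>, \<open>H Z / v\<close> and \<open>Z\<^sup>2 / v\<^sup>2\<close> in Bochner's formula for \<open>Z\<close> have
  nonnegative coefficients; the last one, \<open>c = K\<^sup>2 / N - K\<close>, is positive since \<open>\<sigma> N < 1\<close>. Testing the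
  formula with \<open>\<psi>\<^sup>n (Z - \<delta>)\<^sub>+\<^sup>m\<close> for a large \<open>m\<close> absorbs all gradient terms and bounds the
  integral of \<open>\<psi>\<^sup>n (Z - \<delta>)\<^sub>+\<^sup>m Z\<^sup>2 / v\<^sup>2\<close> over the ball of radius \<open>R\<close> by a constant times
  \<open>R ^ N * (sup v) ^ (2 m + 2) / R ^ (2 m + 4)\<close>. As \<open>u\<close> is superharmonic it decays at most like \<open>R powr (- N)\<close>, so
  \<open>v\<close> grows at most like \<open>R powr (\<sigma> N)\<close> and the bound tends to \<open>0\<close>.

  A weak solution need not be twice differentiable, and for \<open>q < 0\<close> the source is singular where
  \<open>\<nabla>u = 0\<close>. The estimate is therefore made for mollifications of \<open>u\<close>: they satisfy the equation up to
  an error that is uniformly small where \<open>Z > \<delta>\<close>, and derivatives of the error are avoided by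
  integrating by parts.\<close>

section \<open>The pointwise inequality\<close>

text \<open>The exponent of \<open>v\<close> in \<open>H\<close> is
  \<open>A = (1 + \<sigma> - p - (1 + \<sigma>) * q) / \<sigma>\<close>. The term
  \<open>H Z / v\<close> gets \<open>2 * K / N\<close> from squaring the Laplacian and
  \<open>A\<close> from differentiating \<open>H\<close> along the gradient of \<open>v\<close>; the
  hypothesis on \<open>p + (1 + \<sigma>) * q\<close> makes \<open>A + 2 * K / N\<close>
  nonnegative. Likewise \<open>c\<close> is \<open>K\<^sup>2 / N\<close> from the square minus
  \<open>K\<close> from differentiating \<open>1 / v\<close>. Two fields are combined, with
  \<open>P = \<psi>\<^sup>n (Z - \<delta>)\<^sub>+\<^sup>m\<close>:
  \<open>P (D\<^sup>2v \<nabla>v - \<Delta>v \<nabla>v)\<close>, whose divergence is free of third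
  derivatives, and \<open>P (H + K Z / v) \<nabla>v\<close>, whose divergence contains the Laplacian
  but no derivative of it. Both divergences have integral 0, and in their sum the error of the
  mollified equation occurs undifferentiated. The order of choices avoids uniform estimates: once
  \<open>m\<close> is fixed, a point \<open>x0\<close> with nonzero gradient determines
  \<open>\<delta>\<close> and a positive lower bound for the integral; then \<open>R\<close> makes
  the cutoff contribution small; the mollification radius comes last and may depend on
  \<open>R\<close>.\<close>

lemma young_weighted:
  fixes a x m :: real
  assumes "0 < m"
  shows "a * x \<le> m / 8 * a\<^sup>2 + 2 / m * x\<^sup>2"
proof -
  have "0 \<le> (m * a - 4 * x)\<^sup>2" by simp
  then have "8 * m * (a * x) \<le> m\<^sup>2 * a\<^sup>2 + 16 * x\<^sup>2"
    by (simp add: power2_eq_square algebra_simps)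
  then have "a * x \<le> (m\<^sup>2 * a\<^sup>2 + 16 * x\<^sup>2) / (8 * m)"
    using assms by (simp add: pos_le_divide_eq algebra_simps)
  also have "\<dots> = m / 8 * a\<^sup>2 + 2 / m * x\<^sup>2"
    using assms by (simp add: field_simps power2_eq_square)
  finally show ?thesis .
qed

text \<open>Either half of the good term \<open>c / 2 * Z\<^sup>2 / w\<^sup>2\<close> absorbs the
  cutoff term, or \<open>Z\<close> is bounded by a multiple of \<open>X / psi\<^sup>2\<close>, and
  then the cutoff term is bounded outright. The exponent \<open>n = 2 * m + 4\<close> is the one for
  which \<open>psi\<close> cancels from
  \<open>psi ^ n * (X / psi\<^sup>2) ^ (m + 2)\<close>.\<close>

lemma absorb_cutoff:
  fixes Z w c X psi W :: real and m n :: nat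
  assumes "0 < Z" "0 < c" "0 < w" "0 < psi" "0 \<le> X" "n = 2 * m + 4" "0 \<le> W" "W \<le> Z ^ m"
  shows "psi ^ n * W * (c / 4 * Z\<^sup>2 / w\<^sup>2) - (4 * w\<^sup>2 / c) ^ (m + 1) * X ^ (m + 2)
     \<le> psi ^ n * W * (c / 2 * Z\<^sup>2 / w\<^sup>2 - X / psi\<^sup>2 * Z)"
proof (cases "X / psi\<^sup>2 \<le> c / 4 * Z / w\<^sup>2")
  case True
  then have "X / psi\<^sup>2 * Z \<le> c / 4 * Z / w\<^sup>2 * Z"
    using assms(1) by (intro mult_right_mono) auto
  then have "c / 4 * Z\<^sup>2 / w\<^sup>2 \<le> c / 2 * Z\<^sup>2 / w\<^sup>2 - X / psi\<^sup>2 * Z"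
    by (simp add: power2_eq_square)
  then have "psi ^ n * W * (c / 4 * Z\<^sup>2 / w\<^sup>2) \<le> psi ^ n * W * (c / 2 * Z\<^sup>2 / w\<^sup>2 - X / psi\<^sup>2 * Z)"
    using assms by (intro mult_left_mono) auto
  moreover have "0 \<le> (4 * w\<^sup>2 / c) ^ (m + 1) * X ^ (m + 2)"
    using assms by (intro mult_nonneg_nonneg zero_le_power) auto
  ultimately show ?thesis by linarith
next
  case False
  then have "Z \<le> 4 * w\<^sup>2 / c * (X / psi\<^sup>2)"
    using assms by (simp add: field_simps)
  then have *: "Z ^ (m + 1) \<le> (4 * w\<^sup>2 / c * (X / psi\<^sup>2)) ^ (m + 1)"
    using assms by (intro power_mono) auto
  have "psi ^ n * W * (X / psi\<^sup>2 * Z) = psi ^ n * (X / psi\<^sup>2) * (W * Z)" by simp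
  also have "\<dots> \<le> psi ^ n * (X / psi\<^sup>2) * (Z ^ m * Z)"
    using assms by (intro mult_left_mono mult_right_mono) auto
  also have "\<dots> \<le> psi ^ n * (X / psi\<^sup>2) * (4 * w\<^sup>2 / c * (X / psi\<^sup>2)) ^ (m + 1)"
    using assms * by (intro mult_left_mono) (auto simp: mult.commute)
  also have "\<dots> = (4 * w\<^sup>2 / c) ^ (m + 1) * (psi ^ n * (X / psi\<^sup>2) ^ (m + 2))"
    by (simp only: power_mult_distrib power_add power_one_right) (simp add: power2_eq_square mult_ac)
  also have "psi ^ n * (X / psi\<^sup>2) ^ (m + 2) = X ^ (m + 2)"
  proof -
    have "psi ^ n = (psi\<^sup>2) ^ (m + 2)" using assms(6) by (simp add: add.commute power_add flip: power_mult)
    then have "psi ^ n * (X / psi\<^sup>2) ^ (m + 2) = (psi\<^sup>2 * (X / psi\<^sup>2)) ^ (m + 2)"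
      by (simp only: power_mult_distrib)
    then show ?thesis using assms(4) by simp
  qed
  finally have "psi ^ n * W * (X / psi\<^sup>2 * Z) \<le> (4 * w\<^sup>2 / c) ^ (m + 1) * X ^ (m + 2)" .
  moreover have "0 \<le> psi ^ n * W * (c / 4 * Z\<^sup>2 / w\<^sup>2)"
    using assms by (intro mult_nonneg_nonneg) auto
  moreover have "psi ^ n * W * (c / 2 * Z\<^sup>2 / w\<^sup>2 - X / psi\<^sup>2 * Z)
     = 2 * (psi ^ n * W * (c / 4 * Z\<^sup>2 / w\<^sup>2)) - psi ^ n * W * (X / psi\<^sup>2 * Z)"
    by (simp add: algebra_simps)
  moreover have "T - k \<le> U" if "S \<le> k" "0 \<le> T" "U = 2 * T - S" for S T U k :: real
    using that by linarith
  ultimately show ?thesis by blast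
qed

text \<open>Here \<open>s, a\<close> are the lengths of the gradients of \<open>v\<close> and \<open>Z\<close>, and \<open>I, J, L\<close> the inner
  products of the gradients of \<open>v, Z\<close>, of \<open>Z, \<psi>\<^sup>n\<close> and of \<open>v, \<psi>\<^sup>n\<close>.\<close>

lemma bernstein_pointwise:
  fixes Z w H K A q e s a D psi W W' G G0 I J L R N c :: real and m n :: nat
  assumes Z: "0 < Z" "s\<^sup>2 = Z" "0 < s" and w: "0 < w" and H: "0 \<le> H" and K: "0 < K" and N: "1 \<le> N"
    and m: "1 \<le> m" "q\<^sup>2 * N \<le> 2 * m" "4 * K\<^sup>2 \<le> m * c" and n: "n = 2 * m + 4"
    and psi: "0 < psi" "psi \<le> 1" and W: "0 \<le> W" "m * W \<le> W' * Z" "W \<le> Z ^ m" "W' \<le> m * Z ^ (m - 1)"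
    and G0: "G0 = H + K * Z / w" "G = G0 + e" and D: "G\<^sup>2 \<le> N * D"
    and c: "c = K\<^sup>2 / N - K" "0 < c" and A: "0 \<le> A + 2 * K / N"
    and a: "0 \<le> a" and I: "\<bar>I\<bar> \<le> s * a" and J: "\<bar>J\<bar> \<le> a * (n * psi ^ (n - 1) * (2 / R))"
    and L: "\<bar>L\<bar> \<le> s * (n * psi ^ (n - 1) * (2 / R))" and R: "0 < R"
    and e: "\<bar>e\<bar> \<le> \<eta>" "\<eta> \<le> 1"
  shows "psi ^ n * W * (c / 4 * Z\<^sup>2 / w\<^sup>2)
     - (4 * w\<^sup>2 / c) ^ (m + 1) * (2 * n\<^sup>2 / (m * R\<^sup>2)) ^ (m + 2)
     - \<eta> * (Z ^ m * (3 * G0 + 1 + 2 * m + s * (2 * n / R)))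
   \<le> psi ^ n * W * D + (psi ^ n * W' * a\<^sup>2 + W * J) / 2
     - e * (psi ^ n * W * G + psi ^ n * W' * I + W * L)
     + psi ^ n * W * (H * (A * Z / w + q / 2 * I / Z) + K * (I / w - Z\<^sup>2 / w\<^sup>2))"
proof -
  define f where "f = psi ^ n"
  have f: "0 < f" "f \<le> 1" using psi by (auto simp: f_def power_le_one)
  have m0: "0 < real m" using m by simp
  have W': "0 \<le> W'" using W Z m0
    by (metis mult_nonneg_nonneg of_nat_0_le_iff order_trans zero_le_mult_iff linorder_not_less mult.commute)
  \<comment> \<open>The ratio \<open>|\<nabla>Z| / |\<nabla>v|\<close>. In this unit each cross term
    is \<open>y\<close> times a quantity free of derivatives of \<open>Z\<close>, ready for Young's
    inequality.\<close>
  define y where "y = a / s"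
  have y: "a = s * y" "0 \<le> y" using Z a by (auto simp: y_def)
  have a2: "a\<^sup>2 = Z * y\<^sup>2" by (simp add: y(1) power_mult_distrib Z(2))
  have sy: "s * a = Z * y" using y(1) Z(2) by (simp add: power2_eq_square)
  \<comment> \<open>The term \<open>W' * a\<^sup>2 / 2\<close> is thus worth at least
    \<open>m / 2 * W * y\<^sup>2\<close>. It is spent in four equal parts: on \<open>qterm\<close>,
    \<open>Kterm\<close>, \<open>Xterm\<close> and, in \<open>b4\<close>, on the error times
    \<open>I\<close>.\<close>
  have mW: "m * W * y\<^sup>2 \<le> W' * a\<^sup>2"
  proof -
    have "m * W * y\<^sup>2 \<le> W' * Z * y\<^sup>2" using W(2) by (intro mult_right_mono) auto
    then show ?thesis by (simp add: a2)
  qed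
  \<comment> \<open>\<open>2 * X\<close> bounds the logarithmic gradient of the cutoff power
    \<open>psi ^ n\<close>.\<close>
  define X where "X = n / (R * psi)"
  have B: "n * psi ^ (n - 1) * (2 / R) = f * (2 * X)"
  proof -
    have "psi ^ n = psi ^ (n - 1) * psi" using n by (simp add: numeral_eq_Suc)
    then show ?thesis using psi R by (simp add: f_def X_def field_simps)
  qed
  have G0n: "0 \<le> G0" using G0 H K Z w by simp
  have eta: "0 \<le> \<eta>" using e by linarith
  have e2: "e\<^sup>2 \<le> \<eta>"
  proof -
    have "e\<^sup>2 = \<bar>e\<bar> * \<bar>e\<bar>" by (simp add: power2_eq_square)
    also have "\<dots> \<le> \<eta> * 1" using e by (intro mult_mono) auto
    finally show ?thesis by simp
  qed
  have hess: "G0\<^sup>2 / N - 2 * (\<eta> * G0) \<le> D"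
  proof -
    have "\<bar>e * G0\<bar> \<le> \<eta> * G0" unfolding abs_mult using e(1) G0n by (intro mult_mono) auto
    then have "- (\<eta> * G0) \<le> e * G0" using abs_ge_minus_self[of "e * G0"] by linarith
    moreover have "G\<^sup>2 = G0\<^sup>2 + 2 * (e * G0) + e\<^sup>2" by (simp add: G0(2) power2_sum)
    ultimately have "G0\<^sup>2 - 2 * (\<eta> * G0) \<le> G\<^sup>2" using zero_le_power2[of e] by linarith
    then have "G0\<^sup>2 - 2 * (\<eta> * G0) \<le> N * D" using D by linarith
    then have "(G0\<^sup>2 - 2 * (\<eta> * G0)) / N \<le> D" using N by (simp add: pos_divide_le_eq mult.commute)
    moreover have "2 * (\<eta> * G0) / N \<le> 2 * (\<eta> * G0) / 1"
      using N eta G0n by (intro divide_left_mono) auto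
    ultimately show ?thesis by (simp add: diff_divide_distrib)
  qed
  have eG: "e * G \<le> \<eta> * (G0 + 1)"
  proof -
    have "e * G0 \<le> \<eta> * G0" using e(1) G0n by (intro mult_right_mono) auto
    then show ?thesis using e2 by (simp add: G0(2) algebra_simps power2_eq_square)
  qed
  \<comment> \<open>The condition \<open>q\<^sup>2 * N \<le> 2 * m\<close> is made for this: the
    remainder in Young's inequality does not exceed the \<open>H\<^sup>2 / N\<close> contained in
    \<open>G0\<^sup>2 / N\<close>.\<close>
  have qterm: "- (m / 8 * y\<^sup>2 + H\<^sup>2 / N) \<le> H * (q / 2 * I / Z)"
  proof -
    have "\<bar>I\<bar> / Z \<le> y" using I Z sy by (simp add: pos_divide_le_eq mult.commute)
    then have "\<bar>H * (q / 2 * I / Z)\<bar> \<le> y * (H * \<bar>q\<bar> / 2)"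
      using mult_left_mono[of "\<bar>I\<bar> / Z" y "H * \<bar>q\<bar> / 2"] H Z by (simp add: abs_mult mult_ac)
    also have "\<dots> \<le> m / 8 * y\<^sup>2 + 2 / m * (H * \<bar>q\<bar> / 2)\<^sup>2" by (rule young_weighted[OF m0])
    also have "2 / m * (H * \<bar>q\<bar> / 2)\<^sup>2 = q\<^sup>2 / (2 * m) * H\<^sup>2" by (simp add: power_mult_distrib power_divide)
    also have "\<dots> \<le> 1 / N * H\<^sup>2"
      using m N m0 by (intro mult_right_mono) (auto simp: field_simps)
    finally have "\<bar>H * (q / 2 * I / Z)\<bar> \<le> m / 8 * y\<^sup>2 + 1 / N * H\<^sup>2" by simp
    then have "- (m / 8 * y\<^sup>2 + 1 / N * H\<^sup>2) \<le> H * (q / 2 * I / Z)" by (rule abs_le_iff[THEN iffD1, THEN conjunct2, THEN minus_le_iff[THEN iffD1]])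
    then show ?thesis by simp
  qed
  \<comment> \<open>Similarly \<open>4 * K\<^sup>2 \<le> m * c\<close> limits the remainder to half
    of \<open>c * Z\<^sup>2 / w\<^sup>2\<close>. The other half is left for
    \<open>absorb_cutoff\<close>.\<close>
  have Kterm: "- (m / 8 * y\<^sup>2 + c / 2 * (Z\<^sup>2 / w\<^sup>2)) \<le> K * (I / w)"
  proof -
    have "\<bar>K * (I / w)\<bar> \<le> y * (K * Z / w)"
      using mult_left_mono[OF I, of "K / w"] K w sy by (simp add: abs_mult mult_ac)
    also have "\<dots> \<le> m / 8 * y\<^sup>2 + 2 / m * (K * Z / w)\<^sup>2" by (rule young_weighted[OF m0])
    also have "2 / m * (K * Z / w)\<^sup>2 = 2 * K\<^sup>2 / m * (Z\<^sup>2 / w\<^sup>2)"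
      by (simp add: power_mult_distrib power_divide)
    also have "\<dots> \<le> c / 2 * (Z\<^sup>2 / w\<^sup>2)"
      using m(3) m0 by (intro mult_right_mono) (auto simp: field_simps)
    finally have "\<bar>K * (I / w)\<bar> \<le> m / 8 * y\<^sup>2 + c / 2 * (Z\<^sup>2 / w\<^sup>2)" by simp
    then show ?thesis by (rule abs_le_iff[THEN iffD1, THEN conjunct2, THEN minus_le_iff[THEN iffD1]])
  qed
  have Xterm: "y * (s * X) \<le> m / 8 * y\<^sup>2 + 2 / m * (Z * X\<^sup>2)"
    using young_weighted[OF m0, of y "s * X"] by (simp add: power_mult_distrib Z(2))
  have sq: "G0\<^sup>2 / N + H * (A * Z / w) - K * (Z\<^sup>2 / w\<^sup>2)
      = H\<^sup>2 / N + (A + 2 * K / N) * (H * Z / w) + c * (Z\<^sup>2 / w\<^sup>2)"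
    using N w by (simp add: diff_divide_distrib G0(1) c(1) power2_sum power_mult_distrib power_divide add_divide_distrib algebra_simps)
  have "0 \<le> (A + 2 * K / N) * (H * Z / w)" using A H Z w by (intro mult_nonneg_nonneg) auto
  then have bracket: "c / 2 * (Z\<^sup>2 / w\<^sup>2) - 2 / m * (Z * X\<^sup>2) - 3 * (m / 8 * y\<^sup>2) - \<eta> * (3 * G0 + 1)
     \<le> D - e * G + H * (A * Z / w) + H * (q / 2 * I / Z) + K * (I / w) - K * (Z\<^sup>2 / w\<^sup>2) - y * (s * X)"
    (is "?l \<le> ?r")
    using hess eG qterm Kterm Xterm sq by (simp add: algebra_simps)
  have fW: "0 \<le> f * W" "f * W \<le> Z ^ m"
    using f W mult_mono[of f 1 W W] by (auto)
  have b1: "f * W * ?l \<le> f * W * ?r" using bracket fW by (intro mult_left_mono)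
  have b2: "f * W * (\<eta> * (3 * G0 + 1)) \<le> Z ^ m * (\<eta> * (3 * G0 + 1))"
    using fW eta G0n by (intro mult_right_mono) auto
  have b3: "- (f * W * (y * (s * X))) \<le> W * J / 2"
  proof -
    have "\<bar>J\<bar> \<le> 2 * (f * (y * (s * X)))" using J unfolding B by (simp add: y(1) mult_ac)
    then have "W * \<bar>J\<bar> \<le> W * (2 * (f * (y * (s * X))))" using W by (intro mult_left_mono)
    moreover have "- (W * \<bar>J\<bar>) \<le> W * J" using W by (metis abs_ge_minus_self minus_le_iff mult_left_mono mult_minus_right)
    ultimately show ?thesis by (simp add: mult_ac)
  qed
  have W'Z: "W' * Z \<le> m * Z ^ m"
  proof -
    have "W' * Z \<le> m * Z ^ (m - 1) * Z" using W(4) Z by (intro mult_right_mono) auto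
    also have "\<dots> = m * Z ^ m" using m by (simp add: power_eq_if)
    finally show ?thesis .
  qed
  have b4: "f * W * (3 * (m / 8 * y\<^sup>2)) - \<eta> * (2 * m * Z ^ m) \<le> f * W' * a\<^sup>2 / 2 - e * (f * W' * I)"
  proof -
    have "e * I \<le> \<bar>e\<bar> * \<bar>I\<bar>" by (simp flip: abs_mult)
    also have "\<dots> \<le> \<bar>e\<bar> * (s * a)" using I by (intro mult_left_mono) auto
    also have "\<dots> = a * (s * \<bar>e\<bar>)" by simp
    also have "\<dots> \<le> 1 / 8 * a\<^sup>2 + 2 / 1 * (s * \<bar>e\<bar>)\<^sup>2" by (rule young_weighted) simp
    also have "\<dots> \<le> a\<^sup>2 / 8 + 2 * (Z * \<eta>)"
      using mult_left_mono[OF e2, of Z] Z by (simp add: power_mult_distrib)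
    finally have "f * W' * (e * I) \<le> f * W' * (a\<^sup>2 / 8 + 2 * (Z * \<eta>))"
      using f W' by (intro mult_left_mono) auto
    moreover have "f * (m * W * y\<^sup>2) \<le> f * (W' * a\<^sup>2)" using mW f by (intro mult_left_mono) auto
    moreover have "f * (W' * Z * \<eta>) \<le> 1 * (m * Z ^ m * \<eta>)"
    proof (rule mult_mono)
      show "W' * Z * \<eta> \<le> m * Z ^ m * \<eta>" using W'Z eta by (rule mult_right_mono)
    qed (use f W' Z eta in auto)
    ultimately show ?thesis by (simp add: algebra_simps)
  qed
  have b5: "e * (W * L) \<le> \<eta> * (Z ^ m * (s * (2 * n / R)))"
  proof -
    have "psi ^ (n - 1) \<le> 1" using psi by (simp add: power_le_one)
    then have "n * psi ^ (n - 1) * (2 / R) \<le> n * 1 * (2 / R)"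
      using R mult_left_le[of "psi ^ (n - 1)" n] by (intro mult_right_mono) auto
    then have "\<bar>L\<bar> \<le> s * (n * 1 * (2 / R))"
      by (rule order_trans[OF L mult_left_mono]) (use Z in simp)
    then have "\<bar>e\<bar> * (W * \<bar>L\<bar>) \<le> \<eta> * (Z ^ m * (s * (2 * n / R)))"
      using e eta W Z by (intro mult_mono) (auto simp: mult.commute)
    moreover have "\<bar>e * (W * L)\<bar> = \<bar>e\<bar> * (W * \<bar>L\<bar>)"
      using W(1) by (simp add: abs_mult)
    ultimately show ?thesis by (metis abs_ge_self order_trans)
  qed
  have X: "2 / m * (Z * X\<^sup>2) = 2 * n\<^sup>2 / (m * R\<^sup>2) / psi\<^sup>2 * Z"
    using psi R m0 by (simp add: X_def power_divide power_mult_distrib mult_ac)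
  have "psi ^ n * W * (c / 4 * Z\<^sup>2 / w\<^sup>2) - (4 * w\<^sup>2 / c) ^ (m + 1) * (2 * n\<^sup>2 / (m * R\<^sup>2)) ^ (m + 2)
     \<le> psi ^ n * W * (c / 2 * Z\<^sup>2 / w\<^sup>2 - 2 * n\<^sup>2 / (m * R\<^sup>2) / psi\<^sup>2 * Z)"
    using Z c w psi n W by (intro absorb_cutoff) auto
  then have b6: "psi ^ n * W * (c / 4 * Z\<^sup>2 / w\<^sup>2) - (4 * w\<^sup>2 / c) ^ (m + 1) * (2 * n\<^sup>2 / (m * R\<^sup>2)) ^ (m + 2)
     \<le> f * W * (c / 2 * (Z\<^sup>2 / w\<^sup>2)) - f * W * (2 / m * (Z * X\<^sup>2))"
    unfolding X by (simp add: f_def right_diff_distrib)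
  have r: "psi ^ n * W * D + (psi ^ n * W' * a\<^sup>2 + W * J) / 2
     - e * (psi ^ n * W * G + psi ^ n * W' * I + W * L)
     + psi ^ n * W * (H * (A * Z / w + q / 2 * I / Z) + K * (I / w - Z\<^sup>2 / w\<^sup>2))
     = f * W * ?r + f * W * (y * (s * X)) + W * J / 2 + (f * W' * a\<^sup>2 / 2 - e * (f * W' * I)) - e * (W * L)"
    by (simp add: f_def[symmetric] algebra_simps add_divide_distrib)
  have l: "f * W * ?l = f * W * (c / 2 * (Z\<^sup>2 / w\<^sup>2)) - f * W * (2 / m * (Z * X\<^sup>2))
     - f * W * (3 * (m / 8 * y\<^sup>2)) - f * W * (\<eta> * (3 * G0 + 1))"
    by (simp only: right_diff_distrib)
  have k: "\<eta> * (Z ^ m * (3 * G0 + 1 + 2 * m + s * (2 * n / R)))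
     = Z ^ m * (\<eta> * (3 * G0 + 1)) + \<eta> * (2 * m * Z ^ m) + \<eta> * (Z ^ m * (s * (2 * n / R)))"
    by (simp add: algebra_simps)
  show ?thesis unfolding r k using b1 b2 b3 b4 b5 b6 l by linarith
qed

section \<open>Partial derivatives and integration by parts\<close>

text \<open>Only derivatives along lines are recorded. Together with continuity they suffice for
  differentiation under the integral sign and integration by parts, and all rules reduce to one
  variable.\<close>

definition has_partial :: "('a::real_vector \<Rightarrow> real) \<Rightarrow> 'a \<Rightarrow> ('a \<Rightarrow> real) \<Rightarrow> bool" where
  "has_partial f b f' \<longleftrightarrow> (\<forall>x. ((\<lambda>t. f (x + t *\<^sub>R b)) has_real_derivative f' x) (at 0))"

lemma has_partialD: "has_partial f b f' \<Longrightarrow> ((\<lambda>t. f (x + t *\<^sub>R b)) has_real_derivative f' x) (at 0)"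
  by (simp add: has_partial_def)

lemma has_partial_at:
  assumes "has_partial f b f'"
  shows "((\<lambda>t. f (x + t *\<^sub>R b)) has_real_derivative f' (x + s *\<^sub>R b)) (at s)"
proof -
  have "((\<lambda>t. f ((x + s *\<^sub>R b) + t *\<^sub>R b)) has_real_derivative f' (x + s *\<^sub>R b)) (at 0)"
    using assms by (rule has_partialD)
  then have "((\<lambda>t. f (x + (t + s) *\<^sub>R b)) has_real_derivative f' (x + s *\<^sub>R b)) (at 0)"
    by (simp add: algebra_simps)
  then show ?thesis
    using DERIV_shift[of "\<lambda>t. f (x + t *\<^sub>R b)" "f' (x + s *\<^sub>R b)" 0 s] by simp
qed

lemma has_partial_const: "has_partial (\<lambda>_. c) b (\<lambda>_. 0)"
  by (simp add: has_partial_def)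

lemma has_partial_add:
  "has_partial f b f' \<Longrightarrow> has_partial g b g' \<Longrightarrow> has_partial (\<lambda>x. f x + g x) b (\<lambda>x. f' x + g' x)"
  by (auto simp: has_partial_def intro!: derivative_intros)

lemma has_partial_diff:
  "has_partial f b f' \<Longrightarrow> has_partial g b g' \<Longrightarrow> has_partial (\<lambda>x. f x - g x) b (\<lambda>x. f' x - g' x)"
  by (auto simp: has_partial_def intro!: derivative_intros)

lemma has_partial_mult:
  assumes "has_partial f b f'" "has_partial g b g'"
  shows "has_partial (\<lambda>x. f x * g x) b (\<lambda>x. f' x * g x + f x * g' x)"
  unfolding has_partial_def
proof
  fix x
  show "((\<lambda>t. f (x + t *\<^sub>R b) * g (x + t *\<^sub>R b)) has_real_derivative f' x * g x + f x * g' x) (at 0)"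
    using DERIV_mult[OF has_partialD[OF assms(1), of x] has_partialD[OF assms(2), of x]]
    by (simp add: add.commute mult.commute)
qed

lemma has_partial_sum:
  "(\<And>i. i \<in> S \<Longrightarrow> has_partial (f i) b (f' i)) \<Longrightarrow> has_partial (\<lambda>x. \<Sum>i\<in>S. f i x) b (\<lambda>x. \<Sum>i\<in>S. f' i x)"
  by (auto simp: has_partial_def intro!: DERIV_sum)

lemma has_partial_compose:
  assumes "has_partial f b f'" and "\<And>x. (g has_real_derivative g' (f x)) (at (f x))"
  shows "has_partial (\<lambda>x. g (f x)) b (\<lambda>x. g' (f x) * f' x)"
  unfolding has_partial_def
proof
  fix x
  show "((\<lambda>t. g (f (x + t *\<^sub>R b))) has_real_derivative g' (f x) * f' x) (at 0)"
    by (rule DERIV_chain2[of g _ "\<lambda>t. f (x + t *\<^sub>R b)"]) (use assms in \<open>auto dest: has_partialD\<close>)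
qed

lemma has_partial_cong:
  "has_partial f b f' \<Longrightarrow> (\<And>x. f x = g x) \<Longrightarrow> (\<And>x. f' x = g' x) \<Longrightarrow> has_partial g b g'"
  by (metis ext)

section \<open>Integrals of compactly supported functions\<close>

lemma integrable_compact_support:
  fixes f :: "'a::euclidean_space \<Rightarrow> real"
  assumes "continuous_on UNIV f" "\<And>x. x \<notin> cbox a b \<Longrightarrow> f x = 0"
  shows "integrable lborel f" "(LINT x|lborel. f x) = integral (cbox a b) f"
proof -
  have eq: "f = (\<lambda>x. indicator (cbox a b) x *\<^sub>R f x)"
    using assms(2) by (auto simp: fun_eq_iff indicator_def)
  have "integrable lborel (\<lambda>x. indicator (cbox a b) x *\<^sub>R f x)"
    using assms(1) by (intro borel_integrable_compact) (auto intro: continuous_on_subset)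
  then show i: "integrable lborel f" using eq by simp
  have "integral UNIV f = integral (cbox a b) f"
  proof (rule integral_unique, rule has_integral_on_superset)
    show "(f has_integral integral (cbox a b) f) (cbox a b)"
      by (intro integrable_integral integrable_continuous continuous_on_subset[OF assms(1)]) simp
  qed (use assms(2) in auto)
  then show "(LINT x|lborel. f x) = integral (cbox a b) f"
    using integral_lborel[OF i] by simp
qed

lemma lborel_integral_translation:
  fixes f :: "'a::euclidean_space \<Rightarrow> real"
  assumes "f \<in> borel_measurable borel"
  shows "(LINT x|lborel. f (x + c)) = (LINT x|lborel. f x)"
proof -
  have "(LINT x|lborel. f x) = (LINT x|distr lborel borel ((+) c). f x)"
    by (simp add: lborel_distr_plus)
  also have "\<dots> = (LINT x|lborel. f (c + x))"
    using assms by (intro integral_distr) auto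
  finally show ?thesis by (simp add: add.commute)
qed

text \<open>A support common to all \<open>\<bar>t\<bar> < 1\<close> replaces the integral over the
  whole space by one over a fixed box, where the Leibniz rule applies.\<close>

lemma has_derivative_integral_compact:
  fixes G G' :: "real \<Rightarrow> 'a::euclidean_space \<Rightarrow> real"
  assumes deriv: "\<And>t x. ((\<lambda>s. G s x) has_real_derivative G' t x) (at t)"
    and contG: "\<And>t. continuous_on UNIV (G t)"
    and cont: "continuous_on UNIV (\<lambda>(t, x). G' t x)"
    and zero: "\<And>t x. \<bar>t\<bar> < 1 \<Longrightarrow> x \<notin> cbox a b \<Longrightarrow> G t x = 0"
  shows "((\<lambda>t. LINT x|lborel. G t x) has_real_derivative (LINT x|lborel. G' 0 x)) (at 0)"
proof -
  let ?U = "{-1<..<1::real}"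
  have zero': "G' 0 x = 0" if "x \<notin> cbox a b" for x
  proof -
    have "((\<lambda>s. G s x) has_real_derivative 0) (at 0)"
      by (rule has_field_derivative_transform_within_open[of "\<lambda>_. 0" 0 0 ?U])
         (auto simp: zero that)
    then show ?thesis using deriv DERIV_unique by blast
  qed
  have cont0: "continuous_on UNIV (G' 0)"
    using continuous_on_compose2[OF cont, of UNIV "\<lambda>x. (0, x)"] by (simp add: continuous_on_Pair)
  have "((\<lambda>t. integral (cbox a b) (G t)) has_real_derivative integral (cbox a b) (G' 0)) (at 0 within ?U)"
  proof (rule leibniz_rule_field_derivative)
    show "((\<lambda>t. G t x) has_real_derivative G' t x) (at t within ?U)" for t x
      by (rule has_field_derivative_at_within[OF deriv])
    show "G t integrable_on cbox a b" for t
      by (rule integrable_continuous) (rule continuous_on_subset[OF contG], simp)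
    show "continuous_on (?U \<times> cbox a b) (\<lambda>(t, x). G' t x)"
      by (rule continuous_on_subset[OF cont]) simp
  qed auto
  then have "((\<lambda>t. integral (cbox a b) (G t)) has_real_derivative integral (cbox a b) (G' 0)) (at 0)"
    by (simp add: at_within_open[of 0 ?U])
  then have "((\<lambda>t. LINT x|lborel. G t x) has_real_derivative integral (cbox a b) (G' 0)) (at 0)"
  proof (rule has_field_derivative_transform_within_open[where S = ?U])
    fix t :: real assume "t \<in> ?U"
    then show "integral (cbox a b) (G t) = (LINT x|lborel. G t x)"
      using integrable_compact_support(2)[OF contG[of t], of a b] zero[of t] by auto
  qed auto
  then show ?thesis
    using integrable_compact_support(2)[OF cont0, of a b] zero' by simp
qed

lemma bounded_subset_cbox_obtain:
  fixes S :: "'a::euclidean_space set"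
  assumes "bounded S" obtains a b where "S \<subseteq> cbox a b"
  using assms bounded_subset_cbox_symmetric by metis

text \<open>By translation invariance the integral of \<open>g (x + t *\<^sub>R b)\<close> does not
  depend on \<open>t\<close>; its derivative at \<open>t = 0\<close> is the integral of
  \<open>g'\<close>. No iterated integrals are involved.\<close>

lemma integral_partial_eq_0:
  fixes g g' :: "'a::euclidean_space \<Rightarrow> real"
  assumes "has_partial g b g'" and cont: "continuous_on UNIV g" "continuous_on UNIV g'"
    and zero: "\<And>x. R \<le> norm x \<Longrightarrow> g x = 0"
  shows "(LINT x|lborel. g' x) = 0"
proof -
  obtain l r where lr: "cball (0::'a) (R + norm b) \<subseteq> cbox l r"
    by (rule bounded_subset_cbox_obtain[OF bounded_cball])
  have "((\<lambda>t. LINT x|lborel. g (x + t *\<^sub>R b)) has_real_derivative (LINT x|lborel. g' (x + 0 *\<^sub>R b))) (at 0)"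
  proof (rule has_derivative_integral_compact)
    show "((\<lambda>t. g (x + t *\<^sub>R b)) has_real_derivative g' (x + t *\<^sub>R b)) (at t)" for t x
      by (rule has_partial_at[OF assms(1)])
    show "continuous_on UNIV (\<lambda>x. g (x + t *\<^sub>R b))" for t
      by (intro continuous_on_compose2[OF cont(1)] continuous_intros) auto
    show "continuous_on UNIV (\<lambda>(t, x). g' (x + t *\<^sub>R b))"
      unfolding split_beta by (intro continuous_on_compose2[OF cont(2)] continuous_intros) auto
    show "g (x + t *\<^sub>R b) = 0" if "\<bar>t\<bar> < 1" "x \<notin> cbox l r" for t x
    proof (rule zero)
      have "norm (t *\<^sub>R b) \<le> norm b" using that(1) by (simp add: mult_left_le_one_le)
      moreover have "R + norm b < norm x" using that(2) lr by (auto simp: subset_iff not_le[symmetric])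
      ultimately show "R \<le> norm (x + t *\<^sub>R b)" using norm_diff_ineq[of x "t *\<^sub>R b"] by simp
    qed
  qed
  moreover have "(\<lambda>t. LINT x|lborel. g (x + t *\<^sub>R b)) = (\<lambda>t. LINT x|lborel. g x)"
    by (intro ext lborel_integral_translation borel_measurable_continuous_onI cont)
  ultimately have "((\<lambda>t::real. LINT x|lborel. g x) has_real_derivative (LINT x|lborel. g' x)) (at 0)"
    by simp
  then show ?thesis using DERIV_unique DERIV_const by blast
qed

lemma partial_zero_outside:
  fixes k :: "'a::real_normed_vector \<Rightarrow> real"
  assumes "has_partial k b k'" "\<And>x. r \<le> norm x \<Longrightarrow> k x = 0" "r < norm x"
  shows "k' x = 0"
proof -
  have "open {t::real. r < norm (x + t *\<^sub>R b)}"
    by (intro open_Collect_less continuous_intros)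
  then have "((\<lambda>t. k (x + t *\<^sub>R b)) has_real_derivative 0) (at 0)"
    by (rule has_field_derivative_transform_within_open[of "\<lambda>_. 0" 0 0, rotated]) (auto simp: assms)
  then show ?thesis using has_partialD[OF assms(1)] DERIV_unique by blast
qed

section \<open>Convolution with a compactly supported kernel\<close>

lemma continuous_convolution:
  fixes g k :: "'a::euclidean_space \<Rightarrow> real"
  assumes cont: "continuous_on UNIV g" "continuous_on UNIV k" and zero: "\<And>x. r \<le> norm x \<Longrightarrow> k x = 0"
  shows "continuous_on UNIV (\<lambda>x. LINT y|lborel. g y * k (x - y))"
proof (rule continuous_at_imp_continuous_on, intro ballI)
  fix x0 :: 'a
  obtain l u where lu: "cball (0::'a) (norm x0 + 1 + r) \<subseteq> cbox l u"
    by (rule bounded_subset_cbox_obtain[OF bounded_cball])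
  have "continuous_on (ball x0 1) (\<lambda>x. integral (cbox l u) (\<lambda>y. g y * k (x - y)))"
  proof (rule integral_continuous_on_param)
    show "continuous_on (ball x0 1 \<times> cbox l u) (\<lambda>(x, y). g y * k (x - y))"
      unfolding split_beta
      by (intro continuous_intros continuous_on_compose2[OF cont(1)] continuous_on_compose2[OF cont(2)]) auto
  qed
  moreover have "integral (cbox l u) (\<lambda>y. g y * k (x - y)) = (LINT y|lborel. g y * k (x - y))"
    if "x \<in> ball x0 1" for x
  proof (rule integrable_compact_support(2)[symmetric])
    show "continuous_on UNIV (\<lambda>y. g y * k (x - y))"
      by (intro continuous_intros continuous_on_compose2[OF cont(1)] continuous_on_compose2[OF cont(2)]) auto
    fix y assume "y \<notin> cbox l u"
    then have "norm x0 + 1 + r < norm y" using lu by (auto simp: subset_iff not_le[symmetric])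
    moreover have "norm x \<le> norm x0 + 1"
      using that norm_triangle_sub[of x x0] by (simp add: dist_norm norm_minus_commute)
    ultimately have "r \<le> norm (x - y)" using norm_triangle_ineq2[of y x] by (simp add: norm_minus_commute)
    then show "g y * k (x - y) = 0" by (simp add: zero)
  qed
  ultimately have "continuous_on (ball x0 1) (\<lambda>x. LINT y|lborel. g y * k (x - y))"
    by (rule continuous_on_eq)
  then show "isCont (\<lambda>x. LINT y|lborel. g y * k (x - y)) x0"
    by (simp add: continuous_on_eq_continuous_at)
qed

text \<open>The derivative falls on the kernel, so continuity of \<open>g\<close> is enough. Hence a
  mollification can be differentiated as often as its kernel.\<close>

lemma has_partial_convolution:
  fixes g k k' :: "'a::euclidean_space \<Rightarrow> real"
  assumes "has_partial k b k'" and cont: "continuous_on UNIV g" "continuous_on UNIV k" "continuous_on UNIV k'"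
    and zero: "\<And>x. r \<le> norm x \<Longrightarrow> k x = 0"
  shows "has_partial (\<lambda>x. LINT y|lborel. g y * k (x - y)) b (\<lambda>x. LINT y|lborel. g y * k' (x - y))"
  unfolding has_partial_def
proof
  fix x :: 'a
  obtain l u where lu: "cball (0::'a) (norm x + norm b + r) \<subseteq> cbox l u"
    by (rule bounded_subset_cbox_obtain[OF bounded_cball])
  have "((\<lambda>t. LINT y|lborel. g y * k (x + t *\<^sub>R b - y)) has_real_derivative
     (LINT y|lborel. g y * k' (x + 0 *\<^sub>R b - y))) (at 0)"
  proof (rule has_derivative_integral_compact)
    show "((\<lambda>s. g y * k (x + s *\<^sub>R b - y)) has_real_derivative g y * k' (x + t *\<^sub>R b - y)) (at t)" for t y
      using DERIV_cmult[OF has_partial_at[OF assms(1), of "x - y"], of "g y"] by (simp add: algebra_simps)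
    show "continuous_on UNIV (\<lambda>y. g y * k (x + t *\<^sub>R b - y))" for t
      by (intro continuous_intros continuous_on_compose2[OF cont(1)] continuous_on_compose2[OF cont(2)]) auto
    show "continuous_on UNIV (\<lambda>(t, y). g y * k' (x + t *\<^sub>R b - y))"
      unfolding split_beta
      by (intro continuous_intros continuous_on_compose2[OF cont(1)] continuous_on_compose2[OF cont(3)]) auto
    show "g y * k (x + t *\<^sub>R b - y) = 0" if "\<bar>t\<bar> < 1" "y \<notin> cbox l u" for t y
    proof -
      have "norm (t *\<^sub>R b) \<le> norm b" using that(1) by (simp add: mult_left_le_one_le)
      moreover have "norm x + norm b + r < norm y" using that(2) lu by (auto simp: subset_iff not_le[symmetric])
      ultimately have "r \<le> norm (x + t *\<^sub>R b - y)"
        using norm_triangle_ineq2[of y "x + t *\<^sub>R b"] norm_triangle_ineq[of x "t *\<^sub>R b"]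
        by (simp add: norm_minus_commute)
      then show ?thesis by (simp add: zero)
    qed
  qed
  then show "((\<lambda>t. LINT y|lborel. g y * k (x + t *\<^sub>R b - y)) has_real_derivative
     (LINT y|lborel. g y * k' (x - y))) (at 0)" by simp
qed

section \<open>Mollification\<close>

text \<open>\<open>flat 0\<close> is the classical smooth function that vanishes to infinite order
  at 0. The factors \<open>1 / x ^ k\<close> are those that differentiation produces.\<close>

definition flat :: "nat \<Rightarrow> real \<Rightarrow> real" where
  "flat k x = (if x \<le> 0 then 0 else exp (- (1 / x)) / x ^ k)"

lemma has_derivative_flat: "(flat k has_real_derivative flat (k + 2) x - k * flat (k + 1) x) (at x)"
proof -
  consider "x < 0" | "x = 0" | "0 < x" by linarith
  then show ?thesis
  proof cases
    case 1
    have "((\<lambda>_. 0) has_real_derivative 0) (at x)" by simp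
    then have "(flat k has_real_derivative 0) (at x)"
      by (rule has_field_derivative_transform_within_open[where S = "{..<0}"]) (use 1 in \<open>auto simp: flat_def\<close>)
    then show ?thesis using 1 by (simp add: flat_def)
  next
    case 2
    \<comment> \<open>With \<open>y = 1 / h\<close> the right-hand difference quotient at 0 is
      \<open>y ^ (k + 1) / exp y\<close>.\<close>
    have "((\<lambda>y. y ^ (k + 1) / exp y) \<longlongrightarrow> 0) (at_top :: real filter)"
      by (rule tendsto_power_div_exp_0)
    then have "((\<lambda>h. inverse h ^ (k + 1) / exp (inverse h)) \<longlongrightarrow> 0) (at_right (0::real))"
      by (rule filterlim_compose[OF _ filterlim_inverse_at_top_right])
    then have right: "((\<lambda>h. (flat k (0 + h) - flat k 0) / h) \<longlongrightarrow> 0) (at_right 0)"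
      by (rule filterlim_cong[THEN iffD1, rotated -1])
         (auto simp: eventually_at_filter flat_def exp_minus field_simps)
    have left: "((\<lambda>h. (flat k (0 + h) - flat k 0) / h) \<longlongrightarrow> 0) (at_left 0)"
      by (rule tendsto_eventually) (auto simp: eventually_at_filter flat_def)
    have "((\<lambda>h. (flat k (0 + h) - flat k 0) / h) \<longlongrightarrow> 0) (at 0)"
      using left right by (simp add: filterlim_split_at)
    then show ?thesis using 2 by (simp add: DERIV_def flat_def)
  next
    case 3
    have "((\<lambda>x. exp (- (1 / x)) / x ^ k) has_real_derivative
        ((exp (- (1 / x)) * (1 / x\<^sup>2)) * x ^ k - exp (- (1 / x)) * (k * x ^ (k - 1))) / (x ^ k * x ^ k)) (at x)"
      using 3 by (auto intro!: derivative_eq_intros simp: power2_eq_square)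
    then have "(flat k has_real_derivative
        ((exp (- (1 / x)) * (1 / x\<^sup>2)) * x ^ k - exp (- (1 / x)) * (k * x ^ (k - 1))) / (x ^ k * x ^ k)) (at x)"
      by (rule has_field_derivative_transform_within_open[where S = "{0<..}"]) (use 3 in \<open>auto simp: flat_def\<close>)
    moreover have "((exp (- (1 / x)) * (1 / x\<^sup>2)) * x ^ k - exp (- (1 / x)) * (k * x ^ (k - 1))) / (x ^ k * x ^ k)
       = flat (k + 2) x - k * flat (k + 1) x"
      using 3 by (cases k) (auto simp: flat_def field_simps power2_eq_square)
    ultimately show ?thesis by simp
  qed
qed

text \<open>A class of functions closed under differentiation; it yields a bump function together with all its
  derivatives without computing them.\<close>

inductive_set flat_algebra :: "(real \<Rightarrow> real) set" where
  flat: "(\<lambda>x. flat k (c + d * x)) \<in> flat_algebra"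
| const: "(\<lambda>_. c) \<in> flat_algebra"
| add: "f \<in> flat_algebra \<Longrightarrow> g \<in> flat_algebra \<Longrightarrow> (\<lambda>x. f x + g x) \<in> flat_algebra"
| mult: "f \<in> flat_algebra \<Longrightarrow> g \<in> flat_algebra \<Longrightarrow> (\<lambda>x. f x * g x) \<in> flat_algebra"

lemma flat_algebra_derivative:
  "f \<in> flat_algebra \<Longrightarrow> \<exists>g\<in>flat_algebra. \<forall>x. (f has_real_derivative g x) (at x)"
proof (induction rule: flat_algebra.induct)
  case (flat k c d)
  have "((\<lambda>x. flat k (c + d * x)) has_real_derivative
      (flat (k + 2) (c + d * x) + (- k) * flat (k + 1) (c + d * x)) * d) (at x)" for x
    by (rule DERIV_chain2[where f = "flat k", OF has_derivative_flat[THEN DERIV_cong]])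
       (auto intro!: derivative_eq_intros)
  moreover have "(\<lambda>x. (flat (k + 2) (c + d * x) + (- k) * flat (k + 1) (c + d * x)) * d) \<in> flat_algebra"
    by (intro flat_algebra.intros)
  ultimately show ?case by (intro bexI[where x = "\<lambda>x. (flat (k + 2) (c + d * x) + (- k) * flat (k + 1) (c + d * x)) * d"]) auto
next
  case (const c)
  then show ?case by (intro bexI[where x = "\<lambda>_. 0"]) (auto intro: flat_algebra.intros)
next
  case (add f g)
  then obtain f' g' where "f' \<in> flat_algebra" "g' \<in> flat_algebra"
    "\<forall>x. (f has_real_derivative f' x) (at x)" "\<forall>x. (g has_real_derivative g' x) (at x)" by blast
  then show ?case
    by (intro bexI[where x = "\<lambda>x. f' x + g' x"]) (auto intro: flat_algebra.intros DERIV_add)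
next
  case (mult f g)
  then obtain f' g' where "f' \<in> flat_algebra" "g' \<in> flat_algebra"
    "\<forall>x. (f has_real_derivative f' x) (at x)" "\<forall>x. (g has_real_derivative g' x) (at x)" by blast
  then show ?case using mult.hyps
    by (intro bexI[where x = "\<lambda>x. f' x * g x + g' x * f x"]) (auto intro: flat_algebra.intros DERIV_mult)
qed

text \<open>The factors of \<open>h\<close> vanish for \<open>x \<le> - s\<close> and for
  \<open>x \<ge> s\<close> respectively. As \<open>flat_algebra\<close> is closed under
  differentiation, dependent choice yields the whole sequence \<open>F\<close> of
  derivatives.\<close>

lemma smooth_bump_exists:
  fixes s :: real
  assumes "0 < s"
  obtains F :: "nat \<Rightarrow> real \<Rightarrow> real" where
    "\<And>n x. (F n has_real_derivative F (Suc n) x) (at x)" "\<And>n x. s < \<bar>x\<bar> \<Longrightarrow> F n x = 0"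
    "\<And>x. 0 \<le> F 0 x" "0 < F 0 0"
proof -
  define h where "h = (\<lambda>x. flat 0 (s + 1 * x) * flat 0 (s + (-1) * x))"
  have "\<exists>F. \<forall>n. (F n \<in> flat_algebra \<and> (n = 0 \<longrightarrow> F n = h))
     \<and> (\<forall>x. (F n has_real_derivative F (Suc n) x) (at x))"
  proof (rule dependent_nat_choice)
    have "h \<in> flat_algebra" unfolding h_def by (intro flat_algebra.intros)
    then show "\<exists>f. f \<in> flat_algebra \<and> (0 = (0::nat) \<longrightarrow> f = h)" by blast
  next
    fix f n assume "f \<in> flat_algebra \<and> (n = (0::nat) \<longrightarrow> f = h)"
    then show "\<exists>g. (g \<in> flat_algebra \<and> (Suc n = 0 \<longrightarrow> g = h)) \<and> (\<forall>x. (f has_real_derivative g x) (at x))"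
      using flat_algebra_derivative by blast
  qed
  then obtain F where F: "\<And>n x. (F n has_real_derivative F (Suc n) x) (at x)" "F 0 = h" by metis
  have zero: "F n x = 0" if "s < \<bar>x\<bar>" for n x
    using that
  proof (induction n arbitrary: x)
    case 0
    then show ?case by (auto simp: F h_def flat_def)
  next
    case (Suc n)
    have "open {x::real. s < \<bar>x\<bar>}" by (intro open_Collect_less continuous_intros)
    then have "(F n has_real_derivative 0) (at x)"
      by (rule has_field_derivative_transform_within_open[of "\<lambda>_. 0" 0 x, rotated]) (use Suc in auto)
    then show ?case using F(1) DERIV_unique by blast
  qed
  have "\<And>x. 0 \<le> F 0 x" "0 < F 0 0"
    using assms by (auto simp: F(2) h_def flat_def)
  then show ?thesis using that F(1) zero by metis
qed

text \<open>\<open>\<rho> \<alpha>\<close> is the derivative of the kernel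
  \<open>\<rho> (\<lambda>_. 0)\<close> for the multi-index \<open>\<alpha>\<close>. The kernel is
  not normalised; averages are divided by its integral, called \<open>mass\<close> below.\<close>

definition mollifier :: "real \<Rightarrow> (('a::euclidean_space \<Rightarrow> nat) \<Rightarrow> 'a \<Rightarrow> real) \<Rightarrow> bool" where
  "mollifier r \<rho> \<longleftrightarrow>
     (\<forall>\<alpha> x. (\<rho> \<alpha> has_derivative (\<lambda>h. \<Sum>b\<in>Basis. (h \<bullet> b) * \<rho> (\<alpha>(b := Suc (\<alpha> b))) x)) (at x)) \<and>
     (\<forall>\<alpha> x. r \<le> norm x \<longrightarrow> \<rho> \<alpha> x = 0) \<and> (\<forall>x. 0 \<le> \<rho> (\<lambda>_. 0) x) \<and> 0 < \<rho> (\<lambda>_. 0) 0"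

lemma mollifier_exists:
  assumes "0 < r"
  obtains \<rho> :: "('a::euclidean_space \<Rightarrow> nat) \<Rightarrow> 'a \<Rightarrow> real" where "mollifier r \<rho>"
proof -
  \<comment> \<open>If every coordinate is at most \<open>s\<close> in absolute value, the sum of
    the coordinates bounds the norm by \<open>r / 2\<close>.\<close>
  define s where "s = r / (2 * DIM('a))"
  have s: "0 < s" using assms by (simp add: s_def)
  obtain F where F: "\<And>n x. (F n has_real_derivative F (Suc n) x) (at x)" "\<And>n x. s < \<bar>x\<bar> \<Longrightarrow> F n x = 0"
    "\<And>x. 0 \<le> F 0 x" "0 < F 0 (0::real)" using smooth_bump_exists[OF s] by metis
  define \<rho> where "\<rho> = (\<lambda>(\<alpha>::'a \<Rightarrow> nat) (x::'a). \<Prod>b\<in>Basis. F (\<alpha> b) (x \<bullet> b))"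
  have "(\<rho> \<alpha> has_derivative (\<lambda>h. \<Sum>b\<in>Basis. (h \<bullet> b) * \<rho> (\<alpha>(b := Suc (\<alpha> b))) x)) (at x)" for \<alpha> x
  proof -
    have 1: "((\<lambda>x. F (\<alpha> b) (x \<bullet> b)) has_derivative (\<lambda>h. F (Suc (\<alpha> b)) (x \<bullet> b) * (h \<bullet> b))) (at x)" for b
      using has_derivative_compose[OF has_derivative_inner_left[OF has_derivative_ident, of b]
        F(1)[of "\<alpha> b" "x \<bullet> b", unfolded has_field_derivative_def]] by simp
    have "(\<rho> \<alpha> has_derivative (\<lambda>h. \<Sum>b\<in>Basis. F (Suc (\<alpha> b)) (x \<bullet> b) * (h \<bullet> b)
        * (\<Prod>j\<in>Basis - {b}. F (\<alpha> j) (x \<bullet> j)))) (at x)"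
      unfolding \<rho>_def by (rule has_derivative_prod) (rule 1)
    moreover have "F (Suc (\<alpha> b)) (x \<bullet> b) * (h \<bullet> b) * (\<Prod>j\<in>Basis - {b}. F (\<alpha> j) (x \<bullet> j))
       = (h \<bullet> b) * \<rho> (\<alpha>(b := Suc (\<alpha> b))) x" if "b \<in> Basis" for b h
      unfolding \<rho>_def using that by (simp add: prod.remove[of Basis b])
    ultimately show ?thesis by (simp cong: sum.cong)
  qed
  moreover have "\<rho> \<alpha> x = 0" if "r \<le> norm x" for \<alpha> x
  proof (rule ccontr)
    assume "\<rho> \<alpha> x \<noteq> 0"
    then have "\<bar>x \<bullet> b\<bar> \<le> s" if "b \<in> Basis" for b
      using that F(2)[of "x \<bullet> b"] by (force simp: \<rho>_def not_less[symmetric])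
    then have "norm x \<le> (\<Sum>b\<in>(Basis::'a set). s)"
      by (intro order_trans[OF norm_le_l1] sum_mono) 
    then show False using that assms by (simp add: s_def)
  qed
  ultimately have "mollifier r \<rho>"
    using F(3,4) by (auto simp: mollifier_def \<rho>_def intro!: prod_nonneg prod_pos)
  then show ?thesis by (rule that)
qed

abbreviation incr :: "('a \<Rightarrow> nat) \<Rightarrow> 'a \<Rightarrow> 'a \<Rightarrow> nat" where
  "incr \<alpha> b \<equiv> \<alpha>(b := Suc (\<alpha> b))"

lemma borel_measurable_continuous_lborel:
  "continuous_on UNIV f \<Longrightarrow> f \<in> borel_measurable lborel"
  by (simp add: borel_measurable_continuous_onI)

section \<open>Test functions and averages from a mollifier\<close>

context
  fixes r :: real and \<rho> :: "('a::euclidean_space \<Rightarrow> nat) \<Rightarrow> 'a \<Rightarrow> real"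
  assumes mol: "mollifier r \<rho>"
begin

lemma mollifier_zero: "r \<le> norm x \<Longrightarrow> \<rho> \<alpha> x = 0"
  using mol by (simp add: mollifier_def)

lemma mollifier_derivative: "(\<rho> \<alpha> has_derivative (\<lambda>h. \<Sum>b\<in>Basis. (h \<bullet> b) * \<rho> (incr \<alpha> b) x)) (at x)"
  using mol by (simp add: mollifier_def)

lemma mollifier_continuous: "continuous_on S (\<rho> \<alpha>)"
  by (meson mollifier_derivative continuous_at_imp_continuous_on has_derivative_continuous)

lemma mollifier_partial:
  assumes "b \<in> Basis"
  shows "has_partial (\<rho> \<alpha>) b (\<rho> (incr \<alpha> b))"
  unfolding has_partial_def
proof
  fix x :: 'a
  have "((\<lambda>t. \<rho> \<alpha> (x + t *\<^sub>R b)) has_derivative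
     (\<lambda>t. \<Sum>b'\<in>Basis. ((t *\<^sub>R b) \<bullet> b') * \<rho> (incr \<alpha> b') (x + 0 *\<^sub>R b))) (at 0)"
    by (rule has_derivative_compose[OF _ mollifier_derivative, of "\<lambda>t. x + t *\<^sub>R b" "\<lambda>t. t *\<^sub>R b" 0 UNIV \<alpha>])
       (auto intro!: derivative_eq_intros)
  moreover have "(\<Sum>b'\<in>Basis. ((t *\<^sub>R b) \<bullet> b') * \<rho> (incr \<alpha> b') (x + 0 *\<^sub>R b)) = \<rho> (incr \<alpha> b) x * t" for t
    using assms by (simp add: inner_Basis if_distrib if_distribR sum.delta cong: if_cong)
  ultimately show "((\<lambda>t. \<rho> \<alpha> (x + t *\<^sub>R b)) has_real_derivative \<rho> (incr \<alpha> b) x) (at 0)"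
    by (simp add: has_field_derivative_def)
qed

lemma mollifier_reflect_derivative:
  "((\<lambda>y. c * \<rho> \<alpha> (x - y)) has_derivative (\<lambda>h. \<Sum>b\<in>Basis. (h \<bullet> b) * (- c * \<rho> (incr \<alpha> b) (x - y)))) (at y)"
proof -
  have "((\<lambda>y. \<rho> \<alpha> (x - y)) has_derivative (\<lambda>h. \<Sum>b\<in>Basis. ((- h) \<bullet> b) * \<rho> (incr \<alpha> b) (x - y))) (at y)"
    by (rule has_derivative_compose[OF _ mollifier_derivative, of "\<lambda>y. x - y" "\<lambda>h. - h" y UNIV \<alpha>])
       (auto intro!: derivative_eq_intros)
  from has_derivative_mult_right[OF this, of c] show ?thesis
    by (simp add: sum_distrib_left mult_ac)
qed

lemma mollifier_frechet:
  assumes "b \<in> Basis"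
  shows "frechet_derivative (\<lambda>y. c * \<rho> \<alpha> (x - y)) (at y) b = - c * \<rho> (incr \<alpha> b) (x - y)"
  using assms
  by (simp add: frechet_derivative_at[OF mollifier_reflect_derivative, symmetric] inner_Basis
      if_distrib if_distribR sum.delta cong: if_cong)

lemma mollifier_C_k: "C_k k (\<lambda>y. c * \<rho> \<alpha> (x - y))"
proof (induction k arbitrary: c \<alpha>)
  case 0
  show ?case
    by (auto intro!: continuous_intros continuous_on_compose2[OF mollifier_continuous[of UNIV]])
next
  case (Suc k)
  have "(\<lambda>y. c * \<rho> \<alpha> (x - y)) differentiable at y" for y
    using mollifier_reflect_derivative unfolding differentiable_def by blast
  moreover have "C_k k (\<lambda>y. frechet_derivative (\<lambda>y. c * \<rho> \<alpha> (x - y)) (at y) b)" if "b \<in> Basis" for b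
    unfolding mollifier_frechet[OF that] by (rule Suc)
  ultimately show ?case by simp
qed

text \<open>As a function of the integration variable the reflected kernel may be inserted into the
  weak formulation; this is how the equation passes to the mollification.\<close>

lemma mollifier_test_function: "test_function (\<lambda>y. \<rho> \<alpha> (x - y))"
proof -
  have "{y. \<rho> \<alpha> (x - y) \<noteq> 0} \<subseteq> cball x r"
    using mollifier_zero by (force simp: dist_norm)
  then have "bounded {y. \<rho> \<alpha> (x - y) \<noteq> 0}" by (rule bounded_subset[OF bounded_cball])
  then show ?thesis
    using mollifier_C_k[of _ 1 \<alpha> x] by (simp add: test_function_def)
qed

lemma mollifier_gradient:
  "gradient (\<lambda>y. \<rho> \<alpha> (x - y)) y = (\<Sum>b\<in>Basis. (- \<rho> (incr \<alpha> b) (x - y)) *\<^sub>R b)"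
  using mollifier_frechet[of _ 1 \<alpha> x y] by (simp add: gradient_def)

definition mass :: real where "mass = (LINT y|lborel. \<rho> (\<lambda>_. 0) (- y))"

lemma kernel_integrable:
  assumes "continuous_on UNIV g"
  shows "integrable lborel (\<lambda>y. g y * \<rho> \<alpha> (x - y))"
proof -
  obtain l u where lu: "cball x r \<subseteq> cbox l u"
    by (rule bounded_subset_cbox_obtain[OF bounded_cball])
  have "\<rho> \<alpha> (x - y) = 0" if "y \<notin> cbox l u" for y
    using that lu by (intro mollifier_zero) (force simp: dist_norm)
  then show ?thesis
    by (intro integrable_compact_support(1)[of _ l u])
      (auto intro!: continuous_intros assms continuous_on_compose2[OF mollifier_continuous[of UNIV]])
qed

lemma mass_eq: "(LINT y|lborel. \<rho> (\<lambda>_. 0) (x - y)) = mass"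
  using lborel_integral_translation[of "\<lambda>y. \<rho> (\<lambda>_. 0) (- y)" "- x"]
  by (simp add: mass_def borel_measurable_continuous_onI continuous_on_minus continuous_on_compose2[OF mollifier_continuous[of UNIV]])

text \<open>Mass 0 would make the open set where the kernel is nonzero a null set, hence empty,
  although the kernel is positive at 0.\<close>

lemma mass_pos: "0 < mass"
proof -
  let ?f = "\<lambda>y::'a. \<rho> (\<lambda>_. 0) (- y)"
  have cont: "continuous_on UNIV ?f"
    by (intro continuous_on_compose2[OF mollifier_continuous[of UNIV]] continuous_intros) auto
  have nonneg: "0 \<le> ?f y" for y using mol by (simp add: mollifier_def)
  have int: "integrable lborel ?f" using kernel_integrable[of "\<lambda>_. 1" "\<lambda>_. 0" 0] by simp
  have "mass \<noteq> 0"
  proof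
    assume "mass = 0"
    then have "AE y in lborel. ?f y = 0"
      using integral_nonneg_eq_0_iff_AE[OF int] nonneg by (simp add: mass_def)
    moreover have op: "open {y. ?f y \<noteq> 0}"
      by (rule open_Collect_neq[OF cont]) simp
    ultimately have "{y. ?f y \<noteq> 0} \<in> null_sets lborel"
      using AE_iff_null_sets[of "{y. ?f y \<noteq> 0}" lborel] by simp
    then have "negligible {y. ?f y \<noteq> 0}"
      by (simp add: negligible_iff_null_sets null_sets_completionI)
    then have "{y. ?f y \<noteq> 0} = {}" using open_not_negligible[OF op] by blast
    then have "?f 0 = 0" by blast
    moreover have "0 < ?f 0" using mol by (simp add: mollifier_def)
    ultimately show False by simp
  qed
  moreover have "0 \<le> mass" unfolding mass_def by (intro Bochner_Integration.integral_nonneg nonneg)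
  ultimately show ?thesis by simp
qed

text \<open>A weighted mean over \<open>cball x r\<close>. It is phrased for Lebesgue measure and an
  integrable product, because besides \<open>u\<close> and its gradient it serves the source term,
  which need not be continuous.\<close>

lemma kernel_average_bounds:
  assumes int: "integrable lebesgue (\<lambda>y. g y * \<rho> (\<lambda>_. 0) (x - y))"
    and bds: "\<And>y. y \<in> cball x r \<Longrightarrow> lo \<le> g y \<and> g y \<le> hi"
  shows "lo \<le> (LINT y|lebesgue. g y * \<rho> (\<lambda>_. 0) (x - y)) / mass"
    and "(LINT y|lebesgue. g y * \<rho> (\<lambda>_. 0) (x - y)) / mass \<le> hi"
proof -
  have nonneg: "0 \<le> \<rho> (\<lambda>_. 0) y" for y using mol by (simp add: mollifier_def)
  have meas: "(\<lambda>y. \<rho> (\<lambda>_. 0) (x - y)) \<in> borel_measurable lborel"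
    by (intro borel_measurable_continuous_lborel
        continuous_on_compose2[OF mollifier_continuous[of UNIV]] continuous_intros) auto
  have int1: "integrable lebesgue (\<lambda>y. c * \<rho> (\<lambda>_. 0) (x - y))" for c
    using kernel_integrable[of "\<lambda>_. 1" "\<lambda>_. 0" x] meas by (simp add: integrable_completion)
  have mass: "(LINT y|lebesgue. c * \<rho> (\<lambda>_. 0) (x - y)) = c * mass" for c
    using meas by (simp add: integral_completion mass_eq)
  have zero: "\<rho> (\<lambda>_. 0) (x - y) = 0" if "y \<notin> cball x r" for y
    using that by (intro mollifier_zero) (simp add: dist_norm)
  have "lo * mass \<le> (LINT y|lebesgue. g y * \<rho> (\<lambda>_. 0) (x - y))"
    unfolding mass[symmetric]
  proof (rule integral_mono[OF int1 int])
    show "lo * \<rho> (\<lambda>_. 0) (x - y) \<le> g y * \<rho> (\<lambda>_. 0) (x - y)" for y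
      using bds[of y] zero[of y] nonneg[of "x - y"] by (cases "y \<in> cball x r") (auto intro: mult_right_mono)
  qed
  then show "lo \<le> (LINT y|lebesgue. g y * \<rho> (\<lambda>_. 0) (x - y)) / mass"
    using mass_pos by (simp add: pos_le_divide_eq)
  have "(LINT y|lebesgue. g y * \<rho> (\<lambda>_. 0) (x - y)) \<le> hi * mass"
    unfolding mass[symmetric]
  proof (rule integral_mono[OF int int1])
    show "g y * \<rho> (\<lambda>_. 0) (x - y) \<le> hi * \<rho> (\<lambda>_. 0) (x - y)" for y
      using bds[of y] zero[of y] nonneg[of "x - y"] by (cases "y \<in> cball x r") (auto intro: mult_right_mono)
  qed
  then show "(LINT y|lebesgue. g y * \<rho> (\<lambda>_. 0) (x - y)) / mass \<le> hi"
    using mass_pos by (simp add: pos_divide_le_eq)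
qed

lemma kernel_integrable_source:
  assumes "locally_integrable F"
  shows "integrable lebesgue (\<lambda>y. enn2real (F y) * \<rho> \<alpha> (x - y))"
proof (rule integrableI_bounded)
  have meas: "(\<lambda>y. \<rho> \<alpha> (x - y)) \<in> borel_measurable lebesgue"
    by (intro measurable_completion borel_measurable_continuous_lborel
        continuous_on_compose2[OF mollifier_continuous[of UNIV]] continuous_intros) auto
  have F[measurable]: "F \<in> borel_measurable lebesgue" using assms by (simp add: locally_integrable_def)
  show "(\<lambda>y. enn2real (F y) * \<rho> \<alpha> (x - y)) \<in> borel_measurable lebesgue"
    using meas by measurable
  have "compact (cball 0 (max r 0) :: 'a set)" "continuous_on (cball 0 (max r 0)) (\<rho> \<alpha>)"
    by (auto intro: mollifier_continuous)
  then have "bounded (\<rho> \<alpha> ` cball 0 (max r 0))" by (intro compact_imp_bounded compact_continuous_image)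
  then obtain M where M: "\<And>z. z \<in> cball 0 (max r 0) \<Longrightarrow> \<bar>\<rho> \<alpha> z\<bar> \<le> M" "0 \<le> M"
    unfolding bounded_iff by (metis (no_types, opaque_lifting) abs_ge_zero imageI order_trans real_norm_def max.cobounded2 centre_in_cball)
  have "ennreal (norm (enn2real (F y) * \<rho> \<alpha> (x - y))) \<le> ennreal M * (F y * indicator (cball x r) y)" for y
  proof (cases "y \<in> cball x r")
    case True
    then have "norm (enn2real (F y) * \<rho> \<alpha> (x - y)) \<le> enn2real (F y) * M"
      using M(1)[of "x - y"] by (auto simp: abs_mult dist_norm norm_minus_commute intro!: mult_left_mono)
    then have "ennreal (norm (enn2real (F y) * \<rho> \<alpha> (x - y))) \<le> ennreal (enn2real (F y) * M)"
      by (rule ennreal_leI)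
    also have "\<dots> = ennreal (enn2real (F y)) * ennreal M" using M(2) by (simp add: ennreal_mult)
    \<comment> \<open>\<open>enn2real\<close> maps infinity to 0, so the inequality also holds where
      \<open>F y\<close> is infinite.\<close>
    also have "\<dots> \<le> F y * ennreal M"
      by (intro mult_right_mono) (auto simp: ennreal_enn2real_if)
    finally show ?thesis using True by (simp add: mult.commute)
  next
    case False
    then have "\<rho> \<alpha> (x - y) = 0" by (intro mollifier_zero) (simp add: dist_norm)
    then show ?thesis by simp
  qed
  then have "(\<integral>\<^sup>+y. ennreal (norm (enn2real (F y) * \<rho> \<alpha> (x - y))) \<partial>lebesgue)
      \<le> (\<integral>\<^sup>+y. ennreal M * (F y * indicator (cball x r) y) \<partial>lebesgue)"
    by (intro nn_integral_mono)
  also have "\<dots> = ennreal M * (\<integral>\<^sup>+y\<in>cball x r. F y \<partial>lebesgue)"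
    by (intro nn_integral_cmult borel_measurable_times_ennreal F borel_measurable_indicator) simp
  also have "\<dots> < \<infinity>"
    using assms by (simp add: locally_integrable_def ennreal_mult_less_top)
  finally show "(\<integral>\<^sup>+y. ennreal (norm (enn2real (F y) * \<rho> \<alpha> (x - y))) \<partial>lebesgue) < \<infinity>" .
qed

end

text \<open>Partial derivatives of the mollified solution are indexed by multi-indices, which makes their
  symmetry automatic.\<close>

definition mollified ::
    "real \<Rightarrow> real \<Rightarrow> ('a::euclidean_space \<Rightarrow> real) \<Rightarrow> real \<Rightarrow> (('a \<Rightarrow> nat) \<Rightarrow> 'a \<Rightarrow> real) \<Rightarrow> bool" where
  "mollified p q u r U \<longleftrightarrow>
     (\<forall>\<alpha>. continuous_on UNIV (U \<alpha>)) \<and>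
     (\<forall>\<alpha>. \<forall>b\<in>Basis. has_partial (U \<alpha>) b (U (incr \<alpha> b))) \<and>
     (\<forall>x lo hi. (\<forall>y\<in>cball x r. lo \<le> u y \<and> u y \<le> hi) \<longrightarrow> lo \<le> U (\<lambda>_. 0) x \<and> U (\<lambda>_. 0) x \<le> hi) \<and>
     (\<forall>b\<in>Basis. \<forall>x lo hi. (\<forall>y\<in>cball x r. lo \<le> gradient u y \<bullet> b \<and> gradient u y \<bullet> b \<le> hi)
        \<longrightarrow> lo \<le> U (incr (\<lambda>_. 0) b) x \<and> U (incr (\<lambda>_. 0) b) x \<le> hi) \<and>
     (\<forall>x. 0 \<le> - (\<Sum>b\<in>Basis. U (incr (incr (\<lambda>_. 0) b) b) x)) \<and>
     (\<forall>x lo hi. (\<forall>y\<in>cball x r. lo \<le> enn2real (source p q u y) \<and> enn2real (source p q u y) \<le> hi)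
        \<longrightarrow> lo \<le> - (\<Sum>b\<in>Basis. U (incr (incr (\<lambda>_. 0) b) b) x)
          \<and> - (\<Sum>b\<in>Basis. U (incr (incr (\<lambda>_. 0) b) b) x) \<le> hi)"

lemma gradient_inner: "b \<in> Basis \<Longrightarrow> gradient f x \<bullet> b = frechet_derivative f (at x) b"
  by (simp add: gradient_def inner_sum_left inner_Basis if_distrib cong: if_cong)

lemma C1_has_partial:
  assumes "C_k 1 u" "b \<in> Basis"
  shows "has_partial u b (\<lambda>x. gradient u x \<bullet> b)" "continuous_on UNIV (\<lambda>x. gradient u x \<bullet> b)"
    "continuous_on UNIV u"
proof -
  note g = gradient_inner[OF assms(2)]
  have d: "(u has_derivative frechet_derivative u (at x)) (at x)" for x
    using assms(1) by (simp add: frechet_derivative_works[symmetric])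
  show "has_partial u b (\<lambda>x. gradient u x \<bullet> b)"
    unfolding has_partial_def g
  proof
    fix x
    have "((\<lambda>t. u (x + t *\<^sub>R b)) has_derivative (\<lambda>t. frechet_derivative u (at (x + 0 *\<^sub>R b)) (t *\<^sub>R b))) (at 0)"
      by (rule has_derivative_compose[of "\<lambda>t. x + t *\<^sub>R b"]) (auto intro!: derivative_eq_intros d)
    then show "((\<lambda>t. u (x + t *\<^sub>R b)) has_real_derivative frechet_derivative u (at x) b) (at 0)"
      by (simp add: has_field_derivative_def linear_cmul[OF has_derivative_linear[OF d]] mult_commute_abs)
  qed
  show "continuous_on UNIV (\<lambda>x. gradient u x \<bullet> b)" using assms by (simp add: g)
  show "continuous_on UNIV u"
    by (meson d continuous_at_imp_continuous_on has_derivative_continuous)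
qed

text \<open>Each clause is an averaging statement: for \<open>u\<close> directly, for the gradient
  after one derivative is moved off the kernel, and for the Laplacian through the weak
  equation.\<close>

lemma mollified_exists:
  fixes u :: "'a::euclidean_space \<Rightarrow> real"
  assumes sol: "positive_weak_solution p q u" and r: "0 < r"
  obtains U where "mollified p q u r U"
proof -
  obtain \<rho> :: "('a \<Rightarrow> nat) \<Rightarrow> 'a \<Rightarrow> real" where mol: "mollifier r \<rho>"
    using mollifier_exists[OF r] .
  let ?c = "mass \<rho>"
  note c = mass_pos[OF mol]
  have C1: "C_k 1 u" and loc: "locally_integrable (source p q u)"
    and weak: "\<And>\<psi>. test_function \<psi> \<Longrightarrow> (LINT x|lebesgue. gradient u x \<bullet> gradient \<psi> x)
          = (LINT x|lebesgue. enn2real (source p q u x) * \<psi> x)"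
    using sol by (auto simp: positive_weak_solution_def)
  have contu: "continuous_on UNIV u"
    using C1_has_partial(3)[OF C1] nonempty_Basis by blast
  note part = C1_has_partial(1,2)[OF C1]
  define U where "U = (\<lambda>\<alpha> x. (LINT y|lborel. u y * \<rho> \<alpha> (x - y)) / ?c)"
  have contk: "continuous_on UNIV (\<lambda>y. \<rho> \<alpha> (x - y))" for \<alpha> x
    by (intro continuous_on_compose2[OF mollifier_continuous[OF mol, of UNIV]] continuous_intros) auto
  have cont: "continuous_on UNIV (U \<alpha>)" for \<alpha>
    unfolding U_def using c
    by (intro continuous_intros continuous_convolution[OF contu mollifier_continuous[OF mol] mollifier_zero[OF mol]]) auto
  have partU: "has_partial (U \<alpha>) b (U (incr \<alpha> b))" if "b \<in> Basis" for \<alpha> b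
    using has_partial_mult[OF has_partial_convolution[OF mollifier_partial[OF mol that] contu
        mollifier_continuous[OF mol] mollifier_continuous[OF mol] mollifier_zero[OF mol]] has_partial_const[of "1 / ?c"]]
    unfolding U_def by (rule has_partial_cong) auto
  have byparts: "(LINT y|lborel. u y * \<rho> (incr \<alpha> b) (x - y)) = (LINT y|lborel. (gradient u y \<bullet> b) * \<rho> \<alpha> (x - y))"
    if b: "b \<in> Basis" for b \<alpha> x
  proof -
    have k: "has_partial (\<lambda>y. \<rho> \<alpha> (x - y)) b (\<lambda>y. - \<rho> (incr \<alpha> b) (x - y))"
      unfolding has_partial_def
    proof
      fix y
      have "((\<lambda>t. \<rho> \<alpha> ((x - y) + (- t) *\<^sub>R b)) has_real_derivative \<rho> (incr \<alpha> b) (x - y) * (- 1)) (at 0)"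
        by (rule DERIV_chain2[of "\<lambda>t. \<rho> \<alpha> ((x - y) + t *\<^sub>R b)"])
           (use has_partialD[OF mollifier_partial[OF mol b]] in \<open>auto intro!: derivative_eq_intros\<close>)
      then show "((\<lambda>t. \<rho> \<alpha> (x - (y + t *\<^sub>R b))) has_real_derivative - \<rho> (incr \<alpha> b) (x - y)) (at 0)"
        by (simp add: algebra_simps)
    qed
    have "(LINT y|lborel. (gradient u y \<bullet> b) * \<rho> \<alpha> (x - y) + u y * (- \<rho> (incr \<alpha> b) (x - y))) = 0"
    proof (rule integral_partial_eq_0[OF has_partial_mult[OF part(1)[OF b] k], where R = "norm x + r"])
      show "u y * \<rho> \<alpha> (x - y) = 0" if "norm x + r \<le> norm y" for y
        using that norm_triangle_ineq2[of y x] mollifier_zero[OF mol, of "x - y"]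
        by (simp add: norm_minus_commute)
    qed (intro continuous_intros contu contk part(2)[OF b])+
    then show ?thesis
      using kernel_integrable[OF mol part(2)[OF b], of \<alpha> x] kernel_integrable[OF mol contu, of "incr \<alpha> b" x]
      by simp
  qed
  have lap: "- (\<Sum>b\<in>Basis. U (incr (incr (\<lambda>_. 0) b) b) x)
      = (LINT y|lebesgue. enn2real (source p q u y) * \<rho> (\<lambda>_. 0) (x - y)) / ?c" for x
  proof -
    \<comment> \<open>Reflecting the kernel turns its gradient into minus the derivative kernels.
      Hence the averaged source is exactly minus the Laplacian of the mollification.\<close>
    have "(LINT y|lebesgue. enn2real (source p q u y) * \<rho> (\<lambda>_. 0) (x - y))
      = (LINT y|lebesgue. (\<Sum>b\<in>Basis. - ((gradient u y \<bullet> b) * \<rho> (incr (\<lambda>_. 0) b) (x - y))))"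
      unfolding weak[OF mollifier_test_function[OF mol], symmetric] mollifier_gradient[OF mol]
      by (simp add: inner_sum_right mult.commute sum_negf)
    also have "\<dots> = (LINT y|lborel. (\<Sum>b\<in>Basis. - ((gradient u y \<bullet> b) * \<rho> (incr (\<lambda>_. 0) b) (x - y))))"
      by (intro integral_completion borel_measurable_continuous_lborel continuous_intros part(2) contk) 
    also have "\<dots> = - (\<Sum>b\<in>Basis. (LINT y|lborel. (gradient u y \<bullet> b) * \<rho> (incr (\<lambda>_. 0) b) (x - y)))"
      using kernel_integrable[OF mol part(2)] by (simp add: sum_negf)
    also have "\<dots> = - (\<Sum>b\<in>Basis. (LINT y|lborel. u y * \<rho> (incr (incr (\<lambda>_. 0) b) b) (x - y)))"
      by (intro arg_cong[where f = uminus] sum.cong refl byparts[symmetric])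
    finally show ?thesis by (simp add: U_def sum_divide_distrib)
  qed
  have leb: "(LINT y|lborel. g y * \<rho> \<alpha> (x - y)) = (LINT y|lebesgue. g y * \<rho> \<alpha> (x - y))"
    "integrable lebesgue (\<lambda>y. g y * \<rho> \<alpha> (x - y))" if "continuous_on UNIV g" for g \<alpha> x
  proof -
    have m: "(\<lambda>y. g y * \<rho> \<alpha> (x - y)) \<in> borel_measurable lborel"
      by (intro borel_measurable_continuous_lborel continuous_intros that contk)
    show "(LINT y|lborel. g y * \<rho> \<alpha> (x - y)) = (LINT y|lebesgue. g y * \<rho> \<alpha> (x - y))"
      using m by (simp add: integral_completion)
    show "integrable lebesgue (\<lambda>y. g y * \<rho> \<alpha> (x - y))"
      using m kernel_integrable[OF mol that] by (simp add: integrable_completion)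
  qed
  have "mollified p q u r U"
    unfolding mollified_def
  proof (intro conjI allI ballI impI)
    fix x lo hi assume *: "\<forall>y\<in>cball x r. lo \<le> u y \<and> u y \<le> hi"
    show "lo \<le> U (\<lambda>_. 0) x" "U (\<lambda>_. 0) x \<le> hi"
      using kernel_average_bounds[OF mol leb(2)[OF contu], of x lo hi] * by (auto simp: U_def leb(1)[OF contu])
  next
    fix b x lo hi assume b: "b \<in> Basis" and *: "\<forall>y\<in>cball x r. lo \<le> gradient u y \<bullet> b \<and> gradient u y \<bullet> b \<le> hi"
    show "lo \<le> U (incr (\<lambda>_. 0) b) x" "U (incr (\<lambda>_. 0) b) x \<le> hi"
      unfolding U_def byparts[OF b, of "\<lambda>_. 0"] leb(1)[OF part(2)[OF b]]
      using kernel_average_bounds[OF mol leb(2)[OF part(2)[OF b]], of x lo hi] * by auto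
  next
    fix x
    have "0 \<le> \<rho> (\<lambda>_. 0) y" for y using mol by (simp add: mollifier_def)
    then show "0 \<le> - (\<Sum>b\<in>Basis. U (incr (incr (\<lambda>_. 0) b) b) x)"
      unfolding lap using c by (intro divide_nonneg_pos Bochner_Integration.integral_nonneg) auto
  next
    fix x lo hi assume *: "\<forall>y\<in>cball x r. lo \<le> enn2real (source p q u y) \<and> enn2real (source p q u y) \<le> hi"
    show "lo \<le> - (\<Sum>b\<in>Basis. U (incr (incr (\<lambda>_. 0) b) b) x)"
      "- (\<Sum>b\<in>Basis. U (incr (incr (\<lambda>_. 0) b) b) x) \<le> hi"
      unfolding lap using kernel_average_bounds[OF mol kernel_integrable_source[OF mol loc], of x lo hi] *
      by auto
  qed (use cont partU in auto)
  then show ?thesis by (rule that)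
qed

section \<open>The integral estimate\<close>

lemma has_derivative_pos_part_power:
  fixes s :: real and m :: nat
  assumes "2 \<le> m"
  shows "((\<lambda>s. (max 0 s) ^ m) has_real_derivative m * (max 0 s) ^ (m - 1)) (at s)"
proof -
  consider "s < 0" | "0 < s" | "s = 0" by linarith
  then show ?thesis
  proof cases
    case 1
    have "((\<lambda>s. (max 0 s) ^ m) has_real_derivative 0) (at s)"
      by (rule has_field_derivative_transform_within_open[of "\<lambda>_. 0" 0 s "{..<0}"])
         (use 1 assms in \<open>auto simp: max_def\<close>)
    then show ?thesis using 1 assms by (simp add: max_absorb1 power_0_left)
  next
    case 2
    have "((\<lambda>s. (max 0 s) ^ m) has_real_derivative m * s ^ (m - 1)) (at s)"
      by (rule has_field_derivative_transform_within_open[of "\<lambda>s. s ^ m" _ s "{0<..}"])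
         (use 2 in \<open>auto simp: max_def intro!: derivative_eq_intros\<close>)
    then show ?thesis using 2 by (simp add: max_def)
  next
    case 3
    have "((\<lambda>h. (max 0 h) ^ (m - 1)) \<longlongrightarrow> (max 0 0) ^ (m - 1)) (at (0::real))"
      by (intro tendsto_intros)
    then have "((\<lambda>h. (max 0 (0 + h) ^ m - max 0 0 ^ m) / h) \<longlongrightarrow> 0) (at (0::real))"
    proof (rule Lim_transform_within_open[where s = UNIV, OF tendsto_eq_rhs])
      show "max 0 0 ^ (m - 1) = (0::real)" using assms by simp
      fix h :: real assume "h \<noteq> 0"
      have "m = Suc (m - 1)" using assms by simp
      then have "h ^ m = h * h ^ (m - 1)" by (metis power_Suc)
      then show "max 0 h ^ (m - 1) = (max 0 (0 + h) ^ m - max 0 0 ^ m) / h"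
        using \<open>h \<noteq> 0\<close> assms by (auto simp: max_def power_0_left)
    qed auto
    then show ?thesis using 3 assms by (simp add: DERIV_def power_0_left)
  qed
qed

lemma abs_sum_mult_le_sqrt:
  fixes f g :: "'b \<Rightarrow> real"
  shows "\<bar>\<Sum>i\<in>S. f i * g i\<bar> \<le> sqrt (\<Sum>i\<in>S. (f i)\<^sup>2) * sqrt (\<Sum>i\<in>S. (g i)\<^sup>2)"
proof -
  have "(\<Sum>i\<in>S. f i * g i)\<^sup>2 \<le> (\<Sum>i\<in>S. (f i)\<^sup>2) * (\<Sum>i\<in>S. (g i)\<^sup>2)"
    by (rule Cauchy_Schwarz_ineq_sum)
  then show ?thesis
    by (metis real_sqrt_abs real_sqrt_le_iff real_sqrt_mult)
qed

section \<open>Divergence theorem and Bochner's formula\<close>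

lemma integral_divergence_eq_0:
  fixes X X' :: "'a::euclidean_space \<Rightarrow> 'a \<Rightarrow> real"
  assumes part: "\<And>b. b \<in> Basis \<Longrightarrow> has_partial (X b) b (X' b)"
    and cont: "\<And>b. b \<in> Basis \<Longrightarrow> continuous_on UNIV (X b)" "\<And>b. b \<in> Basis \<Longrightarrow> continuous_on UNIV (X' b)"
    and zero: "\<And>b x. b \<in> Basis \<Longrightarrow> R \<le> norm x \<Longrightarrow> X b x = 0"
  shows "integrable lborel (\<lambda>x. \<Sum>b\<in>Basis. X' b x)" "(LINT x|lborel. (\<Sum>b\<in>Basis. X' b x)) = 0"
proof -
  obtain l u where lu: "cball (0::'a) R \<subseteq> cbox l u"
    by (rule bounded_subset_cbox_obtain[OF bounded_cball])
  have int: "integrable lborel (X' b)" if b: "b \<in> Basis" for b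
  proof (rule integrable_compact_support(1)[OF cont(2)[OF b]])
    fix x assume "x \<notin> cbox l u"
    then have "R < norm x" using lu by (auto simp: subset_iff not_le[symmetric])
    then show "X' b x = 0" using partial_zero_outside[OF part[OF b] zero[OF b]] by blast
  qed
  then show "integrable lborel (\<lambda>x. \<Sum>b\<in>Basis. X' b x)" by (rule Bochner_Integration.integrable_sum)
  show "(LINT x|lborel. (\<Sum>b\<in>Basis. X' b x)) = 0"
    using int integral_partial_eq_0[OF part cont zero] by simp
qed

text \<open>\<open>v1\<close>, \<open>v2\<close>, \<open>v3\<close> are the partial derivatives by
  order. \<open>sym3\<close> is the exchange of derivatives that identifies the divergence of the
  Hessian with the gradient of the Laplacian.\<close>

locale smooth_field =
  fixes v :: "'a::euclidean_space \<Rightarrow> real" and v1 :: "'a \<Rightarrow> 'a \<Rightarrow> real"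
    and v2 :: "'a \<Rightarrow> 'a \<Rightarrow> 'a \<Rightarrow> real" and v3 :: "'a \<Rightarrow> 'a \<Rightarrow> 'a \<Rightarrow> 'a \<Rightarrow> real"
  assumes p1: "i \<in> Basis \<Longrightarrow> has_partial v i (v1 i)"
    and p2: "i \<in> Basis \<Longrightarrow> j \<in> Basis \<Longrightarrow> has_partial (v1 i) j (v2 i j)"
    and p3: "i \<in> Basis \<Longrightarrow> j \<in> Basis \<Longrightarrow> k \<in> Basis \<Longrightarrow> has_partial (v2 i j) k (v3 i j k)"
    and c0: "continuous_on UNIV v" and c1: "i \<in> Basis \<Longrightarrow> continuous_on UNIV (v1 i)"
    and c2: "i \<in> Basis \<Longrightarrow> j \<in> Basis \<Longrightarrow> continuous_on UNIV (v2 i j)"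
    and c3: "i \<in> Basis \<Longrightarrow> j \<in> Basis \<Longrightarrow> k \<in> Basis \<Longrightarrow> continuous_on UNIV (v3 i j k)"
    and sym3: "i \<in> Basis \<Longrightarrow> j \<in> Basis \<Longrightarrow> v3 i j j x = v3 j j i x"
begin

definition lap :: "'a \<Rightarrow> real" where "lap x = (\<Sum>i\<in>Basis. v2 i i x)"
definition hess_sq :: "'a \<Rightarrow> real" where "hess_sq x = (\<Sum>j\<in>Basis. \<Sum>i\<in>Basis. (v2 i j x)\<^sup>2)"
definition grad_sq :: "'a \<Rightarrow> real" where "grad_sq x = (\<Sum>i\<in>Basis. (v1 i x)\<^sup>2)"
definition grad_sq1 :: "'a \<Rightarrow> 'a \<Rightarrow> real" where "grad_sq1 j x = 2 * (\<Sum>i\<in>Basis. v2 i j x * v1 i x)"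

lemma continuous_lap: "continuous_on UNIV lap"
  unfolding lap_def by (intro continuous_intros c2)

lemma continuous_grad_sq: "continuous_on UNIV grad_sq"
  unfolding grad_sq_def by (intro continuous_intros c1)

lemma continuous_grad_sq1: "j \<in> Basis \<Longrightarrow> continuous_on UNIV (grad_sq1 j)"
  unfolding grad_sq1_def by (intro continuous_intros c1 c2)

lemma has_partial_grad_sq:
  assumes "j \<in> Basis" shows "has_partial grad_sq j (grad_sq1 j)"
proof -
  have "has_partial (\<lambda>x. \<Sum>i\<in>Basis. v1 i x * v1 i x) j (\<lambda>x. \<Sum>i\<in>Basis. v2 i j x * v1 i x + v1 i x * v2 i j x)"
    using assms by (intro has_partial_sum has_partial_mult p2)
  then show ?thesis
    by (rule has_partial_cong)
      (auto simp: grad_sq_def grad_sq1_def power2_eq_square sum_distrib_left mult.commute)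
qed

text \<open>Cauchy-Schwarz on the diagonal of the Hessian; the remaining squares are
  discarded.\<close>

lemma lap_sq_le: "(lap x)\<^sup>2 \<le> DIM('a) * hess_sq x"
proof -
  have "(\<Sum>i\<in>(Basis::'a set). 1 * v2 i i x)\<^sup>2 \<le> (\<Sum>i\<in>(Basis::'a set). 1\<^sup>2) * (\<Sum>i\<in>Basis. (v2 i i x)\<^sup>2)"
    by (rule Cauchy_Schwarz_ineq_sum)
  moreover have "(\<Sum>i\<in>(Basis::'a set). (v2 i i x)\<^sup>2) \<le> hess_sq x"
    unfolding hess_sq_def
    by (intro sum_mono member_le_sum[where f = "\<lambda>i. (v2 i j x)\<^sup>2" for j]) auto
  ultimately show ?thesis
    by (simp add: lap_def) (meson mult_left_mono of_nat_0_le_iff order_trans)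
qed

text \<open>Integrated Bochner formula: the third derivatives of \<open>v\<close> cancel in the divergence of
  \<open>P (D\<^sup>2v \<nabla>v - \<Delta>v \<nabla>v)\<close>.\<close>

lemma integral_bochner:
  assumes P: "\<And>j. j \<in> Basis \<Longrightarrow> has_partial P j (P1 j)" "continuous_on UNIV P"
    "\<And>j. j \<in> Basis \<Longrightarrow> continuous_on UNIV (P1 j)" "\<And>x. R \<le> norm x \<Longrightarrow> P x = 0"
  defines "T \<equiv> \<lambda>x. (\<Sum>j\<in>Basis. P1 j x * (grad_sq1 j x / 2 - lap x * v1 j x)) + P x * (hess_sq x - (lap x)\<^sup>2)"
  shows "integrable lborel T" "(LINT x|lborel. T x) = 0"
proof -
  define X where "X = (\<lambda>j x. P x * ((\<Sum>i\<in>Basis. v2 i j x * v1 i x) - lap x * v1 j x))"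
  define X' where "X' = (\<lambda>j x. P1 j x * ((\<Sum>i\<in>Basis. v2 i j x * v1 i x) - lap x * v1 j x)
     + P x * ((\<Sum>i\<in>Basis. v3 i j j x * v1 i x + v2 i j x * v2 i j x)
       - ((\<Sum>i\<in>Basis. v3 i i j x) * v1 j x + lap x * v2 j j x)))"
  have "has_partial lap j (\<lambda>x. \<Sum>i\<in>Basis. v3 i i j x)" if "j \<in> Basis" for j
    unfolding lap_def by (intro has_partial_sum p3 that)
  then have X: "has_partial (X j) j (X' j)" if "j \<in> Basis" for j
    unfolding X_def X'_def using that by (intro has_partial_mult has_partial_diff has_partial_sum P p2 p3)
  have cont: "continuous_on UNIV (X j)" "continuous_on UNIV (X' j)" if "j \<in> Basis" for j
    unfolding X_def X'_def using that by (auto intro!: continuous_intros P c1 c2 c3 continuous_lap)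
  have zero: "X j x = 0" if "R \<le> norm x" for j x using P(4)[OF that] by (simp add: X_def)
  have T: "T x = (\<Sum>j\<in>Basis. X' j x)" for x
  proof -
    \<comment> \<open>After interchanging the sums, \<open>sym3\<close> makes the third-order part
      of \<open>D\<^sup>2v \<nabla>v\<close> equal to that of
      \<open>\<Delta>v \<nabla>v\<close>.\<close>
    have "(\<Sum>j\<in>Basis. \<Sum>i\<in>Basis. v3 i j j x * v1 i x) = (\<Sum>i\<in>Basis. \<Sum>j\<in>Basis. v3 i j j x * v1 i x)"
      by (rule sum.swap)
    also have "\<dots> = (\<Sum>j\<in>Basis. (\<Sum>i\<in>Basis. v3 i i j x) * v1 j x)"
      unfolding sum_distrib_right by (intro sum.cong refl arg_cong2[where f = "(*)"] sym3)
    finally have third: "(\<Sum>j\<in>Basis. \<Sum>i\<in>Basis. v3 i j j x * v1 i x)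
      = (\<Sum>j\<in>Basis. (\<Sum>i\<in>Basis. v3 i i j x) * v1 j x)" .
    have "(\<Sum>j\<in>Basis. (\<Sum>i\<in>Basis. v3 i j j x * v1 i x + v2 i j x * v2 i j x)
       - ((\<Sum>i\<in>Basis. v3 i i j x) * v1 j x + lap x * v2 j j x))
      = hess_sq x - lap x * (\<Sum>j\<in>Basis. v2 j j x)"
      by (simp add: sum.distrib sum_subtractf third hess_sq_def power2_eq_square sum_distrib_left)
    then have "hess_sq x - (lap x)\<^sup>2 = (\<Sum>j\<in>Basis. (\<Sum>i\<in>Basis. v3 i j j x * v1 i x + v2 i j x * v2 i j x)
       - ((\<Sum>i\<in>Basis. v3 i i j x) * v1 j x + lap x * v2 j j x))"
      by (simp add: lap_def power2_eq_square)
    then show ?thesis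
      by (simp add: T_def X'_def sum.distrib grad_sq1_def flip: sum_distrib_left)
  qed
  show "integrable lborel T" "(LINT x|lborel. T x) = 0"
    using integral_divergence_eq_0[OF X cont zero, of R] by (simp_all add: T[abs_def])
qed

end

text \<open>The square of the norm avoids a singularity at the origin. Powers with exponent at least
  2 are C^1, which suffices because each integration by parts differentiates the cutoff
  once.\<close>

definition cutoff :: "real \<Rightarrow> 'a::euclidean_space \<Rightarrow> real" where
  "cutoff R x = max 0 (1 - (norm x)\<^sup>2 / R\<^sup>2)"

lemma has_partial_norm_sq: "has_partial (\<lambda>x::'a::euclidean_space. (norm x)\<^sup>2) b (\<lambda>x. 2 * (x \<bullet> b))"
proof -
  have "((\<lambda>t. x \<bullet> x + 2 * t * (x \<bullet> b) + t\<^sup>2 * (b \<bullet> b)) has_real_derivative 2 * (x \<bullet> b)) (at 0)" for x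
    by (auto intro!: derivative_eq_intros)
  moreover have "(norm (x + t *\<^sub>R b))\<^sup>2 = x \<bullet> x + 2 * t * (x \<bullet> b) + t\<^sup>2 * (b \<bullet> b)" for x :: 'a and t
    unfolding power2_norm_eq_inner by (simp add: inner_simps power2_eq_square inner_commute algebra_simps)
  ultimately show ?thesis by (simp add: has_partial_def)
qed

lemma has_partial_cutoff_power:
  assumes "2 \<le> n"
  shows "has_partial (\<lambda>x::'a::euclidean_space. cutoff R x ^ n) b
     (\<lambda>x. n * cutoff R x ^ (n - 1) * (- 2 * (x \<bullet> b) / R\<^sup>2))"
proof -
  have "has_partial (\<lambda>x::'a. 1 - (norm x)\<^sup>2 * (1 / R\<^sup>2)) b (\<lambda>x. 0 - (2 * (x \<bullet> b) * (1 / R\<^sup>2) + (norm x)\<^sup>2 * 0))"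
    by (intro has_partial_diff has_partial_mult has_partial_const has_partial_norm_sq)
  from has_partial_compose[OF this, of "\<lambda>s. max 0 s ^ n" "\<lambda>s. n * max 0 s ^ (n - 1)"]
  show ?thesis
    unfolding cutoff_def by (rule has_partial_cong) (use assms has_derivative_pos_part_power in auto)
qed

lemma continuous_cutoff: "0 < R \<Longrightarrow> continuous_on UNIV (cutoff R)"
  unfolding cutoff_def by (intro continuous_intros) auto

lemma cutoff_bounds: "0 \<le> cutoff R x" "cutoff R x \<le> 1"
  by (auto simp: cutoff_def)

lemma cutoff_pos_iff: "0 < R \<Longrightarrow> 0 < cutoff R x \<longleftrightarrow> norm x < R"
proof -
  assume "0 < R"
  then have "(norm x)\<^sup>2 / R\<^sup>2 < 1 \<longleftrightarrow> (norm x)\<^sup>2 < R\<^sup>2"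
    by (simp add: pos_divide_less_eq)
  also have "\<dots> \<longleftrightarrow> norm x < R"
    using \<open>0 < R\<close> power2_less_imp_less[of "norm x" R] power_strict_mono[of "norm x" R 2] by auto
  finally have "(norm x)\<^sup>2 / R\<^sup>2 < 1 \<longleftrightarrow> norm x < R" .
  then show ?thesis by (auto simp: cutoff_def max_def)
qed

text \<open>The factor \<open>s powr r\<close> is singular at \<open>0\<close>, but the truncated power in front of it vanishes
  near \<open>0\<close>.\<close>

lemma has_derivative_truncated_powr:
  fixes s \<delta> r :: real and m :: nat
  assumes "2 \<le> m" "0 < \<delta>"
  shows "((\<lambda>s. max 0 (s - \<delta>) ^ m * s powr r) has_real_derivative
     m * max 0 (s - \<delta>) ^ (m - 1) * max \<delta> s powr r + r * max 0 (s - \<delta>) ^ m * max \<delta> s powr (r - 1)) (at s)"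
proof (cases "s < \<delta>")
  case True
  have "((\<lambda>s. max 0 (s - \<delta>) ^ m * s powr r) has_real_derivative 0) (at s)"
    by (rule has_field_derivative_transform_within_open[of "\<lambda>_. 0" 0 s "{..<\<delta>}"])
       (use True assms in auto)
  then show ?thesis using True assms by (simp add: max_absorb1 power_0_left)
next
  case False
  have "((\<lambda>s. max 0 (s - \<delta>) ^ m) has_real_derivative m * max 0 (s - \<delta>) ^ (m - 1) * 1) (at s)"
    by (rule DERIV_chain2[OF has_derivative_pos_part_power[OF assms(1)]]) (auto intro!: derivative_eq_intros)
  moreover have "((\<lambda>s. s powr r) has_real_derivative r * s powr (r - 1)) (at s)"
    using False assms by (intro has_real_derivative_powr) auto
  ultimately have "((\<lambda>s. max 0 (s - \<delta>) ^ m * s powr r) has_real_derivative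
      m * max 0 (s - \<delta>) ^ (m - 1) * 1 * s powr r + r * s powr (r - 1) * max 0 (s - \<delta>) ^ m) (at s)"
    by (rule DERIV_mult)
  then show ?thesis using False by (simp add: max_absorb2 mult_ac)
qed

text \<open>\<open>err\<close> bounds the defect in \<open>\<Delta>v = \<mu> v powr A * Z powr (q / 2) + K Z / v\<close>, the equation satisfied
  by \<open>v = u powr (- \<sigma>)\<close> for an exact solution \<open>u\<close>, but only where \<open>Z = |\<nabla>v|\<^sup>2\<close> exceeds \<open>\<delta>\<close>.\<close>

locale bernstein = smooth_field v v1 v2 v3
  for v :: "'a::euclidean_space \<Rightarrow> real" and v1 v2 v3 +
  fixes K c A \<mu> q \<delta> R \<eta> V M \<Gamma> :: real and m n :: nat
  assumes v_pos: "\<And>x. 0 < v x" and K: "0 < K" and c: "c = K\<^sup>2 / DIM('a) - K" "0 < c"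
    and A: "0 \<le> A + 2 * K / DIM('a)" and \<mu>: "0 \<le> \<mu>"
    and m: "2 \<le> m" "q\<^sup>2 * DIM('a) \<le> 2 * m" "4 * K\<^sup>2 \<le> m * c" and n: "n = 2 * m + 4"
    and \<delta>: "0 < \<delta>" and R: "0 < R" and \<eta>: "0 \<le> \<eta>" "\<eta> \<le> 1"
    and V: "\<And>x. norm x < R \<Longrightarrow> v x \<le> V"
    and M: "\<And>x. norm x < R \<Longrightarrow> grad_sq x \<le> M"
    and \<Gamma>: "\<And>x. norm x < R \<Longrightarrow> \<delta> < grad_sq x \<Longrightarrow>
        \<mu> * v x powr A * grad_sq x powr (q / 2) + K * grad_sq x / v x \<le> \<Gamma>"
    and \<Gamma>_nonneg: "0 \<le> \<Gamma>"
    and err: "\<And>x. norm x < R \<Longrightarrow> \<delta> < grad_sq x \<Longrightarrow>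
        \<bar>lap x - (\<mu> * v x powr A * grad_sq x powr (q / 2) + K * grad_sq x / v x)\<bar> \<le> \<eta>"
begin

abbreviation "G0 x \<equiv> \<mu> * v x powr A * grad_sq x powr (q / 2) + K * grad_sq x / v x"
abbreviation "W x \<equiv> max 0 (grad_sq x - \<delta>) ^ m"
abbreviation "W' x \<equiv> m * max 0 (grad_sq x - \<delta>) ^ (m - 1)"
abbreviation "\<phi> x \<equiv> cutoff R x ^ n"
abbreviation "\<phi>1 j x \<equiv> n * cutoff R x ^ (n - 1) * (- 2 * (x \<bullet> j) / R\<^sup>2)"

definition "P x = \<phi> x * W x"
definition "P1 j x = \<phi>1 j x * W x + \<phi> x * (W' x * grad_sq1 j x)"

lemma has_partial_W: "j \<in> Basis \<Longrightarrow> has_partial W j (\<lambda>x. W' x * grad_sq1 j x)"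
proof -
  assume "j \<in> Basis"
  have "((\<lambda>s. max 0 (s - \<delta>) ^ m) has_real_derivative m * max 0 (s - \<delta>) ^ (m - 1) * 1) (at s)" for s
    by (rule DERIV_chain2[OF has_derivative_pos_part_power[OF m(1)]]) (auto intro!: derivative_eq_intros)
  from has_partial_compose[OF has_partial_grad_sq this] \<open>j \<in> Basis\<close>
  show ?thesis by simp
qed

lemma continuous_phi: "continuous_on UNIV (\<lambda>x. cutoff R x ^ k :: real)"
  by (intro continuous_intros continuous_cutoff R)

lemma P_props: "j \<in> Basis \<Longrightarrow> has_partial P j (P1 j)" "continuous_on UNIV P"
    "j \<in> Basis \<Longrightarrow> continuous_on UNIV (P1 j)" "R \<le> norm x \<Longrightarrow> P x = 0"
proof -
  show "has_partial P j (P1 j)" if "j \<in> Basis"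
    unfolding P_def P1_def using that n
    by (intro has_partial_mult has_partial_cutoff_power has_partial_W) auto
  show "continuous_on UNIV P"
    unfolding P_def by (intro continuous_intros continuous_phi continuous_grad_sq)
  show "continuous_on UNIV (P1 j)" if "j \<in> Basis"
    unfolding P1_def using R that
    by (intro continuous_intros continuous_phi continuous_grad_sq continuous_grad_sq1) auto
  have n0: "0 < n" using n by simp
  have "cutoff R x = 0" if "R \<le> norm x"
    using cutoff_pos_iff[OF R, of x] cutoff_bounds(1)[of R x] that by linarith
  then show "P x = 0" if "R \<le> norm x" using n0 that by (simp add: P_def)
qed

text \<open>This is \<open>P\<close> times the exact right-hand side \<open>G0\<close>.
  \<open>W\<close> stays next to the power of \<open>grad_sq\<close>, since the power alone may be
  singular where the gradient of \<open>v\<close> vanishes; writing \<open>grad_sq x powr 1\<close>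
  lets one differentiation rule serve both terms.\<close>

definition "F x = \<phi> x * (\<mu> * v x powr A * (W x * grad_sq x powr (q / 2)) + K * (W x * grad_sq x powr 1) * inverse (v x))"
definition "F1 j x = \<phi>1 j x * (\<mu> * v x powr A * (W x * grad_sq x powr (q / 2)) + K * (W x * grad_sq x powr 1) * inverse (v x))
   + \<phi> x * ((\<mu> * (A * v x powr (A - 1) * v1 j x) * (W x * grad_sq x powr (q / 2))
     + \<mu> * v x powr A * ((W' x * max \<delta> (grad_sq x) powr (q / 2)
         + q / 2 * W x * max \<delta> (grad_sq x) powr (q / 2 - 1)) * grad_sq1 j x))
     + (K * ((W' x * max \<delta> (grad_sq x) powr 1
         + 1 * W x * max \<delta> (grad_sq x) powr (1 - 1)) * grad_sq1 j x) * inverse (v x)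
     + K * (W x * grad_sq x powr 1) * (- (inverse (v x) ^ 2) * v1 j x)))"

text \<open>Where \<open>grad_sq x < \<delta>\<close> both sides vanish with \<open>W x\<close>. On
  the right the base is bounded away from 0, so continuity is clear for every exponent.\<close>

lemma W_powr: "W x * grad_sq x powr r = W x * max \<delta> (grad_sq x) powr r"
proof (cases "grad_sq x < \<delta>")
  case True
  moreover have "m \<noteq> 0" using m(1) by simp
  ultimately show ?thesis by (simp add: max_absorb1)
next
  case False
  then show ?thesis by (simp add: max_absorb2)
qed

lemma F_props: "j \<in> Basis \<Longrightarrow> has_partial F j (F1 j)" "continuous_on UNIV F"
    "j \<in> Basis \<Longrightarrow> continuous_on UNIV (F1 j)" "R \<le> norm x \<Longrightarrow> F x = 0"
proof -
  have vA: "has_partial (\<lambda>x. v x powr A) j (\<lambda>x. A * v x powr (A - 1) * v1 j x)" if "j \<in> Basis"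
    by (rule has_partial_compose[OF p1[OF that], of "\<lambda>s. s powr A" "\<lambda>s. A * s powr (A - 1)"])
       (rule has_real_derivative_powr[OF v_pos])
  have vne: "v x \<noteq> 0" for x using v_pos[of x] by simp
  have vinv: "has_partial (\<lambda>x. inverse (v x)) j (\<lambda>x. - (inverse (v x) ^ 2) * v1 j x)" if "j \<in> Basis"
    by (rule has_partial_compose[OF p1[OF that], of inverse "\<lambda>s. - (inverse s ^ 2)"])
       (use DERIV_inverse[OF vne] in \<open>simp add: numeral_eq_Suc\<close>)
  have Wr: "has_partial (\<lambda>x. W x * grad_sq x powr r) j (\<lambda>x. (W' x * max \<delta> (grad_sq x) powr r
         + r * W x * max \<delta> (grad_sq x) powr (r - 1)) * grad_sq1 j x)" if "j \<in> Basis" for r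
    by (rule has_partial_compose[OF has_partial_grad_sq[OF that], of "\<lambda>s. max 0 (s - \<delta>) ^ m * s powr r"
      "\<lambda>s. m * max 0 (s - \<delta>) ^ (m - 1) * max \<delta> s powr r + r * max 0 (s - \<delta>) ^ m * max \<delta> s powr (r - 1)"])
       (rule has_derivative_truncated_powr[OF m(1) \<delta>])
  have const: "has_partial (\<lambda>x. a * f x) j (\<lambda>x. a * f' x)" if "has_partial f j f'" for a f f'
    using has_partial_mult[OF has_partial_const[of a] that] by (rule has_partial_cong) auto
  show "has_partial F j (F1 j)" if j: "j \<in> Basis"
  proof -
    have "2 \<le> n" using n by simp
    note * = has_partial_mult[OF has_partial_cutoff_power[OF this]
        has_partial_add[OF has_partial_mult[OF const[OF vA[OF j]] Wr[OF j]]
          has_partial_mult[OF const[OF Wr[OF j]] vinv[OF j]]]]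
    show ?thesis unfolding F_def F1_def by (rule *)
  qed
  have maxne: "max \<delta> (grad_sq x) \<noteq> 0" for x using \<delta> by linarith
  show "continuous_on UNIV F"
    unfolding F_def W_powr
    by (intro continuous_intros continuous_phi continuous_grad_sq c0 ballI vne maxne)
  show "continuous_on UNIV (F1 j)" if j: "j \<in> Basis"
  proof -
    have phi1: "continuous_on UNIV (\<lambda>x. \<phi>1 j x)"
      using R by (intro continuous_intros continuous_phi) auto
    have W: "continuous_on UNIV (\<lambda>x. W x)" "continuous_on UNIV (\<lambda>x. W' x)"
      by (intro continuous_intros continuous_grad_sq)+
    have Z: "continuous_on UNIV (\<lambda>x. max \<delta> (grad_sq x) powr r)" for r
      by (intro continuous_intros continuous_grad_sq ballI maxne)
    have vA: "continuous_on UNIV (\<lambda>x. v x powr r)" for r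
      by (intro continuous_intros c0 ballI vne)
    have vi: "continuous_on UNIV (\<lambda>x. inverse (v x))"
      by (intro continuous_intros c0 ballI vne)
    show ?thesis
      unfolding F1_def W_powr
      by (intro continuous_on_add continuous_on_mult continuous_on_minus continuous_on_power continuous_on_const
          phi1 W Z vA vi c1 j continuous_grad_sq1 continuous_phi)
  qed
  have n0: "0 < n" using n by simp
  have "cutoff R x = 0" if "R \<le> norm x"
    using cutoff_pos_iff[OF R, of x] cutoff_bounds(1)[of R x] that by linarith
  then show "F x = 0" if "R \<le> norm x" using n0 that by (simp add: F_def)
qed

end

section \<open>From the pointwise inequality to the integral estimate\<close>

context bernstein begin

text \<open>The first summand is the constant from \<open>absorb_cutoff\<close>, made small by a
  large \<open>R\<close>; the second collects the mollification error and is made small afterwards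
  through \<open>\<eta>\<close>.\<close>

definition C :: real where
  "C = (4 * V\<^sup>2 / c) ^ (m + 1) * (2 * n\<^sup>2 / (m * R\<^sup>2)) ^ (m + 2)
     + \<eta> * (M ^ m * (3 * \<Gamma> + 1 + 2 * m + sqrt M * (2 * n / R)))"

lemma grad_sq_nonneg: "0 \<le> grad_sq x"
  unfolding grad_sq_def by (intro sum_nonneg) simp

lemma C_nonneg: "0 \<le> C"
proof -
  have "0 \<le> M" using M[of 0] grad_sq_nonneg[of 0] R by simp
  then show ?thesis
    unfolding C_def using \<eta> \<Gamma>_nonneg c R by (intro add_nonneg_nonneg mult_nonneg_nonneg zero_le_power) auto
qed

lemma sum_P1:
  "(\<Sum>j\<in>Basis. P1 j x * (grad_sq1 j x / 2 - G * v1 j x))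
   = (W x * (\<Sum>j\<in>Basis. \<phi>1 j x * grad_sq1 j x) + \<phi> x * W' x * (\<Sum>j\<in>Basis. (grad_sq1 j x)\<^sup>2)) / 2
     - G * (W x * (\<Sum>j\<in>Basis. \<phi>1 j x * v1 j x) + \<phi> x * W' x * (\<Sum>j\<in>Basis. v1 j x * grad_sq1 j x))"
proof -
  define f1 w w' f where "f1 = (\<lambda>j. \<phi>1 j x)" "w = W x" "w' = W' x" "f = \<phi> x"
  have P1: "P1 j x = f1 j * w + f * (w' * grad_sq1 j x)" for j
    by (simp only: P1_def f1_w_w'_f_def)
  have "P1 j x * (grad_sq1 j x / 2 - G * v1 j x)
     = (w / 2) * (f1 j * grad_sq1 j x) + (f * w' / 2) * (grad_sq1 j x)\<^sup>2
       - ((G * w) * (f1 j * v1 j x) + (G * f * w') * (v1 j x * grad_sq1 j x))" for j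
    unfolding P1 by (simp add: field_simps power2_eq_square)
  then have "(\<Sum>j\<in>Basis. P1 j x * (grad_sq1 j x / 2 - G * v1 j x))
     = (w * (\<Sum>j\<in>Basis. f1 j * grad_sq1 j x) + f * w' * (\<Sum>j\<in>Basis. (grad_sq1 j x)\<^sup>2)) / 2
     - G * (w * (\<Sum>j\<in>Basis. f1 j * v1 j x) + f * w' * (\<Sum>j\<in>Basis. v1 j x * grad_sq1 j x))"
    by (simp add: sum.distrib sum_subtractf add_divide_distrib distrib_left mult_ac flip: sum_distrib_left sum_divide_distrib)
  then show ?thesis by (simp only: f1_w_w'_f_def)
qed

lemma F_inside:
  assumes "\<delta> < grad_sq x"
  shows "F x = \<phi> x * W x * G0 x"
    and "F1 j x = \<phi>1 j x * (W x * G0 x) + \<phi> x * W' x * G0 x * grad_sq1 j x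
      + \<phi> x * W x * (\<mu> * v x powr A * grad_sq x powr (q / 2) * (A * v1 j x / v x + q / 2 * grad_sq1 j x / grad_sq x)
         + K * (grad_sq1 j x / v x - grad_sq x * v1 j x / (v x)\<^sup>2))"
proof -
  define f1 w w' f where "f1 = \<phi>1 j x" "w = W x" "w' = W' x" "f = \<phi> x"
  have pos: "0 < v x" "0 < grad_sq x" using v_pos assms \<delta> by auto
  have powr: "v x powr (A - 1) = v x powr A / v x"
    "grad_sq x powr (q / 2 - 1) = grad_sq x powr (q / 2) / grad_sq x"
    using pos by (simp_all add: powr_diff)
  have max: "max \<delta> (grad_sq x) = grad_sq x" using assms by simp
  show "F x = \<phi> x * W x * G0 x"
    unfolding F_def f1_w_w'_f_def[symmetric] using pos by (simp add: field_simps)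
  show "F1 j x = \<phi>1 j x * (W x * G0 x) + \<phi> x * W' x * G0 x * grad_sq1 j x
      + \<phi> x * W x * (\<mu> * v x powr A * grad_sq x powr (q / 2) * (A * v1 j x / v x + q / 2 * grad_sq1 j x / grad_sq x)
         + K * (grad_sq1 j x / v x - grad_sq x * v1 j x / (v x)\<^sup>2))"
    unfolding F1_def max powr f1_w_w'_f_def[symmetric] using pos
    by (simp add: field_simps power2_eq_square)
qed

text \<open>The left side is the divergence of \<open>F \<nabla>v\<close>. Its first group repeats
  that of \<open>sum_P1\<close> with \<open>G0 x\<close> for the Laplacian and the opposite sign, so
  that their sum leaves only the defect \<open>lap x - G0 x\<close> as a factor.\<close>

lemma sum_F1:
  assumes "\<delta> < grad_sq x"
  shows "(\<Sum>j\<in>Basis. F1 j x * v1 j x + F x * v2 j j x)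
   = G0 x * (W x * (\<Sum>j\<in>Basis. \<phi>1 j x * v1 j x) + \<phi> x * W' x * (\<Sum>j\<in>Basis. v1 j x * grad_sq1 j x)
        + \<phi> x * W x * lap x)
     + \<phi> x * W x * (\<mu> * v x powr A * grad_sq x powr (q / 2)
           * (A * grad_sq x / v x + q / 2 * (\<Sum>j\<in>Basis. v1 j x * grad_sq1 j x) / grad_sq x)
         + K * ((\<Sum>j\<in>Basis. v1 j x * grad_sq1 j x) / v x - (grad_sq x)\<^sup>2 / (v x)\<^sup>2))"
proof -
  define f1 w w' f g h z u where "f1 = (\<lambda>j. \<phi>1 j x)" "w = W x" "w' = W' x" "f = \<phi> x" "g = G0 x"
    "h = \<mu> * v x powr A * grad_sq x powr (q / 2)" "z = grad_sq x" "u = v x"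
  note defs = f1_w_w'_f_g_h_z_u_def
  have z: "(\<Sum>j\<in>Basis. (v1 j x)\<^sup>2) = z" by (simp add: defs grad_sq_def)
  have F: "F x = f * w * g" by (simp only: F_inside(1)[OF assms] defs)
  have F1: "F1 j x = f1 j * (w * g) + f * w' * g * grad_sq1 j x
      + f * w * (h * (A * v1 j x / u + q / 2 * grad_sq1 j x / z) + K * (grad_sq1 j x / u - z * v1 j x / u\<^sup>2))" for j
    by (simp only: F_inside(2)[OF assms] defs)
  have "F1 j x * v1 j x = (w * g) * (f1 j * v1 j x) + (f * w' * g + f * w * h * q / (2 * z) + f * w * K / u) * (v1 j x * grad_sq1 j x)
     + (f * w * h * A / u - f * w * K * z / u\<^sup>2) * (v1 j x)\<^sup>2" for j
    unfolding F1 by (simp add: algebra_simps power2_eq_square)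
  then have "(\<Sum>j\<in>Basis. F1 j x * v1 j x) = (w * g) * (\<Sum>j\<in>Basis. f1 j * v1 j x)
     + (f * w' * g + f * w * h * q / (2 * z) + f * w * K / u) * (\<Sum>j\<in>Basis. v1 j x * grad_sq1 j x)
     + (f * w * h * A / u - f * w * K * z / u\<^sup>2) * z"
    by (simp add: sum.distrib z flip: sum_distrib_left)
  moreover have "(\<Sum>j\<in>Basis. F x * v2 j j x) = f * w * g * lap x"
    by (simp add: F lap_def sum_distrib_left)
  ultimately have "(\<Sum>j\<in>Basis. F1 j x * v1 j x + F x * v2 j j x)
    = g * (w * (\<Sum>j\<in>Basis. f1 j * v1 j x) + f * w' * (\<Sum>j\<in>Basis. v1 j x * grad_sq1 j x) + f * w * lap x)
     + f * w * (h * (A * z / u + q / 2 * (\<Sum>j\<in>Basis. v1 j x * grad_sq1 j x) / z)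
         + K * ((\<Sum>j\<in>Basis. v1 j x * grad_sq1 j x) / u - z\<^sup>2 / u\<^sup>2))"
    by (simp add: sum.distrib algebra_simps power2_eq_square)
  then show ?thesis by (simp only: defs)
qed

text \<open>Outside the ball the cutoff vanishes, and where \<open>grad_sq x \<le> \<delta>\<close>
  the truncated power does. On the rest the equation holds up to \<open>\<eta>\<close> and
  \<open>bernstein_pointwise\<close> applies; \<open>V\<close>, \<open>M\<close> and
  \<open>\<Gamma>\<close> turn its remainder into \<open>C\<close>.\<close>

lemma pointwise_lower_bound:
  "\<phi> x * W x * (c / 4 * (grad_sq x)\<^sup>2 / (v x)\<^sup>2) - C * indicator (ball 0 R) x
   \<le> ((\<Sum>j\<in>Basis. P1 j x * (grad_sq1 j x / 2 - lap x * v1 j x)) + P x * (hess_sq x - (lap x)\<^sup>2))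
     + (\<Sum>j\<in>Basis. F1 j x * v1 j x + F x * v2 j j x)"
proof -
  \<comment> \<open>The lower exponents matter too: \<open>P1\<close> and \<open>F1\<close> contain
    them and must vanish along with \<open>P\<close> and \<open>F\<close>.\<close>
  have n0: "n \<noteq> 0" "n - 1 \<noteq> 0" "m \<noteq> 0" "m - 1 \<noteq> 0" using n m(1) by auto
  consider "R \<le> norm x" | "norm x < R" "grad_sq x \<le> \<delta>" | "norm x < R" "\<delta> < grad_sq x" by linarith
  then show ?thesis
  proof cases
    case 1
    then have "cutoff R x = 0"
      using cutoff_pos_iff[OF R, of x] cutoff_bounds(1)[of R x] by linarith
    then have phi: "\<phi> x = 0" "cutoff R x ^ (n - 1) = 0" using n0 by (auto simp only: power_eq_0_iff)
    have "P x = 0" "F x = 0" "P1 j x = 0" "F1 j x = 0" "\<phi> x = 0" for j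
      unfolding P_def F_def P1_def F1_def phi by simp_all
    then show ?thesis unfolding phi using 1 by simp
  next
    case 2
    then have "max 0 (grad_sq x - \<delta>) = 0" by simp
    then have w: "W x = 0" "max 0 (grad_sq x - \<delta>) ^ (m - 1) = 0" using n0 by (auto simp only: power_eq_0_iff)
    have "P x = 0" "F x = 0" "P1 j x = 0" "F1 j x = 0" "W x = 0" for j
      unfolding P_def F_def P1_def F1_def w by simp_all
    then show ?thesis unfolding w using C_nonneg 2 by simp
  next
    case 3
    define z a s where "z = grad_sq x" "a = sqrt (\<Sum>j\<in>Basis. (grad_sq1 j x)\<^sup>2)" "s = sqrt (grad_sq x)"
    note zas = z_a_s_def
    define I J L where "I = (\<Sum>j\<in>Basis. v1 j x * grad_sq1 j x)" "J = (\<Sum>j\<in>Basis. \<phi>1 j x * grad_sq1 j x)"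
      "L = (\<Sum>j\<in>Basis. \<phi>1 j x * v1 j x)"
    note IJL = I_J_L_def
    have z: "0 < z" "\<delta> < z" using 3 \<delta> by (auto simp: zas)
    have s: "s\<^sup>2 = z" "0 < s" using z by (auto simp: zas)
    have a2: "a\<^sup>2 = (\<Sum>j\<in>Basis. (grad_sq1 j x)\<^sup>2)" "0 \<le> a" by (auto simp: zas sum_nonneg)
    have psi: "0 < cutoff R x" "cutoff R x \<le> 1" using cutoff_pos_iff[OF R] 3 cutoff_bounds by auto
    have w: "W x = (z - \<delta>) ^ m" "W' x = m * (z - \<delta>) ^ (m - 1)" using z by (auto simp: zas)
    have phi1: "sqrt (\<Sum>j\<in>Basis. (\<phi>1 j x)\<^sup>2) \<le> n * cutoff R x ^ (n - 1) * (2 / R)"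
    proof -
      have "(\<Sum>j\<in>Basis. (\<phi>1 j x)\<^sup>2) = (\<Sum>j\<in>Basis. (n * cutoff R x ^ (n - 1) * (2 / R\<^sup>2))\<^sup>2 * (x \<bullet> j)\<^sup>2)"
        by (intro sum.cong refl) (simp add: power_mult_distrib power_divide)
      also have "\<dots> = (n * cutoff R x ^ (n - 1) * (2 / R\<^sup>2) * norm x)\<^sup>2"
        unfolding power_mult_distrib[of _ "norm x"] sum_distrib_left[symmetric] power2_norm_eq_inner
        by (simp add: euclidean_inner[of x x] power2_eq_square)
      finally have "sqrt (\<Sum>j\<in>Basis. (\<phi>1 j x)\<^sup>2) = n * cutoff R x ^ (n - 1) * (2 / R\<^sup>2) * norm x"
        using psi by simp
      also have "\<dots> \<le> n * cutoff R x ^ (n - 1) * (2 / R\<^sup>2) * R"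
        using 3 psi by (intro mult_left_mono) auto
      also have "\<dots> = n * cutoff R x ^ (n - 1) * (2 / R)"
        using R by (simp add: power2_eq_square)
      finally show ?thesis .
    qed
    have I: "\<bar>I\<bar> \<le> s * a"
      unfolding IJL zas grad_sq_def by (rule abs_sum_mult_le_sqrt)
    have J: "\<bar>J\<bar> \<le> a * (n * cutoff R x ^ (n - 1) * (2 / R))"
    proof -
      have "\<bar>J\<bar> \<le> sqrt (\<Sum>j\<in>Basis. (\<phi>1 j x)\<^sup>2) * a" unfolding IJL zas by (rule abs_sum_mult_le_sqrt)
      also have "\<dots> \<le> (n * cutoff R x ^ (n - 1) * (2 / R)) * a" using phi1 a2(2) by (rule mult_right_mono)
      finally show ?thesis by (simp only: mult.commute)
    qed
    have L: "\<bar>L\<bar> \<le> s * (n * cutoff R x ^ (n - 1) * (2 / R))"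
    proof -
      have "\<bar>L\<bar> \<le> sqrt (\<Sum>j\<in>Basis. (\<phi>1 j x)\<^sup>2) * s"
        unfolding IJL zas grad_sq_def by (rule abs_sum_mult_le_sqrt)
      also have "\<dots> \<le> (n * cutoff R x ^ (n - 1) * (2 / R)) * s" using phi1 s(2) by (intro mult_right_mono) auto
      finally show ?thesis by (simp only: mult.commute)
    qed
    define H e where "H = \<mu> * v x powr A * grad_sq x powr (q / 2)" "e = lap x - G0 x"
    have e: "\<bar>e\<bar> \<le> \<eta>" using err[OF 3] by (simp add: H_e_def)
    have H: "0 \<le> H" using \<mu> by (simp add: H_e_def)
    have G0: "G0 x = H + K * z / v x" by (simp add: H_e_def zas)
    have W1: "0 \<le> W x" "W x \<le> z ^ m" "W' x \<le> m * z ^ (m - 1)" "m * W x \<le> W' x * z"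
    proof -
      show "0 \<le> W x" by simp
      show "W x \<le> z ^ m" unfolding w using z \<delta> by (intro power_mono) auto
      show "W' x \<le> m * z ^ (m - 1)" unfolding w using z \<delta> by (intro mult_left_mono power_mono) auto
      have "(z - \<delta>) ^ m = (z - \<delta>) ^ (m - 1) * (z - \<delta>)" using n0 by (simp add: power_eq_if)
      also have "\<dots> \<le> (z - \<delta>) ^ (m - 1) * z" using z \<delta> by (intro mult_left_mono) auto
      finally show "m * W x \<le> W' x * z" unfolding w by (simp add: mult_left_mono mult.assoc)
    qed
    have key: "\<phi> x * W x * (c / 4 * z\<^sup>2 / (v x)\<^sup>2)
     - (4 * (v x)\<^sup>2 / c) ^ (m + 1) * (2 * n\<^sup>2 / (m * R\<^sup>2)) ^ (m + 2)
     - \<eta> * (z ^ m * (3 * G0 x + 1 + 2 * m + s * (2 * n / R)))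
   \<le> \<phi> x * W x * hess_sq x + (\<phi> x * W' x * a\<^sup>2 + W x * J) / 2
     - e * (\<phi> x * W x * lap x + \<phi> x * W' x * I + W x * L)
     + \<phi> x * W x * (H * (A * z / v x + q / 2 * I / z) + K * (I / v x - z\<^sup>2 / (v x)\<^sup>2))"
      using bernstein_pointwise[OF z(1) s(1,2) v_pos H K _ _ m(2,3) n psi W1(1,4,2,3) G0 _ lap_sq_le c A a2(2)
          I J L R e \<eta>(2)] m(1) by (simp add: H_e_def(2) Suc_leI)
    have "(4 * (v x)\<^sup>2 / c) ^ (m + 1) * (2 * n\<^sup>2 / (m * R\<^sup>2)) ^ (m + 2)
      \<le> (4 * V\<^sup>2 / c) ^ (m + 1) * (2 * n\<^sup>2 / (m * R\<^sup>2)) ^ (m + 2)"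
      using V[OF 3(1)] v_pos[of x] c by (intro mult_right_mono power_mono divide_right_mono mult_left_mono) auto
    moreover have "\<eta> * (z ^ m * (3 * G0 x + 1 + 2 * m + s * (2 * n / R)))
      \<le> \<eta> * (M ^ m * (3 * \<Gamma> + 1 + 2 * m + sqrt M * (2 * n / R)))"
    proof (rule mult_left_mono[OF mult_mono \<eta>(1)])
      show "z ^ m \<le> M ^ m" using M[OF 3(1)] z by (intro power_mono) (auto simp: zas)
      have "s * (2 * n / R) \<le> sqrt M * (2 * n / R)"
        using M[OF 3(1)] R by (intro mult_right_mono) (auto simp: zas)
      then show "3 * G0 x + 1 + 2 * m + s * (2 * n / R) \<le> 3 * \<Gamma> + 1 + 2 * m + sqrt M * (2 * n / R)"
        using \<Gamma>[OF 3] by (intro add_mono mult_left_mono order_refl) simp_all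
      show "0 \<le> M ^ m" using M[OF 3(1)] z by (intro zero_le_power) (auto simp: zas)
      have "0 \<le> G0 x" unfolding G0 using H K z v_pos[of x] by auto
      then show "0 \<le> 3 * G0 x + 1 + 2 * m + s * (2 * n / R)" using s R by (intro add_nonneg_nonneg) auto
    qed
    ultimately have "\<phi> x * W x * (c / 4 * z\<^sup>2 / (v x)\<^sup>2) - C
     \<le> \<phi> x * W x * (c / 4 * z\<^sup>2 / (v x)\<^sup>2)
     - (4 * (v x)\<^sup>2 / c) ^ (m + 1) * (2 * n\<^sup>2 / (m * R\<^sup>2)) ^ (m + 2)
     - \<eta> * (z ^ m * (3 * G0 x + 1 + 2 * m + s * (2 * n / R)))"
      unfolding C_def by linarith
    also note key
    also have "\<phi> x * W x * hess_sq x + (\<phi> x * W' x * a\<^sup>2 + W x * J) / 2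
     - e * (\<phi> x * W x * lap x + \<phi> x * W' x * I + W x * L)
     + \<phi> x * W x * (H * (A * z / v x + q / 2 * I / z) + K * (I / v x - z\<^sup>2 / (v x)\<^sup>2))
     = ((\<Sum>j\<in>Basis. P1 j x * (grad_sq1 j x / 2 - lap x * v1 j x)) + P x * (hess_sq x - (lap x)\<^sup>2))
     + (\<Sum>j\<in>Basis. F1 j x * v1 j x + F x * v2 j j x)"
    proof -
      have S: "(\<Sum>j\<in>Basis. P1 j x * (grad_sq1 j x / 2 - lap x * v1 j x))
        = (W x * J + \<phi> x * W' x * a\<^sup>2) / 2 - lap x * (W x * L + \<phi> x * W' x * I)"
        by (simp only: sum_P1 IJL a2(1))
      have S': "(\<Sum>j\<in>Basis. F1 j x * v1 j x + F x * v2 j j x)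
        = G0 x * (W x * L + \<phi> x * W' x * I + \<phi> x * W x * lap x)
          + \<phi> x * W x * (H * (A * z / v x + q / 2 * I / z) + K * (I / v x - z\<^sup>2 / (v x)\<^sup>2))"
        by (simp only: sum_F1[OF 3(2)] IJL H_e_def(1) zas(1))
      \<comment> \<open>With \<open>l\<close> the Laplacian and \<open>g = G0 x\<close>, the terms
        \<open>- l\<^sup>2\<close> from Bochner's formula and \<open>g * l\<close> from the
        divergence of \<open>F \<nabla>v\<close> combine to \<open>- (l - g) * l\<close>.\<close>
      have alg: "f * w * d + (f * w' * b + w * J) / 2 - (l - g) * (f * w * l + f * w' * I + w * L) + Q
        = ((w * J + f * w' * b) / 2 - l * (w * L + f * w' * I) + f * w * (d - l\<^sup>2))
          + (g * (w * L + f * w' * I + f * w * l) + Q)" for f w w' d b l g Q :: real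
        by (simp add: algebra_simps power2_eq_square add_divide_distrib)
      show ?thesis unfolding S S' P_def H_e_def(2) by (rule alg)
    qed
    finally show ?thesis using 3 by (simp add: zas)
  qed
qed

text \<open>The right side of \<open>pointwise_lower_bound\<close> is a sum of two divergences of
  fields supported in the closed ball of radius \<open>R\<close>, so its integral is 0.\<close>

theorem integral_estimate:
  "integrable lborel (\<lambda>x. \<phi> x * W x * (c / 4 * (grad_sq x)\<^sup>2 / (v x)\<^sup>2))"
  "(LINT x|lborel. \<phi> x * W x * (c / 4 * (grad_sq x)\<^sup>2 / (v x)\<^sup>2)) \<le> C * measure lborel (ball (0::'a) R)"
proof -
  define T where "T = (\<lambda>x. (\<Sum>j\<in>Basis. P1 j x * (grad_sq1 j x / 2 - lap x * v1 j x)) + P x * (hess_sq x - (lap x)\<^sup>2))"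
  define Y where "Y = (\<lambda>x. \<Sum>j\<in>Basis. F1 j x * v1 j x + F x * v2 j j x)"
  have T: "integrable lborel T" "(LINT x|lborel. T x) = 0"
    unfolding T_def by (rule integral_bochner[where R = R]; use P_props in blast)+
  have Y: "integrable lborel Y" "(LINT x|lborel. Y x) = 0"
    unfolding Y_def
    by (rule integral_divergence_eq_0[where R = R and X = "\<lambda>j x. F x * v1 j x"];
        use F_props c1 c2 p2 in \<open>auto intro!: has_partial_mult continuous_intros\<close>)+
  define E where "E = (\<lambda>x. \<phi> x * W x * (c / 4 * (grad_sq x)\<^sup>2 / (v x)\<^sup>2))"
  have vne: "(v x)\<^sup>2 \<noteq> 0" for x using v_pos[of x] by simp
  have "continuous_on UNIV E"
    unfolding E_def by (intro continuous_on_mult continuous_on_divide continuous_on_power continuous_on_const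
        continuous_on_max continuous_on_diff continuous_grad_sq c0 ballI vne continuous_cutoff R)
  moreover obtain l u where lu: "cball (0::'a) R \<subseteq> cbox l u"
    by (rule bounded_subset_cbox_obtain[OF bounded_cball])
  moreover have "E x = 0" if "x \<notin> cbox l u" for x
  proof -
    have "R < norm x" using that lu by (auto simp: subset_iff not_le[symmetric])
    then have "P x = 0" by (intro P_props(4)) simp
    then show ?thesis by (simp add: E_def P_def)
  qed
  ultimately have E: "integrable lborel E" by (rule_tac integrable_compact_support(1)[of E l u])
  have ball: "integrable lborel (\<lambda>x. C * indicator (ball (0::'a) R) x)"
    by (intro integrable_mult_right integrable_real_indicator) (auto intro: emeasure_bounded_finite[unfolded infinity_ennreal_def])
  have "(LINT x|lborel. E x - C * indicator (ball 0 R) x) \<le> (LINT x|lborel. T x + Y x)"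
    by (intro integral_mono Bochner_Integration.integrable_diff Bochner_Integration.integrable_add E ball T Y)
       (simp only: E_def T_def Y_def, rule pointwise_lower_bound)
  then have "(LINT x|lborel. E x) \<le> C * measure lborel (ball (0::'a) R)"
    using E ball T Y by simp
  then show "integrable lborel (\<lambda>x. \<phi> x * W x * (c / 4 * (grad_sq x)\<^sup>2 / (v x)\<^sup>2))"
    "(LINT x|lborel. \<phi> x * W x * (c / 4 * (grad_sq x)\<^sup>2 / (v x)\<^sup>2)) \<le> C * measure lborel (ball (0::'a) R)"
    using E by (simp_all add: E_def)
qed

end

section \<open>A lower bound for solutions\<close>

text \<open>If \<open>D < 0\<close>, then \<open>f'\<close>, which is 0 at the minimum, is negative
  just to its right, and \<open>f\<close> drops below \<open>f 0\<close>.\<close>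

lemma second_derivative_nonneg_at_min:
  fixes f f' :: "real \<Rightarrow> real"
  assumes d: "0 < d" and deriv: "\<And>t. \<bar>t\<bar> < d \<Longrightarrow> (f has_real_derivative f' t) (at t)"
    and deriv2: "(f' has_real_derivative D) (at 0)" and min: "\<And>t. \<bar>t\<bar> < d \<Longrightarrow> f 0 \<le> f t"
  shows "0 \<le> D"
proof (rule ccontr)
  assume "\<not> 0 \<le> D"
  have "f' 0 = 0"
    by (rule DERIV_local_min[OF deriv d]) (use min d in auto)
  from DERIV_neg_dec_right[OF deriv2] \<open>\<not> 0 \<le> D\<close>
  obtain e where e: "0 < e" "\<And>h. 0 < h \<Longrightarrow> h < e \<Longrightarrow> f' h < f' 0" by auto
  define h where "h = min (d / 2) (e / 2)"
  have h: "0 < h" "h < d" "h < e" using d e by (auto simp: h_def)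
  have "f h < f 0"
  proof (rule DERIV_neg_imp_decreasing_open[OF h(1)])
    show "\<exists>y. (f has_real_derivative y) (at x) \<and> y < 0" if "0 < x" "x < h" for x
      using deriv[of x] e(2)[of x] that h \<open>f' 0 = 0\<close> by auto
    show "continuous_on {0..h} f"
      by (rule DERIV_continuous_on[where D = f'])
         (use deriv h in \<open>auto intro: has_field_derivative_at_within\<close>)
  qed
  then show False using min[of h] h by auto
qed

definition grad_of :: "(('a::euclidean_space \<Rightarrow> nat) \<Rightarrow> 'a \<Rightarrow> real) \<Rightarrow> 'a \<Rightarrow> 'a" where
  "grad_of U x = (\<Sum>b\<in>Basis. U (incr (\<lambda>_. 0) b) x *\<^sub>R b)"

lemma grad_of_inner: "b \<in> Basis \<Longrightarrow> grad_of U x \<bullet> b = U (incr (\<lambda>_. 0) b) x"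
  by (simp add: grad_of_def inner_sum_left inner_Basis if_distrib sum.delta cong: if_cong)

context
  fixes p q :: real and u :: "'a::euclidean_space \<Rightarrow> real"
  assumes sol: "positive_weak_solution p q u"
begin

lemma solution_continuous: "continuous_on UNIV u" "b \<in> Basis \<Longrightarrow> continuous_on UNIV (\<lambda>x. gradient u x \<bullet> b)"
  and solution_pos: "0 < u x"
  using sol C1_has_partial[of u] nonempty_Basis unfolding positive_weak_solution_def by blast+

lemma gradient_continuous: "continuous_on UNIV (gradient u)"
  using solution_continuous(2) by (simp add: continuous_on_componentwise[of UNIV "gradient u"])

text \<open>Minimum principle on the annulus \<open>1 \<le> norm x \<le> \<rho>\<close>: the
  difference \<open>g\<close> of \<open>U\<close> and the barrier cannot have a negative minimum on
  either boundary sphere, nor inside, where its Laplacian would have to be nonnegative. Mollifying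
  makes second derivatives available.\<close>

lemma mollified_lower_bound:
  assumes U: "mollified p q u r U" and r: "0 < r" "r \<le> 1" and a: "0 < a" "\<And>y. norm y \<le> 2 \<Longrightarrow> a \<le> u y"
    and x: "1 \<le> norm x" "norm x \<le> \<rho>"
  shows "a * (((norm x)\<^sup>2) powr (- (DIM('a) / 2)) - (\<rho>\<^sup>2) powr (- (DIM('a) / 2))) \<le> U (\<lambda>_. 0) x"
proof (rule ccontr)
  assume neg: "\<not> ?thesis"
  define k where "k = - (real DIM('a) / 2)"
  have k: "k < 0" by (simp add: k_def)
  define g where "g = (\<lambda>x. U (\<lambda>_. 0) x - a * (((norm x)\<^sup>2) powr k - (\<rho>\<^sup>2) powr k))"
  have U_cont: "continuous_on UNIV (U \<alpha>)" for \<alpha> using U by (simp add: mollified_def)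
  have U_bound: "lo \<le> U (\<lambda>_. 0) x" if "\<And>y. y \<in> cball x r \<Longrightarrow> lo \<le> u y" for x lo
  proof -
    have "compact (cball x r)" "cball x r \<noteq> {}" "continuous_on (cball x r) u"
      using r continuous_on_subset[OF solution_continuous(1)] by auto
    from continuous_attains_sup[OF this] obtain hi where "\<forall>y\<in>cball x r. u y \<le> hi" by blast
    then show ?thesis using U that by (auto simp: mollified_def)
  qed
  define S where "S = {x::'a. 1 \<le> norm x \<and> norm x \<le> \<rho>}"
  have S: "compact S"
  proof -
    have "S = cball 0 \<rho> - ball 0 1" by (auto simp: S_def)
    then show ?thesis by (simp add: compact_diff)
  qed
  have "continuous_on S g"
    unfolding g_def
    by (intro continuous_intros continuous_on_subset[OF U_cont]) (auto simp: S_def)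
  moreover have "S \<noteq> {}" using x by (auto simp: S_def)
  ultimately obtain x0 where x0: "x0 \<in> S" "\<And>y. y \<in> S \<Longrightarrow> g x0 \<le> g y"
    using continuous_attains_inf[OF S] by blast
  have "g x < 0" using neg by (simp add: g_def k_def)
  then have g0: "g x0 < 0" using x0(2)[of x] x by (simp add: S_def)
  \<comment> \<open>On the inner sphere the averages see only \<open>norm y \<le> 2\<close>, where
    \<open>u \<ge> a\<close>; on the outer sphere the barrier is 0.\<close>
  have "norm x0 \<noteq> 1"
  proof
    assume 1: "norm x0 = 1"
    have "a \<le> U (\<lambda>_. 0) x0"
    proof (rule U_bound)
      fix y assume "y \<in> cball x0 r"
      then have "norm y \<le> 2" using norm_triangle_sub[of y x0] 1 r by (simp add: dist_norm norm_minus_commute)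
      then show "a \<le> u y" by (rule a)
    qed
    moreover have "a * (1 - (\<rho>\<^sup>2) powr k) \<le> a * 1" using a by (intro mult_left_mono) auto
    ultimately show False using g0 1 by (simp add: g_def)
  qed
  moreover have "norm x0 \<noteq> \<rho>"
  proof
    assume "norm x0 = \<rho>"
    moreover have "0 \<le> U (\<lambda>_. 0) x0" by (rule U_bound) (use solution_pos less_imp_le in blast)
    ultimately show False using g0 by (simp add: g_def)
  qed
  ultimately have int: "1 < norm x0" "norm x0 < \<rho>" using x0(1) by (auto simp: S_def)
  define s where "s = (norm x0)\<^sup>2"
  have s: "0 < s" unfolding s_def using int by (intro zero_less_power) linarith
  have second: "0 \<le> U (incr (incr (\<lambda>_. 0) b) b) x0
      - a * (k * ((k - 1) * s powr (k - 2) * (2 * (x0 \<bullet> b)) * (2 * (x0 \<bullet> b)) + s powr (k - 1) * 2))"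
    if b: "b \<in> Basis" for b
  proof -
    define \<beta> where "\<beta> = x0 \<bullet> b"
    define w where "w = (\<lambda>t. s + 2 * t * \<beta> + t\<^sup>2)"
    have w: "(norm (x0 + t *\<^sub>R b))\<^sup>2 = w t" for t
      using b unfolding w_def s_def \<beta>_def power2_norm_eq_inner
      by (simp add: inner_simps power2_eq_square inner_commute algebra_simps inner_Basis)
    define d where "d = min (norm x0 - 1) (\<rho> - norm x0)"
    have d: "0 < d" using int by (simp add: d_def)
    have in_S: "x0 + t *\<^sub>R b \<in> S" if "\<bar>t\<bar> < d" for t
      using that norm_triangle_ineq[of x0 "t *\<^sub>R b"] norm_diff_ineq[of x0 "t *\<^sub>R b"] b
      by (auto simp: S_def d_def)
    have w_pos: "0 < w t" if "\<bar>t\<bar> < d" for t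
    proof -
      have "0 < norm (x0 + t *\<^sub>R b)" using in_S[OF that] by (auto simp: S_def)
      then show ?thesis unfolding w[symmetric] by simp
    qed
    have wd: "(w has_real_derivative 2 * \<beta> + 2 * t) (at t)" for t
      unfolding w_def by (auto intro!: derivative_eq_intros)
    have powr: "((\<lambda>t. w t powr l) has_real_derivative l * w t powr (l - 1) * (2 * \<beta> + 2 * t)) (at t)"
      if "\<bar>t\<bar> < d" for t l
      by (rule DERIV_chain2[OF has_real_derivative_powr[OF w_pos[OF that]] wd])
    have Ud: "has_partial (U \<alpha>) b (U (incr \<alpha> b))" for \<alpha>
      using U b by (simp add: mollified_def)
    show ?thesis
    proof (rule second_derivative_nonneg_at_min[OF d])
      show "((\<lambda>t. g (x0 + t *\<^sub>R b)) has_real_derivative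
          U (incr (\<lambda>_. 0) b) (x0 + t *\<^sub>R b) - a * (k * w t powr (k - 1) * (2 * \<beta> + 2 * t))) (at t)"
        if "\<bar>t\<bar> < d" for t
        unfolding g_def w
        using DERIV_diff[OF has_partial_at[OF Ud, of "\<lambda>_. 0" x0 t]
            DERIV_cmult[OF DERIV_diff[OF powr[OF that, of k] DERIV_const]]] by simp
      show "((\<lambda>t. U (incr (\<lambda>_. 0) b) (x0 + t *\<^sub>R b) - a * (k * w t powr (k - 1) * (2 * \<beta> + 2 * t)))
         has_real_derivative U (incr (incr (\<lambda>_. 0) b) b) x0
      - a * (k * ((k - 1) * s powr (k - 2) * (2 * (x0 \<bullet> b)) * (2 * (x0 \<bullet> b)) + s powr (k - 1) * 2))) (at 0)"
      proof -
        have "((\<lambda>t. w t powr (k - 1)) has_real_derivative (k - 1) * s powr (k - 2) * (2 * \<beta>)) (at 0)"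
          using powr[of 0 "k - 1"] d by (simp add: w_def)
        moreover have "((\<lambda>t. 2 * \<beta> + 2 * t) has_real_derivative 2) (at 0)"
          by (auto intro!: derivative_eq_intros)
        ultimately have "((\<lambda>t. a * (k * w t powr (k - 1) * (2 * \<beta> + 2 * t))) has_real_derivative
           a * (k * ((k - 1) * s powr (k - 2) * (2 * \<beta>)) * (2 * \<beta> + 2 * 0) + 2 * (k * w 0 powr (k - 1)))) (at 0)"
          by (intro DERIV_cmult DERIV_mult)
        from DERIV_diff[OF has_partialD[OF Ud, of "incr (\<lambda>_. 0) b" x0] this]
        show ?thesis by (simp add: w_def \<beta>_def algebra_simps)
      qed
      show "g (x0 + 0 *\<^sub>R b) \<le> g (x0 + t *\<^sub>R b)" if "\<bar>t\<bar> < d" for t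
        using x0(2)[OF in_S[OF that]] by simp
    qed
  qed
  define lapU where "lapU = (\<Sum>b\<in>Basis. U (incr (incr (\<lambda>_. 0) b) b) x0)"
  have N: "real DIM('a) = - 2 * k" by (simp add: k_def)
  have sq: "(\<Sum>b\<in>Basis. (x0 \<bullet> b) * (x0 \<bullet> b)) = s"
    by (simp add: s_def power2_norm_eq_inner euclidean_inner[of x0 x0])
  have "0 \<le> (\<Sum>b\<in>Basis. U (incr (incr (\<lambda>_. 0) b) b) x0
      - a * (k * ((k - 1) * s powr (k - 2) * (2 * (x0 \<bullet> b)) * (2 * (x0 \<bullet> b)) + s powr (k - 1) * 2)))"
    by (intro sum_nonneg second)
  also have "\<dots> = lapU
      - (\<Sum>b\<in>Basis. 4 * a * k * (k - 1) * s powr (k - 2) * ((x0 \<bullet> b) * (x0 \<bullet> b)) + a * k * s powr (k - 1) * 2)"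
    unfolding sum_subtractf lapU_def by (intro arg_cong2[where f = "(-)"] sum.cong refl) (simp add: algebra_simps)
  also have "(\<Sum>b\<in>Basis. 4 * a * k * (k - 1) * s powr (k - 2) * ((x0 \<bullet> b) * (x0 \<bullet> b)) + a * k * s powr (k - 1) * 2)
      = 4 * a * k * (k - 1) * (s powr (k - 2) * s) + DIM('a) * (a * k * s powr (k - 1) * 2)"
    by (simp add: sum.distrib sq flip: sum_distrib_left)
  also have "s powr (k - 2) * s = s powr (k - 1)"
    using powr_add[of s "k - 2" 1] s by simp
  \<comment> \<open>The Laplacian of \<open>((norm x)\<^sup>2) powr k\<close> has the factor
    \<open>4 * k * (k - 1) + 2 * N * k\<close>, and \<open>N = - 2 * k\<close> reduces it to
    \<open>- 4 * k > 0\<close>.\<close>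
  finally have "0 \<le> lapU + 4 * a * k * s powr (k - 1)"
    unfolding N by (simp add: algebra_simps)
  moreover have "lapU \<le> 0" using U by (simp add: mollified_def lapU_def)
  moreover have "a * k * s powr (k - 1) < 0" using a k s by (simp add: mult_pos_neg mult_neg_pos)
  ultimately show False by linarith
qed

text \<open>Comparison with \<open>|x| powr (- N)\<close>, which is strictly subharmonic away from the origin.\<close>

lemma solution_lower_bound:
  obtains c where "0 < c" "\<And>R x. 1 \<le> R \<Longrightarrow> norm x \<le> R \<Longrightarrow> c * R powr (- real DIM('a)) \<le> u x"
proof -
  obtain a where a: "0 < a" "\<And>y. norm y \<le> 2 \<Longrightarrow> a \<le> u y"
  proof -
    have "compact (cball (0::'a) 2)" "cball (0::'a) 2 \<noteq> {}" "continuous_on (cball 0 2) u"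
      using continuous_on_subset[OF solution_continuous(1)] by auto
    from continuous_attains_inf[OF this] obtain z where "\<forall>y\<in>cball 0 2. u z \<le> u y" by blast
    then show ?thesis using that[of "u z"] solution_pos by auto
  qed
  define k where "k = - (real DIM('a) / 2)"
  have k: "k < 0" by (simp add: k_def)
  \<comment> \<open>Here \<open>x\<close> is fixed and the mollification radius tends to 0; its size
    may depend on \<open>x\<close>.\<close>
  have bound: "a * (((norm x)\<^sup>2) powr k - (\<rho>\<^sup>2) powr k) \<le> u x" if x: "1 \<le> norm x" "norm x \<le> \<rho>" for x \<rho>
  proof (rule field_le_epsilon)
    fix e :: real assume "0 < e"
    have "isCont u x" using solution_continuous(1) continuous_on_eq_continuous_at by blast
    then obtain d where d: "0 < d" "\<And>y. dist y x < d \<Longrightarrow> dist (u y) (u x) < e"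
      using \<open>0 < e\<close> unfolding continuous_at_eps_delta by blast
    define r where "r = min 1 (d / 2)"
    have r: "0 < r" "r \<le> 1" "r < d" using d by (auto simp: r_def)
    obtain U where U: "mollified p q u r U" using mollified_exists[OF sol r(1)] .
    have "u x - e \<le> u y \<and> u y \<le> u x + e" if "y \<in> cball x r" for y
      using d(2)[of y] that r by (auto simp: dist_commute dist_real_def abs_less_iff)
    then have "U (\<lambda>_. 0) x \<le> u x + e" using U unfolding mollified_def by blast
    then show "a * (((norm x)\<^sup>2) powr k - (\<rho>\<^sup>2) powr k) \<le> u x + e"
      using mollified_lower_bound[OF U r(1,2) a x] by (simp add: k_def)
  qed
  \<comment> \<open>Letting the outer radius tend to infinity removes the constant from the
    barrier.\<close>
  have far: "a * ((norm x)\<^sup>2) powr k \<le> u x" if x: "1 \<le> norm x" for x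
  proof -
    have "((\<lambda>\<rho>::real. (\<rho>\<^sup>2) powr k) \<longlongrightarrow> 0) at_top"
      by (intro tendsto_neg_powr k filterlim_pow_at_top filterlim_ident) simp
    then have "((\<lambda>\<rho>. a * (((norm x)\<^sup>2) powr k - (\<rho>\<^sup>2) powr k)) \<longlongrightarrow> a * (((norm x)\<^sup>2) powr k - 0)) at_top"
      by (intro tendsto_intros)
    then have "a * (((norm x)\<^sup>2) powr k - 0) \<le> u x"
    proof (rule tendsto_upperbound)
      show "\<forall>\<^sub>F \<rho> in at_top. a * (((norm x)\<^sup>2) powr k - (\<rho>\<^sup>2) powr k) \<le> u x"
        using eventually_ge_at_top[of "norm x"] by (rule eventually_mono) (rule bound[OF x])
    qed simp
    then show ?thesis by simp
  qed
  show ?thesis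
  proof (rule that[OF a(1)])
    fix R x assume R: "1 \<le> R" "norm (x::'a) \<le> R"
    have Rk: "R powr (- real DIM('a)) = (R\<^sup>2) powr k"
      using R by (simp add: powr_powr k_def flip: powr_numeral)
    show "a * R powr (- real DIM('a)) \<le> u x"
    proof (cases "1 \<le> norm x")
      case True
      have "(R\<^sup>2) powr k \<le> ((norm x)\<^sup>2) powr k"
        using k True R by (intro powr_mono2') (auto intro: power_mono)
      then have "a * (R\<^sup>2) powr k \<le> a * ((norm x)\<^sup>2) powr k" using a(1) by (intro mult_left_mono) auto
      then show ?thesis using far[OF True] Rk by simp
    next
      case False
      have "(R\<^sup>2) powr k \<le> 1 powr k" using k R by (intro powr_mono2') auto
      then have "a * (R\<^sup>2) powr k \<le> a * 1" using a by (intro mult_left_mono) auto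
      then show ?thesis using a(2)[of x] False Rk by simp
    qed
  qed
qed

text \<open>Uniform continuity on the ball of radius \<open>R + 1\<close>, the extra 1 making room
  for the averaging balls. \<open>U\<close> at \<open>x\<close> is compared with \<open>u\<close> at
  every \<open>y\<close> of the averaging ball, since all these values enter the averaged
  source.\<close>

lemma mollified_close:
  assumes "0 < \<epsilon>"
  obtains r U where "0 < r" "r \<le> 1" "mollified p q u r U"
    "\<And>x y. norm x \<le> R \<Longrightarrow> y \<in> cball x r \<Longrightarrow> \<bar>u y - U (\<lambda>_. 0) x\<bar> \<le> \<epsilon>"
    "\<And>x y. norm x \<le> R \<Longrightarrow> y \<in> cball x r \<Longrightarrow> norm (gradient u y - grad_of U x) \<le> \<epsilon>"
proof -
  \<comment> \<open>A component of the gradient changes by \<open>\<epsilon>'\<close> from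
    \<open>y\<close> to \<open>x\<close> and again from \<open>x\<close> to the average; the norm is
    then bounded by the sum over the basis.\<close>
  define \<epsilon>' where "\<epsilon>' = \<epsilon> / (2 * DIM('a))"
  have \<epsilon>': "0 < \<epsilon>'" "2 * \<epsilon>' \<le> \<epsilon>" "DIM('a) * (2 * \<epsilon>') = \<epsilon>"
    using assms DIM_positive[where 'a='a] by (auto simp: \<epsilon>'_def field_simps Suc_leI)
  have unif: "\<exists>d>0. \<forall>x\<in>cball 0 (R + 1). \<forall>y\<in>cball 0 (R + 1). dist y x < d \<longrightarrow> dist (f y) (f x) < \<epsilon>'"
    if "continuous_on UNIV f" for f :: "'a \<Rightarrow> 'b::metric_space"
    using compact_uniformly_continuous[OF continuous_on_subset[OF that subset_UNIV] compact_cball, of 0 "R + 1"] \<epsilon>'(1)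
    unfolding uniformly_continuous_on_def by blast
  obtain d1 where d1: "0 < d1" "\<And>x y. norm x \<le> R + 1 \<Longrightarrow> norm y \<le> R + 1 \<Longrightarrow> dist y x < d1 \<Longrightarrow> dist (u y) (u x) < \<epsilon>'"
    using unif[OF solution_continuous(1)] by auto
  obtain d2 where d2: "0 < d2" "\<And>x y. norm x \<le> R + 1 \<Longrightarrow> norm y \<le> R + 1 \<Longrightarrow> dist y x < d2 \<Longrightarrow> dist (gradient u y) (gradient u x) < \<epsilon>'"
    using unif[OF gradient_continuous] by auto
  define r where "r = min 1 (min (d1 / 2) (d2 / 2))"
  have r: "0 < r" "r \<le> 1" "r < d1" "r < d2" using d1 d2 by (auto simp: r_def)
  obtain U where U: "mollified p q u r U" using mollified_exists[OF sol r(1)] .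
  have near: "dist (u y) (u x) < \<epsilon>'" "dist (gradient u y) (gradient u x) < \<epsilon>'"
    if "norm x \<le> R" "y \<in> cball x r" for x y
  proof -
    have "norm y \<le> R + 1" "dist y x < d1" "dist y x < d2"
      using that r norm_triangle_sub[of y x] by (auto simp: dist_norm norm_minus_commute)
    then show "dist (u y) (u x) < \<epsilon>'" "dist (gradient u y) (gradient u x) < \<epsilon>'"
      using d1(2)[of x y] d2(2)[of x y] that by auto
  qed
  have comp: "\<bar>(gradient u y - grad_of U x) \<bullet> b\<bar> \<le> 2 * \<epsilon>'" if x: "norm x \<le> R" and y: "y \<in> cball x r" and b: "b \<in> Basis" for x y b
  proof -
    have n: "\<bar>gradient u z \<bullet> b - gradient u x \<bullet> b\<bar> \<le> \<epsilon>'" if "z \<in> cball x r" for z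
      using near(2)[OF x that] Basis_le_norm[OF b, of "gradient u z - gradient u x"]
      by (simp add: dist_norm inner_diff_left)
    have "gradient u x \<bullet> b - \<epsilon>' \<le> gradient u z \<bullet> b \<and> gradient u z \<bullet> b \<le> gradient u x \<bullet> b + \<epsilon>'" if "z \<in> cball x r" for z
      using n[OF that] by linarith
    then have "gradient u x \<bullet> b - \<epsilon>' \<le> U (incr (\<lambda>_. 0) b) x \<and> U (incr (\<lambda>_. 0) b) x \<le> gradient u x \<bullet> b + \<epsilon>'"
      using U b unfolding mollified_def by blast
    moreover have "grad_of U x \<bullet> b = U (incr (\<lambda>_. 0) b) x"
      using b by (rule grad_of_inner)
    ultimately show ?thesis using n[OF y] by (auto simp: inner_diff_left abs_le_iff)
  qed
  show ?thesis
  proof (rule that[OF r(1,2) U])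
    fix x y :: 'a assume x: "norm x \<le> R" and y: "y \<in> cball x r"
    have n: "\<bar>u z - u x\<bar> \<le> \<epsilon>'" if "z \<in> cball x r" for z
      using near(1)[OF x that] by (simp add: dist_real_def)
    have "u x - \<epsilon>' \<le> u z \<and> u z \<le> u x + \<epsilon>'" if "z \<in> cball x r" for z
      using n[OF that] by linarith
    then have "u x - \<epsilon>' \<le> U (\<lambda>_. 0) x \<and> U (\<lambda>_. 0) x \<le> u x + \<epsilon>'" using U unfolding mollified_def by blast
    then show "\<bar>u y - U (\<lambda>_. 0) x\<bar> \<le> \<epsilon>" using n[OF y] \<epsilon>'(2) by linarith
    have "norm (gradient u y - grad_of U x) \<le> (\<Sum>b\<in>Basis. \<bar>(gradient u y - grad_of U x) \<bullet> b\<bar>)"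
      by (rule norm_le_l1)
    also have "\<dots> \<le> (\<Sum>b\<in>(Basis::'a set). 2 * \<epsilon>')" by (intro sum_mono comp x y)
    also have "\<dots> = \<epsilon>" using \<epsilon>'(3) by simp
    finally show "norm (gradient u y - grad_of U x) \<le> \<epsilon>" .
  qed
qed

end

section \<open>The Liouville theorem\<close>

definition neg_pow :: "real \<Rightarrow> (('a \<Rightarrow> nat) \<Rightarrow> 'a \<Rightarrow> real) \<Rightarrow> 'a \<Rightarrow> real" where
  "neg_pow s U x = U (\<lambda>_. 0) x powr (- s)"

definition neg_pow1 where
  "neg_pow1 s U i x = - s * U (\<lambda>_. 0) x powr (- s - 1) * U (incr (\<lambda>_. 0) i) x"

definition neg_pow2 where
  "neg_pow2 s U i j x = - s * U (\<lambda>_. 0) x powr (- s - 1) * U (incr (incr (\<lambda>_. 0) i) j) x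
     + s * (s + 1) * U (\<lambda>_. 0) x powr (- s - 2) * (U (incr (\<lambda>_. 0) i) x * U (incr (\<lambda>_. 0) j) x)"

definition neg_pow3 where
  "neg_pow3 s U i j k x = - s * U (\<lambda>_. 0) x powr (- s - 1) * U (incr (incr (incr (\<lambda>_. 0) i) j) k) x
     + s * (s + 1) * U (\<lambda>_. 0) x powr (- s - 2)
       * (U (incr (incr (\<lambda>_. 0) i) j) x * U (incr (\<lambda>_. 0) k) x
         + U (incr (incr (\<lambda>_. 0) i) k) x * U (incr (\<lambda>_. 0) j) x
         + U (incr (\<lambda>_. 0) i) x * U (incr (incr (\<lambda>_. 0) j) k) x)
     - s * (s + 1) * (s + 2) * U (\<lambda>_. 0) x powr (- s - 3)
       * (U (incr (\<lambda>_. 0) i) x * U (incr (\<lambda>_. 0) j) x * U (incr (\<lambda>_. 0) k) x)"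

context
  fixes s :: real and U :: "('a::euclidean_space \<Rightarrow> nat) \<Rightarrow> 'a \<Rightarrow> real"
  assumes s: "0 < s" and pos: "\<And>x. 0 < U (\<lambda>_. 0) x"
    and cont: "\<And>\<alpha>. continuous_on UNIV (U \<alpha>)"
    and part: "\<And>\<alpha> b. b \<in> Basis \<Longrightarrow> has_partial (U \<alpha>) b (U (incr \<alpha> b))"
begin

abbreviation "U0 \<equiv> U (\<lambda>_. 0)"
abbreviation "U1 i \<equiv> U (incr (\<lambda>_. 0) i)"
abbreviation "U2 i j \<equiv> U (incr (incr (\<lambda>_. 0) i) j)"
abbreviation "U3 i j k \<equiv> U (incr (incr (incr (\<lambda>_. 0) i) j) k)"

lemma has_partial_powr_U: "b \<in> Basis \<Longrightarrow> has_partial (\<lambda>x. c * U0 x powr r) b (\<lambda>x. c * (r * U0 x powr (r - 1)) * U1 b x)"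
  by (rule has_partial_compose[OF part, where g = "\<lambda>t. c * t powr r" and g' = "\<lambda>t. c * (r * t powr (r - 1))"])
     (auto intro!: DERIV_cmult has_real_derivative_powr pos)

lemma smooth_field_neg_pow: "smooth_field (neg_pow s U) (neg_pow1 s U) (neg_pow2 s U) (neg_pow3 s U)"
proof -
  have ne: "U0 x \<noteq> 0" for x using pos[of x] by simp
  have c: "continuous_on UNIV (\<lambda>x. U0 x powr r)" for r
    by (intro continuous_intros cont ballI ne)
  have cs: "continuous_on UNIV (neg_pow s U)" "continuous_on UNIV (neg_pow1 s U i)" "continuous_on UNIV (neg_pow2 s U i j)"
    "continuous_on UNIV (neg_pow3 s U i j k)" for i j k
    unfolding neg_pow_def neg_pow1_def neg_pow2_def neg_pow3_def
    by (intro continuous_on_add continuous_on_diff continuous_on_mult continuous_on_const c cont)+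
  have p1: "has_partial (neg_pow s U) i (neg_pow1 s U i)" if i: "i \<in> Basis" for i
    using has_partial_powr_U[OF i, of 1 "- s"] by (rule has_partial_cong) (simp_all add: neg_pow_def neg_pow1_def)
  have p2: "has_partial (neg_pow1 s U i) j (neg_pow2 s U i j)" if j: "j \<in> Basis" for i j
    using has_partial_mult[OF has_partial_powr_U[OF j, of "- s" "- s - 1"] part[OF j, of "incr (\<lambda>_. 0) i"]]
    by (rule has_partial_cong) (simp_all add: neg_pow1_def neg_pow2_def algebra_simps)
  have p3: "has_partial (neg_pow2 s U i j) k (neg_pow3 s U i j k)" if k: "k \<in> Basis" for i j k
    using has_partial_add[OF has_partial_mult[OF has_partial_powr_U[OF k, of "- s" "- s - 1"] part[OF k, of "incr (incr (\<lambda>_. 0) i) j"]]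
      has_partial_mult[OF has_partial_powr_U[OF k, of "s * (s + 1)" "- s - 2"]
        has_partial_mult[OF part[OF k, of "incr (\<lambda>_. 0) i"] part[OF k, of "incr (\<lambda>_. 0) j"]]]]
    by (rule has_partial_cong) (simp_all add: neg_pow2_def neg_pow3_def algebra_simps)
  have comm: "incr (incr \<alpha> i) j = incr (incr \<alpha> j) i" for \<alpha> :: "'a \<Rightarrow> nat" and i j
    by (cases "i = j") (auto simp: fun_upd_twist)
  have U3: "U3 i j j = U3 j j i" for i j
    by (metis comm)
  have U2: "U2 i j = U2 j i" for i j
    by (metis comm)
  have "neg_pow3 s U i j j x = neg_pow3 s U j j i x" for i j x
    unfolding neg_pow3_def U3[of i j] U2[of i j] by (simp add: algebra_simps)
  then show ?thesis by (intro smooth_field.intro p1 p2 p3 cs)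
qed

interpretation neg_pow: smooth_field "neg_pow s U" "neg_pow1 s U" "neg_pow2 s U" "neg_pow3 s U" by (rule smooth_field_neg_pow)

lemma norm_grad_of: "(norm (grad_of U x))\<^sup>2 = (\<Sum>i\<in>Basis. (U1 i x)\<^sup>2)"
proof -
  show ?thesis
    unfolding power2_norm_eq_inner by (subst euclidean_inner) (simp add: grad_of_inner power2_eq_square)
qed

lemma neg_pow_grad_sq: "neg_pow.grad_sq x = (s * U0 x powr (- s - 1) * norm (grad_of U x))\<^sup>2"
  unfolding neg_pow.grad_sq_def neg_pow1_def power_mult_distrib norm_grad_of by (simp add: sum_distrib_left)

lemma neg_pow_lap:
  "neg_pow.lap x = - s * U0 x powr (- s - 1) * (\<Sum>i\<in>Basis. U2 i i x)
     + s * (s + 1) * U0 x powr (- s - 2) * (norm (grad_of U x))\<^sup>2"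
  unfolding neg_pow.lap_def neg_pow2_def norm_grad_of
  by (simp add: sum_subtractf sum_distrib_left power2_eq_square sum_negf)

text \<open>Origin of \<open>\<mu>\<close>, \<open>A\<close> and \<open>K\<close>: writing
  \<open>|\<nabla>u|\<close> as \<open>|\<nabla>v| * u powr (s + 1) / s\<close> turns
  \<open>s * u powr (- s - 1) * u powr p * |\<nabla>u| powr q\<close> into the first term, and the
  quadratic gradient term of \<open>\<Delta>v\<close> into the second. What remains is the defect of
  the equation for \<open>U\<close> times an explicit factor.\<close>

lemma neg_pow_residual:
  assumes g: "0 < norm (grad_of U x)"
  shows "neg_pow.lap x - (s powr (1 - q) * neg_pow s U x powr ((1 + s - p - (1 + s) * q) / s) * neg_pow.grad_sq x powr (q / 2)
      + (1 + 1 / s) * neg_pow.grad_sq x / neg_pow s U x)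
    = s * U0 x powr (- s - 1) * (- (\<Sum>i\<in>Basis. U2 i i x) - U0 x powr p * norm (grad_of U x) powr q)"
proof -
  define t g where "t = U0 x" "g = norm (grad_of U x)"
  have t: "0 < t" "0 < g" using pos g by (auto simp: t_g_def)
  have 1: "((s * t powr (- s - 1) * g)\<^sup>2) powr (q / 2) = s powr q * t powr ((- s - 1) * q) * g powr q"
  proof -
    have "(x\<^sup>2) powr (q / 2) = x powr q" if "0 < x" for x :: real
      using that by (simp add: powr_powr flip: powr_numeral)
    then have "((s * t powr (- s - 1) * g)\<^sup>2) powr (q / 2) = (s * t powr (- s - 1) * g) powr q"
      using t s by simp
    then show ?thesis using t s by (simp add: powr_mult powr_powr)
  qed
  have 2: "(t powr (- s)) powr ((1 + s - p - (1 + s) * q) / s) = t powr (- (1 + s - p - (1 + s) * q))"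
    using s by (simp add: powr_powr)
  have "s powr (1 - q) * t powr (- (1 + s - p - (1 + s) * q)) * (s powr q * t powr ((- s - 1) * q) * g powr q)
     = (s powr (1 - q) * s powr q) * (t powr (- (1 + s - p - (1 + s) * q)) * t powr ((- s - 1) * q)) * g powr q"
    by simp
  also have "s powr (1 - q) * s powr q = s" using s by (simp flip: powr_add)
  also have "t powr (- (1 + s - p - (1 + s) * q)) * t powr ((- s - 1) * q) = t powr (- s - 1) * t powr p"
    by (simp add: algebra_simps flip: powr_add)
  finally have H: "s powr (1 - q) * t powr (- (1 + s - p - (1 + s) * q)) * (s powr q * t powr ((- s - 1) * q) * g powr q)
     = s * (t powr (- s - 1) * t powr p) * g powr q" .
  have "(t powr (- s - 1))\<^sup>2 / t powr (- s) = t powr (- s - 2)"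
    using t by (simp add: power2_eq_square flip: powr_add powr_diff)
  moreover have "(1 + 1 / s) * s\<^sup>2 = s * (s + 1)" using s by (simp add: field_simps power2_eq_square)
  moreover have "(1 + 1 / s) * (s * t powr (- s - 1) * g)\<^sup>2 / t powr (- s)
     = (1 + 1 / s) * s\<^sup>2 * ((t powr (- s - 1))\<^sup>2 / t powr (- s)) * g\<^sup>2"
    by (simp add: power_mult_distrib)
  ultimately have K: "(1 + 1 / s) * (s * t powr (- s - 1) * g)\<^sup>2 / t powr (- s) = s * (s + 1) * t powr (- s - 2) * g\<^sup>2"
    by simp
  show ?thesis
    unfolding neg_pow_lap neg_pow_grad_sq unfolding neg_pow_def t_g_def[symmetric] 1 2 H K
    by (simp add: algebra_simps)
qed

end

section \<open>Localisation, admissible exponents and the radius\<close>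

context bernstein begin

lemma local_estimate:
  assumes "\<And>x. x \<in> ball x0 r \<Longrightarrow> \<kappa> \<le> \<phi> x * W x * (c / 4 * (grad_sq x)\<^sup>2 / (v x)\<^sup>2)"
  shows "\<kappa> * measure lborel (ball x0 r) \<le> C * measure lborel (ball (0::'a) R)"
proof -
  have nonneg: "0 \<le> \<phi> x * W x * (c / 4 * (grad_sq x)\<^sup>2 / (v x)\<^sup>2)" for x
    using cutoff_bounds(1)[of R x] c(2) grad_sq_nonneg[of x] v_pos[of x]
    by (intro mult_nonneg_nonneg divide_nonneg_nonneg zero_le_power) auto
  have "(LINT x|lborel. \<kappa> * indicator (ball x0 r) x) \<le> (LINT x|lborel. \<phi> x * W x * (c / 4 * (grad_sq x)\<^sup>2 / (v x)\<^sup>2))"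
  proof (rule integral_mono)
    show "integrable lborel (\<lambda>x. \<kappa> * indicator (ball x0 r) x)"
      by (intro integrable_mult_right integrable_real_indicator)
         (auto intro: emeasure_bounded_finite[unfolded infinity_ennreal_def])
    show "\<kappa> * indicator (ball x0 r) x \<le> \<phi> x * W x * (c / 4 * (grad_sq x)\<^sup>2 / (v x)\<^sup>2)" for x
      using assms[of x] nonneg[of x] by (cases "x \<in> ball x0 r") auto
  qed (rule integral_estimate)
  then show ?thesis using integral_estimate(2) by simp
qed

end

text \<open>The bound on \<open>\<sigma>\<close> enters through
  \<open>(N + 8) / N \<le> (1 + 4 / N)\<^sup>2\<close>, which gives \<open>\<sigma> < 1 / N\<close>
  and hence \<open>N < K\<close>; then \<open>c = K * (K - N) / N\<close> is positive.\<close>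

lemma liouville_constants:
  fixes p q \<sigma> N :: real
  assumes N: "1 \<le> N" and hyp: "p + (1 + \<sigma>) * q < (N + 2) / N + \<sigma>"
    and \<sigma>: "0 < \<sigma>" "\<sigma> < 1 / 4 * (sqrt ((N + 8) / N) - 1)"
  defines "K \<equiv> 1 + 1 / \<sigma>" and "A \<equiv> (1 + \<sigma> - p - (1 + \<sigma>) * q) / \<sigma>"
  shows "\<sigma> * N < 1" "0 < K\<^sup>2 / N - K" "0 \<le> A + 2 * K / N"
proof -
  have "(N + 8) / N \<le> (1 + 4 / N)\<^sup>2"
    using N by (simp add: field_simps power2_eq_square)
  then have "sqrt ((N + 8) / N) \<le> 1 + 4 / N"
    using N by (intro real_le_lsqrt) auto
  then have "\<sigma> < 1 / N" using \<sigma>(2) by simp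
  then show 1: "\<sigma> * N < 1" using N by (simp add: field_simps)
  have "N < K" using 1 \<sigma> by (simp add: K_def field_simps)
  moreover have "K\<^sup>2 / N - K = K * (K - N) / N" using N by (simp add: field_simps power2_eq_square)
  ultimately show "0 < K\<^sup>2 / N - K" using N by simp
  have "A + 2 * K / N = ((N + 2) / N + \<sigma> - (p + (1 + \<sigma>) * q)) / \<sigma> + 2 / N"
    using N \<sigma> by (simp add: A_def K_def field_simps)
  then show "0 \<le> A + 2 * K / N" using hyp \<sigma> N by simp
qed

text \<open>Because \<open>\<sigma> N < 1\<close>, the growth \<open>v \<le> C R powr (\<sigma> N)\<close> is beaten by the cutoff for large \<open>m\<close>.\<close>

lemma large_radius:
  fixes a c \<sigma> \<omega> \<kappa> R0 :: real and N m n :: nat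
  assumes "0 < a" "0 < c" "0 < \<sigma>" "\<sigma> * N < 1" "0 < \<kappa>" "0 \<le> \<omega>" "N / (2 * (1 - \<sigma> * N)) \<le> m" "1 \<le> m"
  obtains R :: real where "1 \<le> R" "R0 \<le> R"
    "(4 * ((a * (R + 1) powr (- real N)) powr (- \<sigma>))\<^sup>2 / c) ^ (m + 1) * (2 * n\<^sup>2 / (m * R\<^sup>2)) ^ (m + 2) * (\<omega> * R ^ N) < \<kappa>"
proof -
  \<comment> \<open>The power of 2 comes from \<open>R + 1 \<le> 2 * R\<close>.\<close>
  define b where "b = 4 * (a powr (- \<sigma>) * 2 powr (N * \<sigma>))\<^sup>2 / c"
  \<comment> \<open>The total exponent of \<open>R\<close>: growth of \<open>v\<close> to the power
    \<open>2 * (m + 1)\<close>, decay of the cutoff gradient to the power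
    \<open>2 * (m + 2)\<close>, and the volume of the ball.\<close>
  define e where "e = 2 * N * \<sigma> * (m + 1) - 2 * (m + 2) + N"
  have e: "e < 0"
  proof -
    have "N \<le> m * (2 * (1 - \<sigma> * N))" using assms by (simp add: pos_divide_le_eq)
    also have "\<dots> \<le> (m + 1) * (2 * (1 - \<sigma> * N))" using assms by (intro mult_right_mono) auto
    finally show ?thesis by (simp add: e_def algebra_simps)
  qed
  define B where "B = b ^ (m + 1) * (2 * n\<^sup>2 / m) ^ (m + 2) * \<omega>"
  have "((\<lambda>R. B * R powr e) \<longlongrightarrow> B * 0) at_top"
    by (intro tendsto_intros tendsto_neg_powr e filterlim_ident)
  then have "eventually (\<lambda>R. B * R powr e < \<kappa>) at_top"
    using assms(5) by (intro order_tendstoD(2)) auto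
  then have "eventually (\<lambda>R. B * R powr e < \<kappa> \<and> 1 \<le> R \<and> R0 \<le> R) at_top"
    by (intro eventually_conj eventually_ge_at_top)
  then obtain R where R: "B * R powr e < \<kappa>" "1 \<le> R" "R0 \<le> R"
    by (auto dest: eventually_happens)
  have V: "(a * (R + 1) powr (- real N)) powr (- \<sigma>) \<le> a powr (- \<sigma>) * 2 powr (N * \<sigma>) * R powr (N * \<sigma>)"
  proof -
    have "(a * (R + 1) powr (- real N)) powr (- \<sigma>) = a powr (- \<sigma>) * (R + 1) powr (N * \<sigma>)"
      using assms R by (simp add: powr_mult powr_powr)
    also have "\<dots> \<le> a powr (- \<sigma>) * (2 * R) powr (N * \<sigma>)"
      using R assms by (intro mult_left_mono powr_mono2) auto
    also have "\<dots> = a powr (- \<sigma>) * 2 powr (N * \<sigma>) * R powr (N * \<sigma>)"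
      using R by (simp add: powr_mult)
    finally show ?thesis .
  qed
  have "4 * ((a * (R + 1) powr (- real N)) powr (- \<sigma>))\<^sup>2 / c
      \<le> 4 * (a powr (- \<sigma>) * 2 powr (N * \<sigma>) * R powr (N * \<sigma>))\<^sup>2 / c"
    using V assms by (intro divide_right_mono mult_left_mono power_mono) auto
  also have "\<dots> = b * R powr (2 * N * \<sigma>)"
    using R by (simp add: b_def power_mult_distrib power2_eq_square[of "R powr _"] mult_ac flip: powr_add)
  finally have "(4 * ((a * (R + 1) powr (- real N)) powr (- \<sigma>))\<^sup>2 / c) ^ (m + 1) \<le> (b * R powr (2 * N * \<sigma>)) ^ (m + 1)"
    using assms by (intro power_mono) auto
  also have "\<dots> = b ^ (m + 1) * R powr (2 * N * \<sigma> * (m + 1))"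
  proof -
    have "(R powr (2 * N * \<sigma>)) ^ (m + 1) = R powr (2 * N * \<sigma> * (m + 1))"
      using R powr_realpow[of "R powr (2 * N * \<sigma>)" "m + 1"] by (simp add: powr_powr)
    then show ?thesis by (simp only: power_mult_distrib)
  qed
  finally have 1: "(4 * ((a * (R + 1) powr (- real N)) powr (- \<sigma>))\<^sup>2 / c) ^ (m + 1) \<le> b ^ (m + 1) * R powr (2 * N * \<sigma> * (m + 1))" .
  have 2: "(2 * n\<^sup>2 / (m * R\<^sup>2)) ^ (m + 2) = (2 * n\<^sup>2 / m) ^ (m + 2) * R powr (- 2 * (m + 2))"
  proof -
    have "1 / R\<^sup>2 = R powr (- 2)" using R by (simp add: powr_minus_divide)
    then have "(1 / R\<^sup>2) ^ (m + 2) = R powr (- 2 * (m + 2))"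
      using R powr_realpow[of "R powr (- 2)" "m + 2"] by (simp add: powr_powr)
    moreover have "2 * n\<^sup>2 / (m * R\<^sup>2) = (2 * n\<^sup>2 / m) * (1 / R\<^sup>2)" by simp
    ultimately show ?thesis by (simp only: power_mult_distrib)
  qed
  have 3: "R ^ N = R powr N" using R by (simp add: powr_realpow)
  have "(4 * ((a * (R + 1) powr (- real N)) powr (- \<sigma>))\<^sup>2 / c) ^ (m + 1) * (2 * n\<^sup>2 / (m * R\<^sup>2)) ^ (m + 2) * (\<omega> * R ^ N)
     \<le> (b ^ (m + 1) * R powr (2 * N * \<sigma> * (m + 1))) * (2 * n\<^sup>2 / (m * R\<^sup>2)) ^ (m + 2) * (\<omega> * R ^ N)"
    using 1 R assms by (intro mult_right_mono) auto
  also have "\<dots> = B * (R powr (2 * N * \<sigma> * (m + 1)) * R powr (- 2 * (m + 2)) * R powr N)"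
    unfolding 2 3 by (simp add: B_def)
  also have "R powr (2 * N * \<sigma> * (m + 1)) * R powr (- 2 * (m + 2)) * R powr N = R powr e"
    by (simp add: e_def algebra_simps flip: powr_add)
  finally show ?thesis using that[of R] R by linarith
qed

text \<open>A nonzero gradient at \<open>x0\<close> bounds the integral below by
  \<open>\<kappa>0\<close>, whereas the upper bound consists of a cutoff part less than
  \<open>\<kappa>0 / 2\<close> and an error part of at most \<open>\<kappa>0 / 2\<close>.\<close>

lemma liouville_gradient_zero:
  fixes u :: "'a::euclidean_space \<Rightarrow> real"
  assumes sol: "positive_weak_solution p q u"
    and hyp: "p + (1 + \<sigma>) * q < (real DIM('a) + 2) / real DIM('a) + \<sigma>"
    and \<sigma>: "0 < \<sigma>" "\<sigma> < 1 / 4 * (sqrt ((real DIM('a) + 8) / real DIM('a)) - 1)"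
  shows "gradient u x0 = 0"
proof (rule ccontr)
  assume grad: "gradient u x0 \<noteq> 0"
  let ?N = "real DIM('a)"
  define K c A \<mu> where "K = 1 + 1 / \<sigma>" "c = K\<^sup>2 / ?N - K" "A = (1 + \<sigma> - p - (1 + \<sigma>) * q) / \<sigma>" "\<mu> = \<sigma> powr (1 - q)"
  note KcA = K_c_A_\<mu>_def
  have N1: "1 \<le> ?N" by (simp add: Suc_leI)
  have cnst: "\<sigma> * ?N < 1" "0 < c" "0 \<le> A + 2 * K / ?N"
    using liouville_constants[OF N1 hyp \<sigma>] by (simp_all add: KcA)
  have K: "0 < K" using \<sigma> by (simp add: KcA add_pos_pos)
  \<comment> \<open>The thresholds serve \<open>qterm\<close>, \<open>Kterm\<close> and the growth
    comparison in \<open>large_radius\<close>.\<close>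
  obtain m0 :: nat where m0: "max (q\<^sup>2 * ?N) (max (4 * K\<^sup>2 / c) (?N / (2 * (1 - \<sigma> * ?N)))) \<le> m0"
    using real_arch_simple by blast
  define m where "m = m0 + 2"
  have m: "2 \<le> m" "q\<^sup>2 * ?N \<le> 2 * m" "4 * K\<^sup>2 \<le> m * c" "?N / (2 * (1 - \<sigma> * ?N)) \<le> m"
    using m0 cnst(2) by (auto simp: m_def pos_divide_le_eq algebra_simps)
  define n where "n = 2 * m + 4"

  \<comment> \<open>The factors leave room for errors \<open>\<epsilon> \<le> g\<close> and
    \<open>\<epsilon> \<le> a / 2\<close>: near \<open>x0\<close> the mollification still lies
    between \<open>a / 2\<close> and \<open>2 * b\<close>, with gradient at least
    \<open>g\<close>.\<close>
  define g a b where "g = norm (gradient u x0) / 4" "a = u x0 / 2" "b = 2 * u x0"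
  have ux0: "0 < u x0" using solution_pos[OF sol] .
  have gab: "0 < g" "0 < a" "0 < b" "a \<le> b" using grad ux0 by (auto simp: g_a_b_def)
  have "open ({y. 2 * g < norm (gradient u y)} \<inter> {y. a < u y} \<inter> {y. u y < b})"
    by (intro open_Int open_Collect_less continuous_intros gradient_continuous[OF sol] solution_continuous[OF sol])
  moreover have "x0 \<in> {y. 2 * g < norm (gradient u y)} \<inter> {y. a < u y} \<inter> {y. u y < b}"
    using grad ux0 by (simp add: g_a_b_def)
  ultimately obtain r1 where r1: "0 < r1"
    "ball x0 r1 \<subseteq> {y. 2 * g < norm (gradient u y)} \<inter> {y. a < u y} \<inter> {y. u y < b}"
    by (meson open_contains_ball)
  \<comment> \<open>Half the resulting lower bound for \<open>Z\<close> near \<open>x0\<close>, so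
    that \<open>Z - \<delta>\<close> is at least \<open>\<delta>\<close> there.\<close>
  define \<delta> where "\<delta> = (\<sigma> * (2 * b) powr (- \<sigma> - 1) * g)\<^sup>2 / 2"
  have \<delta>: "0 < \<delta>" using gab \<sigma> by (simp add: \<delta>_def)
  \<comment> \<open>Lower bound for the integrand near \<open>x0\<close>; \<open>3 / 4\<close>
    bounds the cutoff on the ball of radius \<open>R / 2\<close>. Nothing here depends on
    \<open>R\<close>.\<close>
  define \<kappa> where "\<kappa> = (3 / 4) ^ n * \<delta> ^ m * (c / 4 * (2 * \<delta>)\<^sup>2 / ((a / 2) powr (- \<sigma>))\<^sup>2)"
  have \<kappa>: "0 < \<kappa>" using \<delta> cnst gab by (simp add: \<kappa>_def)
  define \<kappa>0 where "\<kappa>0 = \<kappa> * measure lborel (ball x0 r1)"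
  have \<kappa>0: "0 < \<kappa>0" using \<kappa> r1 by (simp add: \<kappa>0_def content_ball)
  define \<omega> where "\<omega> = unit_ball_vol ?N"
  have \<omega>: "0 \<le> \<omega>" by (simp add: \<omega>_def)

  obtain c' where c': "0 < c'" "\<And>R x. 1 \<le> R \<Longrightarrow> norm x \<le> R \<Longrightarrow> c' * R powr (- ?N) \<le> u x"
    using solution_lower_bound[OF sol] by metis
  obtain R :: real where R: "1 \<le> R" "2 * (norm x0 + r1) \<le> R"
    "(4 * ((c' / 2 * (R + 1) powr (- ?N)) powr (- \<sigma>))\<^sup>2 / c) ^ (m + 1) * (2 * n\<^sup>2 / (m * R\<^sup>2)) ^ (m + 2)
       * (\<omega> * R ^ DIM('a)) < \<kappa>0 / 2"
    using large_radius[of "c' / 2" c \<sigma> "DIM('a)" "\<kappa>0 / 2" \<omega> m "2 * (norm x0 + r1)" n]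
      c' cnst \<sigma> \<kappa>0 \<omega> m by auto
  define \<alpha> where "\<alpha> = c' / 2 * (R + 1) powr (- ?N)"
  have \<alpha>: "0 < \<alpha>" using c' R by (simp add: \<alpha>_def)
  have u_lower: "2 * \<alpha> \<le> u y" if "norm y \<le> R + 1" for y
    using c'(2)[of "R + 1" y] R that by (simp add: \<alpha>_def)
  have "compact (cball (0::'a) (R + 1))" "cball (0::'a) (R + 1) \<noteq> {}" using R by auto
  note attains = continuous_attains_sup[OF this]
  obtain \<beta> where "\<forall>y\<in>cball 0 (R + 1). u y \<le> \<beta>"
    using attains[OF continuous_on_subset[OF solution_continuous(1)[OF sol] subset_UNIV]] by blast
  then have \<beta>: "u y \<le> \<beta>" if "norm y \<le> R + 1" for y using that by simp
  obtain T where "\<forall>y\<in>cball 0 (R + 1). norm (gradient u y) \<le> T"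
    using attains[OF continuous_on_norm[OF continuous_on_subset[OF gradient_continuous[OF sol] subset_UNIV]]] by blast
  then have T: "norm (gradient u y) \<le> T" if "norm y \<le> R + 1" for y using that by simp
  have T0: "0 \<le> T" using T[of 0] R by (simp add: order_trans[OF norm_ge_zero])
  define V M where "V = \<alpha> powr (- \<sigma>)" "M = (\<sigma> * \<alpha> powr (- \<sigma> - 1) * (T + 1))\<^sup>2"
  have M: "0 \<le> M" by (simp add: V_M_def)
  \<comment> \<open>Compactness bounds \<open>G0\<close> over a range of values shared by all
    sufficiently close mollifications. This has to precede the choice of \<open>U\<close>, because
    the admissible error \<open>\<eta>\<close> depends on \<open>\<Gamma>\<close>.\<close>
  obtain \<Gamma> where \<Gamma>: "0 \<le> \<Gamma>" "\<And>t z. (\<beta> + 1) powr (- \<sigma>) \<le> t \<Longrightarrow> t \<le> V \<Longrightarrow> \<delta> \<le> z \<Longrightarrow> z \<le> M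
      \<Longrightarrow> \<mu> * t powr A * z powr (q / 2) + K * z / t \<le> \<Gamma>"
  proof -
    have \<beta>1: "0 < (\<beta> + 1) powr (- \<sigma>)" using \<beta>[of 0] u_lower[of 0] \<alpha> R by simp
    have "continuous_on ({(\<beta> + 1) powr (- \<sigma>)..V} \<times> {\<delta>..M}) (\<lambda>(t, z). \<mu> * t powr A * z powr (q / 2) + K * z / t)"
      unfolding split_beta using \<beta>1 \<delta> by (intro continuous_intros) auto
    then have "bounded ((\<lambda>(t, z). \<mu> * t powr A * z powr (q / 2) + K * z / t) ` ({(\<beta> + 1) powr (- \<sigma>)..V} \<times> {\<delta>..M}))"
      by (intro compact_imp_bounded compact_continuous_image compact_Times) auto
    then obtain \<Gamma> where "\<And>t z. (\<beta> + 1) powr (- \<sigma>) \<le> t \<Longrightarrow> t \<le> V \<Longrightarrow> \<delta> \<le> z \<Longrightarrow> z \<le> M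
      \<Longrightarrow> \<bar>\<mu> * t powr A * z powr (q / 2) + K * z / t\<bar> \<le> \<Gamma>"
      unfolding bounded_iff by fastforce
    then show ?thesis by (intro that[of "max 0 \<Gamma>"]) (auto simp: abs_le_iff le_max_iff_disj)
  qed
  define X where "X = M ^ m * (3 * \<Gamma> + 1 + 2 * m + sqrt M * (2 * n / R))"
  have X: "0 \<le> X" unfolding X_def using M \<Gamma>(1) R by (intro mult_nonneg_nonneg add_nonneg_nonneg zero_le_power) auto
  define Y where "Y = X * (\<omega> * R ^ DIM('a))"
  have Y: "0 \<le> Y" unfolding Y_def using X \<omega> R by (intro mult_nonneg_nonneg) auto
  define \<eta> where "\<eta> = min 1 (\<kappa>0 / (2 * (Y + 1)))"
  have \<eta>: "0 < \<eta>" "\<eta> \<le> 1" using \<kappa>0 Y by (auto simp: \<eta>_def)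
  have \<eta>Y: "\<eta> * Y \<le> \<kappa>0 / 2"
  proof -
    have "\<eta> * Y \<le> \<kappa>0 / (2 * (Y + 1)) * (Y + 1)" using Y \<kappa>0 by (intro mult_mono) (auto simp: \<eta>_def)
    also have "\<dots> = \<kappa>0 / 2" using Y by (simp add: field_simps)
    finally show ?thesis .
  qed
  define S where "S = \<sigma> * \<alpha> powr (- \<sigma> - 1)"
  have S: "0 < S" using \<sigma> \<alpha> by (simp add: S_def)
  \<comment> \<open>\<open>S\<close> bounds \<open>|\<nabla>v| / |\<nabla>U|\<close>, so
    \<open>Z > \<delta>\<close> forces \<open>|\<nabla>U| \<ge> 2 * \<tau>\<close>. The factor 2
    leaves \<open>|\<nabla>u| \<ge> \<tau>\<close> on the averaging ball, away from the singularity
    for \<open>q < 0\<close>.\<close>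
  define \<tau> where "\<tau> = sqrt \<delta> / (2 * S)"
  have \<tau>: "0 < \<tau>" using \<delta> S by (simp add: \<tau>_def)
  have "compact ({\<alpha>..\<beta> + 1} \<times> {\<tau>..T + 1})" by (intro compact_Times) auto
  moreover have "continuous_on ({\<alpha>..\<beta> + 1} \<times> {\<tau>..T + 1}) (\<lambda>(s, t). s powr p * t powr q)"
    unfolding split_beta using \<alpha> \<tau> by (intro continuous_intros) auto
  ultimately have "uniformly_continuous_on ({\<alpha>..\<beta> + 1} \<times> {\<tau>..T + 1}) (\<lambda>(s, t). s powr p * t powr q)"
    by (rule compact_uniformly_continuous[rotated])
  moreover have "0 < \<eta> / S" using \<eta> S by simp
  \<comment> \<open>The tolerance \<open>\<eta> / S\<close> anticipates the factor, at most
    \<open>S\<close>, in front of the defect in \<open>neg_pow_residual\<close>.\<close>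
  ultimately obtain d where d: "0 < d" "\<And>s t s' t'. s \<in> {\<alpha>..\<beta> + 1} \<Longrightarrow> t \<in> {\<tau>..T + 1} \<Longrightarrow> s' \<in> {\<alpha>..\<beta> + 1} \<Longrightarrow> t' \<in> {\<tau>..T + 1}
      \<Longrightarrow> dist (s', t') (s, t) < d \<Longrightarrow> \<bar>s' powr p * t' powr q - s powr p * t powr q\<bar> < \<eta> / S"
    unfolding uniformly_continuous_on_def dist_real_def by (auto 0 3)
  \<comment> \<open>\<open>\<alpha>\<close> keeps \<open>U \<ge> \<alpha>\<close>, as
    \<open>u \<ge> 2 * \<alpha>\<close>; 1 keeps the upper bounds \<open>\<beta> + 1\<close> and
    \<open>T + 1\<close>; with \<open>d / 3\<close> the two errors together stay below
    \<open>d\<close>.\<close>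
  define \<epsilon> where "\<epsilon> = Min {\<alpha>, g, a / 2, \<tau>, 1, d / 3}"
  have \<epsilon>: "0 < \<epsilon>" "\<epsilon> \<le> \<alpha>" "\<epsilon> \<le> g" "\<epsilon> \<le> a / 2" "\<epsilon> \<le> \<tau>" "\<epsilon> \<le> 1" "\<epsilon> \<le> d / 3"
    using \<alpha> gab \<tau> d by (auto simp: \<epsilon>_def)
  obtain r U where r: "0 < r" "r \<le> 1" and U: "mollified p q u r U"
    and close: "\<And>x y. norm x \<le> R \<Longrightarrow> y \<in> cball x r \<Longrightarrow> \<bar>u y - U (\<lambda>_. 0) x\<bar> \<le> \<epsilon>"
      "\<And>x y. norm x \<le> R \<Longrightarrow> y \<in> cball x r \<Longrightarrow> norm (gradient u y - grad_of U x) \<le> \<epsilon>"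
    using mollified_close[OF sol \<epsilon>(1)] by metis
  have U_cont: "continuous_on UNIV (U \<gamma>)" for \<gamma> using U by (simp add: mollified_def)
  have U_part: "has_partial (U \<gamma>) e (U (incr \<gamma> e))" if "e \<in> Basis" for \<gamma> e using U that by (simp add: mollified_def)
  have U_pos: "0 < U (\<lambda>_. 0) x" for x
  proof -
    have "compact (cball x r)" "cball x r \<noteq> {}" "continuous_on (cball x r) u"
      using r continuous_on_subset[OF solution_continuous(1)[OF sol]] by auto
    from continuous_attains_sup[OF this] continuous_attains_inf[OF this]
    obtain hi z where "\<forall>y\<in>cball x r. u y \<le> hi" "\<forall>y\<in>cball x r. u z \<le> u y" by blast
    then have "u z \<le> U (\<lambda>_. 0) x" using U unfolding mollified_def by blast
    then show ?thesis using solution_pos[OF sol, of z] by simp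
  qed
  have at_x: "\<bar>u x - U (\<lambda>_. 0) x\<bar> \<le> \<epsilon>" "\<bar>norm (gradient u x) - norm (grad_of U x)\<bar> \<le> \<epsilon>" if "norm x \<le> R" for x
    using close[OF that, of x] r norm_triangle_ineq3[of "gradient u x" "grad_of U x"] by auto
  have U_bounds: "\<alpha> \<le> U (\<lambda>_. 0) x" "U (\<lambda>_. 0) x \<le> \<beta> + 1" "norm (grad_of U x) \<le> T + 1" if "norm x \<le> R" for x
    using at_x[OF that] u_lower[of x] \<beta>[of x] T[of x] that \<epsilon> by (auto simp: abs_le_iff)
  have Z: "smooth_field.grad_sq (neg_pow1 \<sigma> U) x = (\<sigma> * U (\<lambda>_. 0) x powr (- \<sigma> - 1) * norm (grad_of U x))\<^sup>2" for x
    by (rule neg_pow_grad_sq[OF \<sigma>(1) U_pos U_cont U_part])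
  have powr_le: "U (\<lambda>_. 0) x powr (- \<sigma> - 1) \<le> \<alpha> powr (- \<sigma> - 1)" "neg_pow \<sigma> U x \<le> V" if "norm x \<le> R" for x
    using U_bounds(1)[OF that] \<alpha> \<sigma> by (auto simp: neg_pow_def V_M_def intro!: powr_mono2')
  have Z_le: "smooth_field.grad_sq (neg_pow1 \<sigma> U) x \<le> M" if "norm x \<le> R" for x
    unfolding Z V_M_def using powr_le(1)[OF that] U_bounds(3)[OF that] \<sigma>
    by (intro power_mono mult_mono mult_left_mono) auto
  have grad_large: "2 * \<tau> \<le> norm (grad_of U x)" if x: "norm x \<le> R" and z: "\<delta> < smooth_field.grad_sq (neg_pow1 \<sigma> U) x" for x
  proof -
    have "sqrt \<delta> \<le> sqrt ((\<sigma> * U (\<lambda>_. 0) x powr (- \<sigma> - 1) * norm (grad_of U x))\<^sup>2)"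
      using z unfolding Z by (intro real_sqrt_le_mono) simp
    also have "\<dots> = \<sigma> * U (\<lambda>_. 0) x powr (- \<sigma> - 1) * norm (grad_of U x)" using \<sigma> by simp
    also have "\<dots> \<le> S * norm (grad_of U x)"
      unfolding S_def using powr_le(1)[OF x] \<sigma> by (intro mult_right_mono mult_left_mono) auto
    finally show ?thesis using S by (simp add: \<tau>_def pos_divide_le_eq mult.commute)
  qed
  \<comment> \<open>Every source value entering the average at \<open>x\<close> is within
    \<open>\<eta> / S\<close> of the expression in \<open>U\<close>, hence so is the
    average.\<close>
  have residual: "\<bar>- (\<Sum>e\<in>Basis. U (incr (incr (\<lambda>_. 0) e) e) x) - U (\<lambda>_. 0) x powr p * norm (grad_of U x) powr q\<bar> \<le> \<eta> / S"
    if x: "norm x \<le> R" and large: "2 * \<tau> \<le> norm (grad_of U x)" for x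
  proof -
    define \<Phi> where "\<Phi> = U (\<lambda>_. 0) x powr p * norm (grad_of U x) powr q"
    have "\<Phi> - \<eta> / S \<le> enn2real (source p q u y) \<and> enn2real (source p q u y) \<le> \<Phi> + \<eta> / S" if y: "y \<in> cball x r" for y
    proof -
      have cl: "\<bar>u y - U (\<lambda>_. 0) x\<bar> \<le> \<epsilon>" "\<bar>norm (gradient u y) - norm (grad_of U x)\<bar> \<le> \<epsilon>"
        using close[OF x y] norm_triangle_ineq3[of "gradient u y" "grad_of U x"] by auto
      have ny: "norm y \<le> R + 1" using y r x norm_triangle_sub[of y x] by (simp add: dist_norm norm_minus_commute)
      have gy: "\<tau> \<le> norm (gradient u y)" using cl large \<epsilon> by linarith
      then have "gradient u y \<noteq> 0" using \<tau> by auto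
      then have src: "enn2real (source p q u y) = u y powr p * norm (gradient u y) powr q"
        by (simp add: source_def ext_powr_def enn2real_mult)
      have "dist (u y, norm (gradient u y)) (U (\<lambda>_. 0) x, norm (grad_of U x)) \<le> \<epsilon> + \<epsilon>"
        unfolding dist_Pair_Pair using cl
        by (intro order_trans[OF sqrt_sum_squares_le_sum_abs] add_mono) (auto simp: dist_real_def)
      also have "\<dots> < d" using \<epsilon> by linarith
      finally have "\<bar>u y powr p * norm (gradient u y) powr q - \<Phi>\<bar> < \<eta> / S"
        unfolding \<Phi>_def using u_lower[OF ny] \<beta>[OF ny] T[OF ny] gy U_bounds[OF x] large \<alpha> \<tau>
        by (intro d(2)) auto
      then show ?thesis unfolding src by (auto simp: abs_less_iff)
    qed
    then have "\<Phi> - \<eta> / S \<le> - (\<Sum>e\<in>Basis. U (incr (incr (\<lambda>_. 0) e) e) x)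
        \<and> - (\<Sum>e\<in>Basis. U (incr (incr (\<lambda>_. 0) e) e) x) \<le> \<Phi> + \<eta> / S"
      using U unfolding mollified_def by blast
    then show ?thesis unfolding \<Phi>_def[symmetric] by (auto simp: abs_le_iff)
  qed

  have "bernstein (neg_pow \<sigma> U) (neg_pow1 \<sigma> U) (neg_pow2 \<sigma> U) (neg_pow3 \<sigma> U) K c A \<mu> q \<delta> R \<eta> V M \<Gamma> m n"
  proof (intro bernstein.intro bernstein_axioms.intro)
    show "smooth_field (neg_pow \<sigma> U) (neg_pow1 \<sigma> U) (neg_pow2 \<sigma> U) (neg_pow3 \<sigma> U)"
      by (rule smooth_field_neg_pow[OF \<sigma>(1) U_pos U_cont U_part])
    show "0 < neg_pow \<sigma> U x" for x using U_pos[of x] by (simp add: neg_pow_def)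
    show "\<mu> * neg_pow \<sigma> U x powr A * smooth_field.grad_sq (neg_pow1 \<sigma> U) x powr (q / 2)
        + K * smooth_field.grad_sq (neg_pow1 \<sigma> U) x / neg_pow \<sigma> U x \<le> \<Gamma>"
      if "norm x < R" "\<delta> < smooth_field.grad_sq (neg_pow1 \<sigma> U) x" for x
    proof (rule \<Gamma>(2))
      show "(\<beta> + 1) powr - \<sigma> \<le> neg_pow \<sigma> U x"
        unfolding neg_pow_def using U_bounds[of x] U_pos[of x] \<sigma> that by (intro powr_mono2') auto
    qed (use powr_le(2)[of x] Z_le[of x] that in auto)
    show "\<bar>smooth_field.lap (neg_pow2 \<sigma> U) x - (\<mu> * neg_pow \<sigma> U x powr A * smooth_field.grad_sq (neg_pow1 \<sigma> U) x powr (q / 2)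
        + K * smooth_field.grad_sq (neg_pow1 \<sigma> U) x / neg_pow \<sigma> U x)\<bar> \<le> \<eta>"
      if x: "norm x < R" and z: "\<delta> < smooth_field.grad_sq (neg_pow1 \<sigma> U) x" for x
    proof -
      have x': "norm x \<le> R" using x by simp
      note large = grad_large[OF x' z]
      have "0 < norm (grad_of U x)" using large \<tau> by linarith
      from neg_pow_residual[OF \<sigma>(1) U_pos U_cont U_part this, of q p]
      have "\<bar>smooth_field.lap (neg_pow2 \<sigma> U) x - (\<mu> * neg_pow \<sigma> U x powr A * smooth_field.grad_sq (neg_pow1 \<sigma> U) x powr (q / 2)
        + K * smooth_field.grad_sq (neg_pow1 \<sigma> U) x / neg_pow \<sigma> U x)\<bar>
        = \<sigma> * U (\<lambda>_. 0) x powr (- \<sigma> - 1) * \<bar>- (\<Sum>e\<in>Basis. U (incr (incr (\<lambda>_. 0) e) e) x)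
            - U (\<lambda>_. 0) x powr p * norm (grad_of U x) powr q\<bar>"
        using \<sigma> unfolding KcA by (simp add: abs_mult)
      also have "\<dots> \<le> S * (\<eta> / S)"
        unfolding S_def using powr_le(1)[OF x'] \<sigma> residual[OF x' large]
        by (intro mult_mono mult_left_mono) (auto simp: S_def)
      finally show ?thesis using S by simp
    qed
  qed (use K KcA cnst \<sigma> m n_def \<delta> R(1) \<eta> powr_le(2) Z_le \<Gamma>(1) in auto)
  then interpret B: bernstein "neg_pow \<sigma> U" "neg_pow1 \<sigma> U" "neg_pow2 \<sigma> U" "neg_pow3 \<sigma> U" K c A \<mu> q \<delta> R \<eta> V M \<Gamma> m n .

  have "\<kappa> \<le> cutoff R x ^ n * max 0 (B.grad_sq x - \<delta>) ^ m * (c / 4 * (B.grad_sq x)\<^sup>2 / (neg_pow \<sigma> U x)\<^sup>2)"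
    if x: "x \<in> ball x0 r1" for x
  proof -
    have nx: "norm x \<le> R / 2" using x R(2) norm_triangle_sub[of x x0] by (simp add: dist_norm norm_minus_commute)
    then have xR: "norm x \<le> R" using R(1) by linarith
    have loc: "2 * g < norm (gradient u x)" "a < u x" "u x < b" using r1(2) x by auto
    have Ux: "a / 2 \<le> U (\<lambda>_. 0) x" "U (\<lambda>_. 0) x \<le> 2 * b" "g \<le> norm (grad_of U x)"
      using at_x[OF xR] loc \<epsilon> gab by (auto simp: abs_le_iff)
    have "2 * \<delta> = (\<sigma> * (2 * b) powr (- \<sigma> - 1) * g)\<^sup>2" by (simp add: \<delta>_def)
    also have "\<dots> \<le> B.grad_sq x"
      unfolding Z using Ux gab \<sigma> U_pos[of x] by (intro power_mono mult_mono mult_left_mono powr_mono2') auto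
    finally have z: "2 * \<delta> \<le> B.grad_sq x" .
    have cut: "3 / 4 \<le> cutoff R x"
    proof -
      have "(norm x)\<^sup>2 \<le> (R / 2)\<^sup>2" using nx by (intro power_mono) auto
      then have "(norm x)\<^sup>2 / R\<^sup>2 \<le> 1 / 4" using R(1) by (simp add: power_divide pos_divide_le_eq)
      then show ?thesis unfolding cutoff_def by (intro max.coboundedI2) linarith
    qed
    have w: "\<delta> ^ m \<le> max 0 (B.grad_sq x - \<delta>) ^ m" using z \<delta> by (intro power_mono) auto
    have f: "c / 4 * (2 * \<delta>)\<^sup>2 / ((a / 2) powr (- \<sigma>))\<^sup>2 \<le> c / 4 * (B.grad_sq x)\<^sup>2 / (neg_pow \<sigma> U x)\<^sup>2"
    proof (rule frac_le)
      show "c / 4 * (2 * \<delta>)\<^sup>2 \<le> c / 4 * (B.grad_sq x)\<^sup>2"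
        using z \<delta> cnst(2) by (intro mult_left_mono power_mono) auto
      show "(neg_pow \<sigma> U x)\<^sup>2 \<le> ((a / 2) powr (- \<sigma>))\<^sup>2"
        unfolding neg_pow_def using Ux gab \<sigma> by (intro power_mono powr_mono2') auto
    qed (use cnst(2) B.v_pos[of x] in auto)
    have "(3 / 4) ^ n \<le> cutoff R x ^ n" using cut by (intro power_mono) auto
    with w f show ?thesis
      unfolding \<kappa>_def using \<delta> cnst(2) cutoff_bounds(1)[of R x]
      by (intro mult_mono) auto
  qed
  then have "\<kappa>0 \<le> B.C * measure lborel (ball (0::'a) R)"
    unfolding \<kappa>0_def by (rule B.local_estimate)
  also have "measure lborel (ball (0::'a) R) = \<omega> * R ^ DIM('a)"
    using R(1) by (simp add: content_ball \<omega>_def)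
  also have "B.C * (\<omega> * R ^ DIM('a)) = (4 * V\<^sup>2 / c) ^ (m + 1) * (2 * n\<^sup>2 / (m * R\<^sup>2)) ^ (m + 2) * (\<omega> * R ^ DIM('a)) + \<eta> * Y"
    unfolding B.C_def Y_def X_def by (simp add: distrib_right)
  also have "\<dots> < \<kappa>0 / 2 + \<kappa>0 / 2"
    using R(3) \<eta>Y unfolding V_M_def \<alpha>_def by (rule add_less_le_mono)
  finally show False by simp
qed

lemma gradient_zero_constant:
  fixes u :: "'a::euclidean_space \<Rightarrow> real"
  assumes C1: "C_k 1 u" and grad: "\<And>x. gradient u x = 0"
  shows "u constant_on UNIV"
proof -
  have "(u has_derivative (\<lambda>h. 0)) (at x)" for x
  proof -
    have d: "(u has_derivative frechet_derivative u (at x)) (at x)"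
      using C1 by (simp add: frechet_derivative_works[symmetric])
    have "frechet_derivative u (at x) b = 0" if "b \<in> Basis" for b
      using gradient_inner[OF that, of u x] grad[of x] by simp
    then have "frechet_derivative u (at x) = (\<lambda>h. 0)"
      by (intro linear_eq_stdbasis has_derivative_linear[OF d] linear_zero) auto
    then show ?thesis using d by simp
  qed
  then have "u x = u 0" for x
    using has_derivative_zero_unique[of UNIV u 0 x] by auto
  then show ?thesis unfolding constant_on_def by blast
qed

theorem theorem1p5:
  fixes p q \<sigma> :: real and N :: nat
  assumes "CARD('n::finite) = N"
    and "N \<ge> 2"
    and "p + (1 + \<sigma>) * q < (real N + 2) / real N + \<sigma>"
    and "0 < \<sigma>"
    and "\<sigma> < 1 / 4 * (sqrt ((real N + 8) / real N) - 1)"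
  shows "\<not> (\<exists>u :: real ^ 'n \<Rightarrow> real. positive_weak_solution p q u \<and> \<not> u constant_on UNIV)"
proof
  assume "\<exists>u :: real ^ 'n \<Rightarrow> real. positive_weak_solution p q u \<and> \<not> u constant_on UNIV"
  then obtain u :: "real ^ 'n \<Rightarrow> real" where sol: "positive_weak_solution p q u" and nc: "\<not> u constant_on UNIV"
    by blast
  have grad: "gradient u x = 0" for x
    by (rule liouville_gradient_zero[OF sol]) (use assms in simp_all)
  have "C_k 1 u" using sol by (simp add: positive_weak_solution_def)
  from gradient_zero_constant[OF this grad] nc show False by contradiction
qed

end
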